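(* Suppose that a finite group $\Gamma$ acts smoothly and effectively on the circle $S^1$. Let $f$ be a $\Gamma$-invariant Morse function on $S^1$. Let $\mathrm{Met}^{\Gamma}$ denote the set of $\Gamma$-invariant Riemannian metrics on $S^1$, endowed with the $C^\infty$ topology. There exists a dense and open subset $\mathrm{Met}_f\subset \mathrm{Met}^{\Gamma}$ such that for every $g\in \mathrm{Met}_f$ we have $\operatorname{Aut}(\nabla^g f)/\mathbb{R}\simeq\Gamma$.
   Context: For a Riemannian metric $g$, $\nabla^g f$ is the gradient vector field, defined by $g(\nabla^g f,v)=df(v)$ for every tangent vector $v$. For a vector field $\mathcal{X}$ on a manifold $M$, $\operatorname{Aut}(\mathcal{X})=\{\phi\in\operatorname{Diff}(M)\mid \phi_*\mathcal{X}=\mathcal{X}\}$. For nonzero gradient fields the flow of $\mathcal{X}$ gives a central subgroup of $\operatorname{Aut}(\mathcal{X})$ isomorphic to $\mathbb{R}$, and $\operatorname{Aut}(\mathcal{X})/\mathbb{R}$ denotes the quotient by this subgroup. *)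

theory Defs
  imports "HOL-Analysis.Analysis" "HOL-Algebra.Group_Action"
begin

section \<open>Smooth analysis on the circle\<close>

text \<open>The circle is the unit circle in \<open>\<complex>\<close>, with the angular coordinate \<^term>\<open>cis\<close>, whose
  local inverses are the charts of its standard smooth structure. Functions on the circle are
  functions on \<open>\<complex>\<close> of which only the values on the circle are used.\<close>

abbreviation circle :: "complex set" where
  "circle \<equiv> sphere 0 1"

definition vderiv :: "(real \<Rightarrow> 'a::real_normed_vector) \<Rightarrow> real \<Rightarrow> 'a" where
  "vderiv F = (\<lambda>t. vector_derivative F (at t))"

definition smooth_line :: "(real \<Rightarrow> 'a::real_normed_vector) \<Rightarrow> bool" where
  "smooth_line F \<longleftrightarrow> (\<forall>n t. (vderiv ^^ n) F differentiable at t)"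

definition smooth_circle :: "(complex \<Rightarrow> 'a::real_normed_vector) \<Rightarrow> bool" where
  "smooth_circle F \<longleftrightarrow> smooth_line (\<lambda>t. F (cis t))"

definition tangent_circle :: "complex \<Rightarrow> complex set" where
  "tangent_circle z = {v. v \<bullet> z = 0}"

text \<open>For \<open>v\<close> tangent to the circle at \<open>z\<close> the quotient \<open>v / z\<close> is imaginary, so
  \<open>t \<mapsto> z exp (t v / z)\<close> is a curve in the circle through \<open>z\<close> with velocity \<open>v\<close> at time \<open>0\<close>.\<close>

definition differential ::
    "(complex \<Rightarrow> 'a::real_normed_vector) \<Rightarrow> complex \<Rightarrow> complex \<Rightarrow> 'a" where
  "differential F z v = vector_derivative (\<lambda>t. F (z * exp (of_real t * v / z))) (at 0)"

definition Diff_circle :: "(complex \<Rightarrow> complex) set" where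
  "Diff_circle = {\<phi> \<in> Bij circle. smooth_circle \<phi> \<and> smooth_circle (inv_into circle \<phi>)}"

text \<open>A critical point is nondegenerate if the Hessian in the angular coordinate is nonzero.\<close>

definition Morse_circle :: "(complex \<Rightarrow> real) \<Rightarrow> bool" where
  "Morse_circle f \<longleftrightarrow> smooth_circle f \<and>
     (\<forall>t. (\<forall>v \<in> tangent_circle (cis t). differential f (cis t) v = 0)
            \<longrightarrow> (vderiv ^^ 2) (\<lambda>s. f (cis s)) t \<noteq> 0)"


section \<open>Riemannian metrics and gradients\<close>

text \<open>The coefficient of a bilinear form field with respect to the angular coordinate; the
  velocity of \<^term>\<open>cis\<close> at \<open>t\<close> is \<open>\<i> cis t\<close>.\<close>

definition metric_coeff :: "(complex \<Rightarrow> complex \<Rightarrow> complex \<Rightarrow> real) \<Rightarrow> real \<Rightarrow> real" where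
  "metric_coeff g t = g (cis t) (\<i> * cis t) (\<i> * cis t)"

text \<open>By convention a metric takes the value \<open>0\<close> off the tangent bundle, so that metrics are equal
  if they agree on tangent vectors.\<close>

definition Met_circle :: "(complex \<Rightarrow> complex \<Rightarrow> complex \<Rightarrow> real) set" where
  "Met_circle = {g.
     (\<forall>z \<in> circle.
        (\<forall>v \<in> tangent_circle z. \<forall>w \<in> tangent_circle z. g z v w = g z w v) \<and>
        (\<forall>u \<in> tangent_circle z. \<forall>v \<in> tangent_circle z. \<forall>w \<in> tangent_circle z. \<forall>a b.
           g z (a *\<^sub>R u + b *\<^sub>R v) w = a * g z u w + b * g z v w) \<and>
        (\<forall>v \<in> tangent_circle z. v \<noteq> 0 \<longrightarrow> g z v v > 0)) \<and>
     smooth_line (metric_coeff g) \<and>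
     (\<forall>z v w. \<not> (z \<in> circle \<and> v \<in> tangent_circle z \<and> w \<in> tangent_circle z) \<longrightarrow> g z v w = 0)}"

definition Cinf_ball ::
    "(complex \<Rightarrow> complex \<Rightarrow> complex \<Rightarrow> real) \<Rightarrow> nat \<Rightarrow> real
      \<Rightarrow> (complex \<Rightarrow> complex \<Rightarrow> complex \<Rightarrow> real) set" where
  "Cinf_ball g N e = {h \<in> Met_circle. \<forall>k \<le> N. \<forall>t.
     \<bar>(vderiv ^^ k) (metric_coeff h) t - (vderiv ^^ k) (metric_coeff g) t\<bar> < e}"

definition Cinf_topology :: "(complex \<Rightarrow> complex \<Rightarrow> complex \<Rightarrow> real) topology" where
  "Cinf_topology = topology (\<lambda>U. U \<subseteq> Met_circle \<and> (\<forall>g \<in> U. \<exists>N. \<exists>e > 0. Cinf_ball g N e \<subseteq> U))"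

lemma openin_Cinf_topology:
  "openin Cinf_topology U \<longleftrightarrow>
     U \<subseteq> Met_circle \<and> (\<forall>g \<in> U. \<exists>N. \<exists>e > 0. Cinf_ball g N e \<subseteq> U)"
proof -
  let ?P = "\<lambda>U. U \<subseteq> Met_circle \<and> (\<forall>g \<in> U. \<exists>N. \<exists>e > 0. Cinf_ball g N e \<subseteq> U)"
  have "istopology ?P"
    unfolding istopology_def
  proof (intro conjI allI impI)
    fix S T assume S: "?P S" and T: "?P T"
    show "S \<inter> T \<subseteq> Met_circle" using S by blast
    show "\<forall>g \<in> S \<inter> T. \<exists>N. \<exists>e > 0. Cinf_ball g N e \<subseteq> S \<inter> T"
    proof
      fix g assume "g \<in> S \<inter> T"
      then obtain M d N e where
        *: "d > 0" "Cinf_ball g M d \<subseteq> S" "e > 0" "Cinf_ball g N e \<subseteq> T"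
        using S T by (meson IntD1 IntD2)
      have "Cinf_ball g (max M N) (min d e) \<subseteq> Cinf_ball g M d \<inter> Cinf_ball g N e"
        unfolding Cinf_ball_def by (auto simp: le_max_iff_disj)
      with * show "\<exists>N. \<exists>e > 0. Cinf_ball g N e \<subseteq> S \<inter> T"
        by (intro exI[of _ "max M N"] exI[of _ "min d e"]) auto
    qed
  next
    fix K assume K: "\<forall>S \<in> K. ?P S"
    show "\<Union> K \<subseteq> Met_circle" using K by blast
    show "\<forall>g \<in> \<Union> K. \<exists>N. \<exists>e > 0. Cinf_ball g N e \<subseteq> \<Union> K"
      using K by (meson UnionE Sup_upper order_trans)
  qed
  then show ?thesis
    unfolding Cinf_topology_def by (simp add: topology_inverse')
qed

definition gradient ::
    "(complex \<Rightarrow> complex \<Rightarrow> complex \<Rightarrow> real) \<Rightarrow> (complex \<Rightarrow> real) \<Rightarrow> complex \<Rightarrow> complex" where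
  "gradient g f z = (THE x. x \<in> tangent_circle z \<and>
     (\<forall>v \<in> tangent_circle z. g z x v = differential f z v))"


section \<open>Automorphisms of vector fields\<close>

definition pushforward ::
    "(complex \<Rightarrow> complex) \<Rightarrow> (complex \<Rightarrow> complex) \<Rightarrow> complex \<Rightarrow> complex" where
  "pushforward \<phi> V w =
     differential \<phi> (inv_into circle \<phi> w) (V (inv_into circle \<phi> w))"

definition Aut_field :: "(complex \<Rightarrow> complex) \<Rightarrow> (complex \<Rightarrow> complex) monoid" where
  "Aut_field V = BijGroup circle
     \<lparr>carrier := {\<phi> \<in> Diff_circle. \<forall>w \<in> circle. pushforward \<phi> V w = V w}\<rparr>"

definition integral_curve :: "(complex \<Rightarrow> complex) \<Rightarrow> complex \<Rightarrow> (real \<Rightarrow> complex) \<Rightarrow> bool" where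
  "integral_curve V z c \<longleftrightarrow>
     c 0 = z \<and> (\<forall>t. c t \<in> circle \<and> (c has_vector_derivative V (c t)) (at t))"

text \<open>A smooth vector field on the circle is complete, so its integral curves are defined on all
  of \<open>\<real>\<close>. Elements of \<^term>\<open>Bij circle\<close> are extensional, hence the restriction.\<close>

definition flow :: "(complex \<Rightarrow> complex) \<Rightarrow> real \<Rightarrow> complex \<Rightarrow> complex" where
  "flow V t = restrict (\<lambda>z. (THE c. integral_curve V z c) t) circle"


section \<open>Smooth effective actions and invariance\<close>

definition smooth_effective_action ::
    "('a, 'b) monoid_scheme \<Rightarrow> ('a \<Rightarrow> complex \<Rightarrow> complex) \<Rightarrow> bool" where
  "smooth_effective_action \<Gamma> \<alpha> \<longleftrightarrow>
     faithful_action \<Gamma> circle \<alpha> \<and> (\<forall>\<gamma> \<in> carrier \<Gamma>. smooth_circle (\<alpha> \<gamma>))"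

definition invariant_function ::
    "('a, 'b) monoid_scheme \<Rightarrow> ('a \<Rightarrow> complex \<Rightarrow> complex) \<Rightarrow> (complex \<Rightarrow> real) \<Rightarrow> bool" where
  "invariant_function \<Gamma> \<alpha> f \<longleftrightarrow> (\<forall>\<gamma> \<in> carrier \<Gamma>. \<forall>z \<in> circle. f (\<alpha> \<gamma> z) = f z)"

definition Met_inv ::
    "('a, 'b) monoid_scheme \<Rightarrow> ('a \<Rightarrow> complex \<Rightarrow> complex)
      \<Rightarrow> (complex \<Rightarrow> complex \<Rightarrow> complex \<Rightarrow> real) set" where
  "Met_inv \<Gamma> \<alpha> = {g \<in> Met_circle. \<forall>\<gamma> \<in> carrier \<Gamma>. \<forall>z \<in> circle.
     \<forall>v \<in> tangent_circle z. \<forall>w \<in> tangent_circle z.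
       g (\<alpha> \<gamma> z) (differential (\<alpha> \<gamma>) z v) (differential (\<alpha> \<gamma>) z w) = g z v w}"

definition Met_inv_topology ::
    "('a, 'b) monoid_scheme \<Rightarrow> ('a \<Rightarrow> complex \<Rightarrow> complex)
      \<Rightarrow> (complex \<Rightarrow> complex \<Rightarrow> complex \<Rightarrow> real) topology" where
  "Met_inv_topology \<Gamma> \<alpha> = subtopology Cinf_topology (Met_inv \<Gamma> \<alpha>)"

end

theory Submission
  imports Defs "HOL-Algebra.Multiplicative_Group"
begin

text \<open>
  In the angular coordinate the gradient field is \<open>X d/dt\<close> with \<open>X = a / G\<close>, where \<open>a\<close> is the
  derivative of the function and \<open>G\<close> is the coefficient of the metric. Its zeros are the critical
  points; they are simple, and \<open>a' / G\<close> is the multiplier of the field at a zero. An automorphism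
  has a lift \<open>L\<close> to the line with \<open>L' X = X \<circ> L\<close>; it permutes the critical points and keeps their
  multipliers.

  The proof rests on the one-form \<open>(G / a) dt\<close> dual to the field. It has simple poles with the
  inverse multipliers as residues. A primitive of it outside the poles is a time function for
  the field. It is determined up to one constant for all arcs together, if its logarithmic
  singularity at each pole is required to have a limit after subtraction of the residue times
  \<open>ln \<bar>t - p\<bar>\<close> (\<open>const_off_zeros\<close>). An automorphism respects this normalization and therefore
  changes the time function by a constant (\<open>symmetry_time\<close>). Two consequences follow. First, an
  orientation preserving automorphism that fixes a critical point is a flow map
  (\<open>preserving_fixing_imp_flow\<close>), because the flow contains a map with the same constant. Second, the
  increment of the time function around the circle, which is the principal value of the integral of the
  form, vanishes if there is an orientation reversing automorphism (\<open>reversing_imp_period_0\<close>),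
  because such a map changes its sign.

  Fix a critical point \<open>p\<close> that is a fixed point of an orientation reversing element of the group,
  if there is such an element. A metric is called generic if no critical point outside the orbit of
  \<open>p\<close> has the multiplier of \<open>p\<close> and if, for a group that preserves the orientation, the principal
  value is not zero. For a generic metric, an automorphism can be composed with group elements
  until it preserves the orientation and fixes \<open>p\<close>, and then it is a flow map (\<open>generic_cover\<close>).
  A flow map of finite order is trivial, so the group is a complement of the flow.

  The generic metrics are those on which finitely many linear functionals do not vanish. These
  functionals are continuous for the \<open>C\<^sup>2\<close> norm, since two integrations by parts turn the principal value
  into an integral of a continuous function that involves at most two derivatives of \<open>G\<close>. This
  gives openness. For density, a metric is moved in the direction of its product with an invariant
  function on which all the functionals are nonzero (\<open>direction_ex\<close>). For the principal value,
  such a function is the derivative of \<open>f\<close> along the unit tangent vectors, for which the form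
  becomes the length element.

  The flow exists because the time function maps each arc between zeros onto the line
  (\<open>trajectory_ex\<close>), and it is smooth because it lies in a class of functions that is
  closed under differentiation with respect to the initial value (\<open>flow_expr_has_derivative\<close>).
\<close>

section \<open>Smooth functions of a real variable\<close>

lemma smooth_line_has_vderiv:
  assumes "smooth_line F" shows "(F has_vector_derivative vderiv F t) (at t)"
  using assms[unfolded smooth_line_def, rule_format, of 0 t]
  by (simp add: vderiv_def vector_derivative_works)

lemma smooth_line_has_real_derivative:
  fixes F :: "real \<Rightarrow> real"
  assumes "smooth_line F" shows "(F has_real_derivative vderiv F t) (at t)"
  using smooth_line_has_vderiv[OF assms]
  by (simp add: has_real_derivative_iff_has_vector_derivative)

lemma vderivI:
  "(\<And>t. (F has_vector_derivative F' t) (at t)) \<Longrightarrow> vderiv F = F'"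
  by (auto simp: vderiv_def fun_eq_iff intro: vector_derivative_at)

lemma vderiv_realI:
  fixes F :: "real \<Rightarrow> real"
  shows "(\<And>t. (F has_real_derivative F' t) (at t)) \<Longrightarrow> vderiv F = F'"
  by (rule vderivI) (simp add: has_real_derivative_iff_has_vector_derivative)

lemma smooth_line_vderiv: "smooth_line F \<Longrightarrow> smooth_line (vderiv F)"
  unfolding smooth_line_def by (metis funpow_Suc_right o_apply)

lemma smooth_line_vderiv_funpow: "smooth_line F \<Longrightarrow> smooth_line ((vderiv ^^ k) F)"
  by (induction k) (auto intro: smooth_line_vderiv)

text \<open>All iterated derivatives stay in a class that is closed under differentiation. The closure
  properties below and the smoothness of the flow are obtained from suitable classes.\<close>

lemma smooth_line_coinduct:
  assumes "R F" and step: "\<And>F. R F \<Longrightarrow> \<exists>F'. R F' \<and> (\<forall>t. (F has_vector_derivative F' t) (at t))"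
  shows "smooth_line F"
proof -
  have R_vderiv: "R (vderiv F)" if "R F" for F
    using step[OF that] vderivI by metis
  have "R ((vderiv ^^ n) F)" for n
    by (induction n) (auto intro: R_vderiv \<open>R F\<close>)
  then show ?thesis
    unfolding smooth_line_def by (meson step differentiableI_vector)
qed

lemma smooth_line_if_derivative:
  assumes "\<And>t. (F has_vector_derivative F' t) (at t)" "smooth_line F'"
  shows "smooth_line F"
proof (rule smooth_line_coinduct[where R = "\<lambda>H. H = F \<or> smooth_line H"])
  fix H assume "H = F \<or> smooth_line H"
  then show "\<exists>H'. (H' = F \<or> smooth_line H') \<and> (\<forall>t. (H has_vector_derivative H' t) (at t))"
    using assms smooth_line_vderiv[of H] smooth_line_has_vderiv[of H] by metis
qed simp

lemma smooth_line_real_if_derivative: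
  fixes F :: "real \<Rightarrow> real"
  assumes "\<And>t. (F has_real_derivative F' t) (at t)" "smooth_line F'"
  shows "smooth_line F"
  by (rule smooth_line_if_derivative[where F' = F'])
    (simp_all add: assms has_real_derivative_iff_has_vector_derivative[symmetric])

lemma smooth_line_continuous: "smooth_line F \<Longrightarrow> continuous_on S F"
  by (intro continuous_at_imp_continuous_on ballI has_vector_derivative_continuous[OF smooth_line_has_vderiv])

lemma smooth_line_isCont: "smooth_line F \<Longrightarrow> isCont F t"
  using has_vector_derivative_continuous smooth_line_has_vderiv by blast

lemma smooth_line_const [simp]: "smooth_line (\<lambda>_. c)"
  by (rule smooth_line_coinduct[where R = "\<lambda>H. \<exists>c. H = (\<lambda>_. c)"]) (auto intro!: derivative_eq_intros)

lemma smooth_line_ident [simp]: "smooth_line (\<lambda>t::real. t)"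
  by (rule smooth_line_real_if_derivative[where F' = "\<lambda>_. 1"]) (auto intro!: derivative_eq_intros)

lemma smooth_line_sin_cos: "smooth_line (\<lambda>t::real. a * sin t + b * cos t)"
proof (rule smooth_line_coinduct[where R = "\<lambda>H. \<exists>a b. H = (\<lambda>t::real. a * sin t + b * cos t)"])
  fix H assume "\<exists>a b. H = (\<lambda>t::real. a * sin t + b * cos t)"
  then obtain a b where H: "H = (\<lambda>t::real. a * sin t + b * cos t)" by blast
  have "(H has_real_derivative - b * sin t + a * cos t) (at t)" for t
    unfolding H by (auto intro!: derivative_eq_intros)
  then show "\<exists>H'. (\<exists>a b. H' = (\<lambda>t::real. a * sin t + b * cos t)) \<and>
      (\<forall>t. (H has_vector_derivative H' t) (at t))"
    unfolding has_real_derivative_iff_has_vector_derivative by blast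
qed blast

lemma smooth_line_sin: "smooth_line (\<lambda>t::real. sin t)"
  using smooth_line_sin_cos[of 1 0] by simp

lemma smooth_line_cos: "smooth_line (\<lambda>t::real. cos t)"
  using smooth_line_sin_cos[of 0 1] by simp

text \<open>Derivatives of the expressions in this class are again such expressions, so the class
  consists of smooth functions.\<close>

inductive smooth_expr :: "(real \<Rightarrow> real) \<Rightarrow> bool" where
  smooth_expr_base: "smooth_line F \<Longrightarrow> smooth_expr F"
| smooth_expr_add: "smooth_expr F \<Longrightarrow> smooth_expr H \<Longrightarrow> smooth_expr (\<lambda>t. F t + H t)"
| smooth_expr_mult: "smooth_expr F \<Longrightarrow> smooth_expr H \<Longrightarrow> smooth_expr (\<lambda>t. F t * H t)"
| smooth_expr_inverse: "smooth_expr F \<Longrightarrow> (\<And>t. F t \<noteq> 0) \<Longrightarrow> smooth_expr (\<lambda>t. inverse (F t))"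
| smooth_expr_sqrt: "smooth_expr F \<Longrightarrow> (\<And>t. F t > 0) \<Longrightarrow> smooth_expr (\<lambda>t. sqrt (F t))"
| smooth_expr_comp: "smooth_line F \<Longrightarrow> smooth_expr H \<Longrightarrow> smooth_expr (\<lambda>t. F (H t))"

lemma smooth_expr_has_derivative:
  "smooth_expr F \<Longrightarrow> \<exists>F'. smooth_expr F' \<and> (\<forall>t. (F has_real_derivative F' t) (at t))"
proof (induction rule: smooth_expr.induct)
  case (smooth_expr_base F)
  then show ?case
    using smooth_expr.smooth_expr_base smooth_line_vderiv smooth_line_has_real_derivative by blast
next
  case (smooth_expr_add F H)
  then obtain F' H' where *: "smooth_expr F'" "\<And>t. (F has_real_derivative F' t) (at t)"
    "smooth_expr H'" "\<And>t. (H has_real_derivative H' t) (at t)" by blast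
  have "smooth_expr (\<lambda>t. F' t + H' t)"
    using * smooth_expr.smooth_expr_add by blast
  then show ?case
    using * by (intro exI[of _ "\<lambda>t. F' t + H' t"]) (auto intro!: derivative_eq_intros)
next
  case (smooth_expr_mult F H)
  then obtain F' H' where *: "smooth_expr F'" "\<And>t. (F has_real_derivative F' t) (at t)"
    "smooth_expr H'" "\<And>t. (H has_real_derivative H' t) (at t)" by blast
  have "smooth_expr (\<lambda>t. F' t * H t + F t * H' t)"
    by (intro smooth_expr.smooth_expr_add smooth_expr.smooth_expr_mult * smooth_expr_mult.hyps)
  then show ?case
    using * by (intro exI[of _ "\<lambda>t. F' t * H t + F t * H' t"]) (auto intro!: derivative_eq_intros)
next
  case (smooth_expr_inverse F)
  then obtain F' where *: "smooth_expr F'" "\<And>t. (F has_real_derivative F' t) (at t)" by blast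
  have "smooth_expr (\<lambda>t. (- 1) * (inverse (F t) * F' t * inverse (F t)))"
    by (intro smooth_expr.smooth_expr_mult smooth_expr.smooth_expr_inverse
        smooth_expr.smooth_expr_base[OF smooth_line_const] * smooth_expr_inverse.hyps)
  then show ?case
    using * smooth_expr_inverse
    by (intro exI[of _ "\<lambda>t. (- 1) * (inverse (F t) * F' t * inverse (F t))"])
      (auto intro!: derivative_eq_intros)
next
  case (smooth_expr_sqrt F)
  then obtain F' where *: "smooth_expr F'" "\<And>t. (F has_real_derivative F' t) (at t)" by blast
  have nz: "sqrt (F t) \<noteq> 0" for t
    using smooth_expr_sqrt.hyps(2)[of t] by simp
  have "smooth_expr (\<lambda>t. F' t * (inverse (sqrt (F t)) * (1 / 2)))"
    by (intro smooth_expr.smooth_expr_mult smooth_expr.smooth_expr_inverse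
        smooth_expr.smooth_expr_sqrt smooth_expr.smooth_expr_base[OF smooth_line_const] nz *
        smooth_expr_sqrt.hyps)
  then show ?case
  proof (intro exI[of _ "\<lambda>t. F' t * (inverse (sqrt (F t)) * (1 / 2))"] conjI allI)
    show "((\<lambda>t. sqrt (F t)) has_real_derivative F' t * (inverse (sqrt (F t)) * (1 / 2))) (at t)" for t
      using DERIV_chain2[OF DERIV_real_sqrt[OF smooth_expr_sqrt.hyps(2)] *(2)]
      by (simp add: field_simps)
  qed
next
  case (smooth_expr_comp F H)
  then obtain H' where *: "smooth_expr H'" "\<And>t. (H has_real_derivative H' t) (at t)" by blast
  have "smooth_expr (\<lambda>t. vderiv F (H t) * H' t)"
    by (intro smooth_expr.smooth_expr_mult smooth_expr.smooth_expr_comp[OF smooth_line_vderiv] * 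
        smooth_expr_comp.hyps)
  moreover have "((\<lambda>t. F (H t)) has_real_derivative vderiv F (H t) * H' t) (at t)" for t
    using * smooth_expr_comp smooth_line_has_real_derivative DERIV_chain2 by blast
  ultimately show ?case by blast
qed

lemma smooth_expr_imp_smooth_line:
  assumes "smooth_expr F" shows "smooth_line F"
  by (rule smooth_line_coinduct[where R = smooth_expr, OF assms])
    (use smooth_expr_has_derivative in \<open>simp add: has_real_derivative_iff_has_vector_derivative\<close>)

lemma
  fixes F H :: "real \<Rightarrow> real"
  assumes "smooth_line F"
  shows smooth_line_inverse: "(\<And>t. F t \<noteq> 0) \<Longrightarrow> smooth_line (\<lambda>t. inverse (F t))"
    and smooth_line_sqrt: "(\<And>t. F t > 0) \<Longrightarrow> smooth_line (\<lambda>t. sqrt (F t))"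
    and smooth_line_add: "smooth_line H \<Longrightarrow> smooth_line (\<lambda>t. F t + H t)"
    and smooth_line_mult: "smooth_line H \<Longrightarrow> smooth_line (\<lambda>t. F t * H t)"
    and smooth_line_compose: "smooth_line H \<Longrightarrow> smooth_line (\<lambda>t. F (H t))"
  using assms smooth_expr_base
  by (auto intro!: smooth_expr_imp_smooth_line intro: smooth_expr_inverse smooth_expr_sqrt
      smooth_expr_add smooth_expr_mult smooth_expr_comp)

lemma smooth_line_divide:
  fixes F H :: "real \<Rightarrow> real"
  shows "smooth_line F \<Longrightarrow> smooth_line H \<Longrightarrow> (\<And>t. H t \<noteq> 0) \<Longrightarrow> smooth_line (\<lambda>t. F t / H t)"
  unfolding divide_inverse by (intro smooth_line_mult smooth_line_inverse)

lemma smooth_line_minus: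
  fixes F :: "real \<Rightarrow> real"
  shows "smooth_line F \<Longrightarrow> smooth_line (\<lambda>t. - F t)"
  using smooth_line_mult[OF smooth_line_const[of "-1"]] by simp

lemma smooth_line_diff:
  fixes F H :: "real \<Rightarrow> real"
  shows "smooth_line F \<Longrightarrow> smooth_line H \<Longrightarrow> smooth_line (\<lambda>t. F t - H t)"
  using smooth_line_add[of F "\<lambda>t. - H t"] smooth_line_minus by simp

lemma smooth_line_power:
  fixes F :: "real \<Rightarrow> real"
  shows "smooth_line F \<Longrightarrow> smooth_line (\<lambda>t. F t ^ n)"
  by (induction n) (auto intro: smooth_line_mult)

lemma smooth_line_prod:
  fixes F :: "'i \<Rightarrow> real \<Rightarrow> real"
  shows "(\<And>i. i \<in> I \<Longrightarrow> smooth_line (F i)) \<Longrightarrow> smooth_line (\<lambda>t. \<Prod>i\<in>I. F i t)"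
  by (induction I rule: infinite_finite_induct) (auto intro: smooth_line_mult)

lemma smooth_line_shift: "smooth_line F \<Longrightarrow> smooth_line (\<lambda>t::real. F (t + c) :: real)"
  using smooth_line_compose[of F "\<lambda>t. t + c"] smooth_line_add[OF smooth_line_ident smooth_line_const] by simp

lemma vderiv_shift:
  fixes F :: "real \<Rightarrow> real"
  assumes "smooth_line F" shows "vderiv (\<lambda>t. F (t + c)) = (\<lambda>t. vderiv F (t + c))"
  by (rule vderiv_realI) (simp flip: DERIV_shift add: smooth_line_has_real_derivative[OF assms])

lemma vderiv_funpow_add_scaled:
  fixes F H :: "real \<Rightarrow> real"
  assumes "smooth_line F" "smooth_line H"
  shows "(vderiv ^^ k) (\<lambda>t. F t + s * H t) = (\<lambda>t. (vderiv ^^ k) F t + s * (vderiv ^^ k) H t)"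
proof (induction k)
  case (Suc k)
  have "vderiv (\<lambda>t. (vderiv ^^ k) F t + s * (vderiv ^^ k) H t) = 
     (\<lambda>t. (vderiv ^^ Suc k) F t + s * (vderiv ^^ Suc k) H t)"
    using smooth_line_has_real_derivative[OF smooth_line_vderiv_funpow] assms
    by (intro vderiv_realI) (auto intro!: derivative_eq_intros)
  then show ?case by (simp add: Suc)
qed simp

lemma has_vector_derivative_Re: 
  "(F has_vector_derivative F') (at t) \<Longrightarrow> ((\<lambda>t. Re (F t)) has_real_derivative Re F') (at t)"
  using bounded_linear.has_vector_derivative[OF bounded_linear_Re] 
  by (simp add: has_real_derivative_iff_has_vector_derivative)

lemma has_vector_derivative_Im: 
  "(F has_vector_derivative F') (at t) \<Longrightarrow> ((\<lambda>t. Im (F t)) has_real_derivative Im F') (at t)"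
  using bounded_linear.has_vector_derivative[OF bounded_linear_Im] 
  by (simp add: has_real_derivative_iff_has_vector_derivative)

lemma has_vector_derivative_complexI:
  assumes "((\<lambda>t. Re (F t)) has_real_derivative Re F') (at t)"
    "((\<lambda>t. Im (F t)) has_real_derivative Im F') (at t)"
  shows "(F has_vector_derivative F') (at t)"
  using assms unfolding has_vector_derivative_complex_iff
  by (auto simp: o_def DERIV_subset)

lemma smooth_line_complex_iff:
  fixes F :: "real \<Rightarrow> complex"
  shows "smooth_line F \<longleftrightarrow> smooth_line (\<lambda>t. Re (F t)) \<and> smooth_line (\<lambda>t. Im (F t))"
proof (intro iffI conjI)
  assume F: "smooth_line F"
  show "smooth_line (\<lambda>t. Re (F t))"
    by (rule smooth_line_coinduct[where R = "\<lambda>H. \<exists>F. smooth_line F \<and> H = (\<lambda>t. Re (F t))"])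
      (use F smooth_line_vderiv has_vector_derivative_Re[OF smooth_line_has_vderiv] in 
        \<open>force simp: has_real_derivative_iff_has_vector_derivative\<close>)+
  show "smooth_line (\<lambda>t. Im (F t))"
    by (rule smooth_line_coinduct[where R = "\<lambda>H. \<exists>F. smooth_line F \<and> H = (\<lambda>t. Im (F t))"])
      (use F smooth_line_vderiv has_vector_derivative_Im[OF smooth_line_has_vderiv] in 
        \<open>force simp: has_real_derivative_iff_has_vector_derivative\<close>)+
next
  let ?R = "\<lambda>F::real \<Rightarrow> complex. smooth_line (\<lambda>t. Re (F t)) \<and> smooth_line (\<lambda>t. Im (F t))"
  assume F: "?R F"
  show "smooth_line F"
  proof (rule smooth_line_coinduct[where R = ?R, OF F])
    fix F :: "real \<Rightarrow> complex" assume F: "?R F"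
    show "\<exists>F'. ?R F' \<and> (\<forall>t. (F has_vector_derivative F' t) (at t))"
      using F by (intro exI[of _ "\<lambda>t. Complex (vderiv (\<lambda>t. Re (F t)) t) (vderiv (\<lambda>t. Im (F t)) t)"])
        (auto intro!: has_vector_derivative_complexI smooth_line_vderiv smooth_line_has_real_derivative)
  qed
qed

section \<open>Antiderivatives\<close>

text \<open>The rescaling to the unit interval covers times of both signs and gives a fixed domain of
  integration, as in the differentiation of parameter integrals.\<close>

definition antideriv :: "(real \<Rightarrow> real) \<Rightarrow> real \<Rightarrow> real" where
  "antideriv k s = integral {0..1} (\<lambda>u. s * k (s * u))"

lemma antideriv_0 [simp]: "antideriv k 0 = 0"
  by (simp add: antideriv_def)

lemma antideriv_eq:
  assumes "\<And>s. (K has_real_derivative k s) (at s)"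
  shows "antideriv k s = K s - K 0"
proof -
  have "((\<lambda>u. s * k (s * u)) has_integral (K (s * 1) - K (s * 0))) {0..1}"
  proof (rule fundamental_theorem_of_calculus)
    fix u :: real
    have "((\<lambda>u. K (s * u)) has_real_derivative k (s * u) * s) (at u within {0..1})"
      by (rule DERIV_chain2[OF assms]) (auto intro!: derivative_eq_intros)
    then show "((\<lambda>u. K (s * u)) has_vector_derivative s * k (s * u)) (at u within {0..1})"
      by (simp add: has_real_derivative_iff_has_vector_derivative mult.commute)
  qed simp
  from integral_unique[OF this] show ?thesis
    by (simp only: antideriv_def mult_1_right mult_zero_right)
qed

lemma antiderivative_ex:
  fixes k :: "real \<Rightarrow> real"
  assumes "continuous_on UNIV k"
  shows "\<exists>K. \<forall>s. (K has_real_derivative k s) (at s)"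
proof -
  have "((\<lambda>u. LBINT y=0..u. k y) has_real_derivative k s) (at s)" for s
  proof -
    have "((\<lambda>u. LBINT y=ereal 0..u. k y) has_vector_derivative k s) (at s within {-\<bar>s\<bar>-1..\<bar>s\<bar>+1})"
      by (rule interval_integral_FTC2) (auto intro: continuous_on_subset[OF assms])
    then show ?thesis
      by (subst (asm) at_within_interior)
        (auto simp: has_real_derivative_iff_has_vector_derivative zero_ereal_def)
  qed
  then show ?thesis by blast
qed

lemma antideriv_has_derivative:
  assumes "continuous_on UNIV k"
  shows "(antideriv k has_real_derivative k s) (at s)"
proof -
  obtain K where K: "\<And>s. (K has_real_derivative k s) (at s)"
    using antiderivative_ex[OF assms] by blast
  have "antideriv k = (\<lambda>s. K s - K 0)"
    using antideriv_eq[OF K] by blast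
  then show ?thesis
    using K by (auto intro!: derivative_eq_intros)
qed

lemma real_const_if_derivative_0:
  fixes h :: "real \<Rightarrow> real"
  assumes "\<And>t. (h has_real_derivative 0) (at t)" shows "h t = h s"
  using DERIV_isconst_all assms by blast

section \<open>Lifting maps of the circle to the line\<close>

definition lift_of :: "(complex \<Rightarrow> complex) \<Rightarrow> (real \<Rightarrow> real) \<Rightarrow> bool" where
  "lift_of \<phi> L \<longleftrightarrow> smooth_line L \<and> (\<forall>t. \<phi> (cis t) = cis (L t))"

lemma cis_eq_iff: "cis s = cis t \<longleftrightarrow> (\<exists>k::int. s = t + 2 * pi * k)"
  using sin_cos_eq_iff[of s t] by (auto simp: complex_eq_iff)

lemma circle_cisE:
  assumes "z \<in> circle" obtains t where "z = cis t"
  using assms cis_Arg[of z] by (metis cis_Arg_unique norm_one mem_sphere_0 rcis_cmod_Arg rcis_def mult_1 of_real_1)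

lemma cis_mem_circle [simp]: "cis t \<in> circle"
  by simp

lemma has_vector_derivative_cis:
  assumes "(y has_real_derivative y') (at s within A)"
  shows "((\<lambda>s. cis (y s)) has_vector_derivative of_real y' * (\<i> * cis (y s))) (at s within A)"
  using assms unfolding has_vector_derivative_complex_iff
  by (auto intro!: derivative_eq_intros)

lemma real_eq_if_cis_eq:
  fixes y1 y2 :: "real \<Rightarrow> real"
  assumes "continuous_on UNIV y1" "continuous_on UNIV y2" "\<And>s. cis (y1 s) = cis (y2 s)"
  shows "\<exists>k::int. \<forall>s. y2 s = y1 s + 2 * pi * k"
proof -
  have "\<exists>k::int. y2 s = y1 s + 2 * pi * k" for s
    using assms(3)[of s] cis_eq_iff by metis
  then obtain k :: "real \<Rightarrow> int" where k: "\<And>s. y2 s = y1 s + 2 * pi * k s" by metis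
  then have eq: "real_of_int (k s) = (y2 s - y1 s) / (2 * pi)" for s by (simp add: field_simps)
  have "continuous_on UNIV (\<lambda>s. real_of_int (k s))"
    unfolding eq using assms by (intro continuous_intros) auto
  then have "(\<lambda>s. real_of_int (k s)) constant_on UNIV"
    by (rule continuous_discrete_range_constant[OF connected_UNIV])
      (auto intro!: exI[of _ 1] simp flip: of_int_diff)
  then show ?thesis using k by (metis UNIV_I constant_on_def)
qed

text \<open>A curve of modulus one moves with velocity \<open>i u c\<close> where \<open>u = Im (c' / c)\<close>, so that an
  antiderivative of \<open>u\<close> is an angle for it.\<close>

lemma circle_curve_angle:
  fixes c :: "real \<Rightarrow> complex"
  assumes c: "\<And>s. (c has_vector_derivative c' s) (at s)" and norm: "\<And>s. cmod (c s) = 1"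
    and cont: "continuous_on UNIV c'" and start: "c 0 = cis \<theta>"
  defines "u \<equiv> (\<lambda>s. Im (c' s * cnj (c s)))"
  defines "y \<equiv> (\<lambda>s. \<theta> + antideriv u s)"
  shows "\<And>s. (y has_real_derivative u s) (at s)" "\<And>s. c s = cis (y s)"
proof -
  have contc: "continuous_on UNIV c"
    using c by (intro continuous_at_imp_continuous_on ballI has_vector_derivative_continuous)
  have "continuous_on UNIV u"
    unfolding u_def by (intro continuous_intros cont contc)
  then show y: "(y has_real_derivative u s) (at s)" for s
    unfolding y_def by (auto intro!: derivative_eq_intros antideriv_has_derivative)
  have c': "c' s = u s * (\<i> * c s)" for s
  proof -
    have one: "c s * cnj (c s) = 1" for s
      using complex_norm_square[of "c s"] norm[of s] by simp
    have "((\<lambda>s. Re (c s * cnj (c s))) has_real_derivative Re (c s * cnj (c' s) + c' s * cnj (c s))) (at s)"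
      by (intro has_vector_derivative_Re has_vector_derivative_mult c
          bounded_linear.has_vector_derivative[OF bounded_linear_cnj])
    then have "((\<lambda>s. 1) has_real_derivative 2 * Re (c' s * cnj (c s))) (at s)"
      unfolding one by (simp add: mult.commute)
    then have "Re (c' s * cnj (c s)) = 0"
      using DERIV_unique DERIV_const by fastforce
    then have "c' s * cnj (c s) = \<i> * u s"
      by (simp add: complex_eq_iff u_def)
    then have "c' s * (c s * cnj (c s)) = u s * (\<i> * c s)"
      by (simp add: mult_ac)
    then show ?thesis unfolding one by simp
  qed
  have "((\<lambda>s. c s * cis (- y s)) has_vector_derivative 0) (at s)" for s
  proof -
    have "((\<lambda>s. - y s) has_real_derivative - u s) (at s)" 
      using y by (auto intro!: derivative_eq_intros)
    from has_vector_derivative_mult[OF c has_vector_derivative_cis[OF this]]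
    show ?thesis by (simp add: c' algebra_simps)
  qed
  then obtain k where "\<And>s. c s * cis (- y s) = k"
    using has_vector_derivative_zero_constant[of UNIV "\<lambda>s. c s * cis (- y s)"] by auto
  then have "c s * cis (- y s) = c 0 * cis (- y 0)" for s by metis
  also have "c 0 * cis (- y 0) = 1" by (simp add: start y_def cis_mult)
  finally have "c s * (cis (- y s) * cis (y s)) = cis (y s)" for s by (simp flip: mult.assoc)
  then show "c s = cis (y s)" for s by (simp add: cis_mult)
qed

lemma lift_of_imp_smooth_circle:
  assumes "lift_of \<phi> L" shows "smooth_circle \<phi>"
  using assms smooth_line_compose[OF smooth_line_cos, of L] smooth_line_compose[OF smooth_line_sin, of L]
  by (simp add: smooth_circle_def lift_of_def smooth_line_complex_iff)

lemma lift_ex: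
  assumes "smooth_circle \<phi>" "\<phi> ` circle \<subseteq> circle" "\<phi> (cis t0) = cis \<theta>"
  shows "\<exists>L. lift_of \<phi> L \<and> L t0 = \<theta>"
proof -
  define c where "c = (\<lambda>t. \<phi> (cis t))"
  have sm: "smooth_line c" using assms(1) by (simp add: smooth_circle_def c_def)
  have norm: "cmod (c t) = 1" for t
    using assms(2) cis_mem_circle[of t] by (force simp: c_def)
  obtain \<theta>0 where \<theta>0: "c 0 = cis \<theta>0"
    using norm[of 0] circle_cisE by (metis mem_sphere_0)
  define u where "u = (\<lambda>s. Im (vderiv c s * cnj (c s)))"
  define L0 where "L0 = (\<lambda>s. \<theta>0 + antideriv u s)"
  have L0: "\<And>s. (L0 has_real_derivative u s) (at s)" "\<And>s. c s = cis (L0 s)"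
    unfolding L0_def u_def
    by (rule circle_curve_angle[OF smooth_line_has_vderiv[OF sm] norm
          smooth_line_continuous[OF smooth_line_vderiv[OF sm]] \<theta>0])+
  have "smooth_line u"
  proof -
    have "smooth_line (\<lambda>s. Re (c s))" "smooth_line (\<lambda>s. Im (c s))"
      "smooth_line (\<lambda>s. Re (vderiv c s))" "smooth_line (\<lambda>s. Im (vderiv c s))"
      using sm smooth_line_vderiv[OF sm] by (auto simp: smooth_line_complex_iff)
    then show ?thesis unfolding u_def by (auto intro!: smooth_line_add smooth_line_diff smooth_line_mult)
  qed
  then have "smooth_line L0" using L0(1) by (rule smooth_line_real_if_derivative[rotated])
  obtain k :: int where k: "\<theta> = L0 t0 + 2 * pi * k"
    using L0(2)[of t0] assms(3) cis_eq_iff unfolding c_def by metis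
  have "lift_of \<phi> (\<lambda>t. L0 t + 2 * pi * k)"
    unfolding lift_of_def
  proof (intro conjI allI)
    show "smooth_line (\<lambda>t. L0 t + 2 * pi * k)"
      by (intro smooth_line_add \<open>smooth_line L0\<close> smooth_line_const)
    show "\<phi> (cis t) = cis (L0 t + 2 * pi * k)" for t
      using L0(2)[of t] cis_eq_iff[of "L0 t + 2 * pi * k" "L0 t"] by (auto simp: c_def)
  qed
  then show ?thesis using k by auto
qed

lemma lift_of_unique:
  assumes "lift_of \<phi> L1" "lift_of \<phi> L2"
  shows "\<exists>k::int. \<forall>t. L2 t = L1 t + 2 * pi * k"
proof (rule real_eq_if_cis_eq)
  show "continuous_on UNIV L1" "continuous_on UNIV L2"
    using assms by (simp_all add: lift_of_def smooth_line_continuous)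
  show "cis (L1 t) = cis (L2 t)" for t
    using assms unfolding lift_of_def by metis
qed

lemma lift_of_vderiv_unique:
  assumes "lift_of \<phi> L1" "lift_of \<phi> L2" shows "vderiv L2 = vderiv L1"
proof -
  obtain k :: int where k: "L2 = (\<lambda>t. L1 t + 2 * pi * k)"
    using lift_of_unique[OF assms] by blast
  have "smooth_line L1" using assms by (simp add: lift_of_def)
  then show ?thesis
    unfolding k by (intro vderiv_realI) (auto intro!: derivative_eq_intros smooth_line_has_real_derivative)
qed

lemma lift_of_compose:
  assumes "lift_of \<phi> L" "lift_of \<psi> M" and "\<And>z. z \<in> circle \<Longrightarrow> \<theta> z = \<phi> (\<psi> z)"
  shows "lift_of \<theta> (\<lambda>t. L (M t))"
  using assms smooth_line_compose by (simp add: lift_of_def)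

lemma vderiv_compose:
  fixes L M :: "real \<Rightarrow> real"
  assumes "smooth_line L" "smooth_line M"
  shows "vderiv (\<lambda>t. L (M t)) = (\<lambda>t. vderiv L (M t) * vderiv M t)"
  by (intro vderiv_realI DERIV_chain2 smooth_line_has_real_derivative assms)

lemma vderiv_ident: "vderiv (\<lambda>t::real. t) = (\<lambda>t. 1)"
  by (intro vderiv_realI) (auto intro!: derivative_eq_intros)

lemma continuous_nonzero_sign:
  fixes h :: "real \<Rightarrow> real"
  assumes "continuous_on {a..b} h" "\<And>t. t \<in> {a..b} \<Longrightarrow> h t \<noteq> 0" "s \<in> {a..b}" "t \<in> {a..b}"
  shows "h s > 0 \<longleftrightarrow> h t > 0"
proof -
  have False if "h s > 0" "h t < 0" "s \<in> {a..b}" "t \<in> {a..b}" for s t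
  proof -
    have "connected (h ` {a..b})" using assms(1) by (intro connected_continuous_image) auto
    then have "0 \<in> h ` {a..b}"
      using that unfolding connected_iff_interval by (meson image_eqI less_imp_le)
    then show False using assms(2) by auto
  qed
  then show ?thesis using assms(2)[of s] assms(2)[of t] assms(3,4) by (meson linorder_neqE)
qed

lemma continuous_nonzero_sign_UNIV:
  fixes h :: "real \<Rightarrow> real"
  assumes "continuous_on UNIV h" "\<And>t. h t \<noteq> 0"
  shows "(\<forall>t. h t > 0) \<or> (\<forall>t. h t < 0)"
proof -
  have "h s > 0 \<longleftrightarrow> h t > 0" for s t
    by (rule continuous_nonzero_sign[of "min s t" "max s t"]) (use assms(2) continuous_on_subset[OF assms(1)] in simp_all)
  then show ?thesis using assms(2) by (meson linorder_neqE)
qed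

lemma Bij_circle_cis: "\<phi> \<in> Bij circle \<Longrightarrow> \<phi> (cis t) \<in> circle"
  using Bij_imp_funcset cis_mem_circle by blast

text \<open>The lifts of a diffeomorphism and of its inverse are inverse to each other up to a constant,
  hence a lift has no critical points, and the two degrees are integers with product one.\<close>

lemma Diff_circle_lift:
  assumes "\<phi> \<in> Diff_circle" "lift_of \<phi> L"
  shows "(\<forall>t. vderiv L t > 0) \<and> (\<forall>t. L (t + 2 * pi) = L t + 2 * pi) \<or>
         (\<forall>t. vderiv L t < 0) \<and> (\<forall>t. L (t + 2 * pi) = L t - 2 * pi)"
proof -
  have bij: "bij_betw \<phi> circle circle" and sm: "smooth_circle (inv_into circle \<phi>)"
    using assms(1) by (auto simp: Diff_circle_def Bij_def)
  have bij': "bij_betw (inv_into circle \<phi>) circle circle" using bij by (rule bij_betw_inv_into)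
  have L: "smooth_line L" using assms(2) by (simp add: lift_of_def)
  obtain \<theta> where "inv_into circle \<phi> (cis 0) = cis \<theta>"
    using bij' circle_cisE by (metis bij_betwE cis_mem_circle)
  with lift_ex[OF sm] obtain M where M: "lift_of (inv_into circle \<phi>) M"
    using bij' by (metis bij_betw_imp_surj_on order_refl)
  have sM: "smooth_line M" using M by (simp add: lift_of_def)
  have "lift_of id (\<lambda>t. M (L t))"
    by (rule lift_of_compose[OF M assms(2)]) (use bij in \<open>auto simp: bij_betw_inv_into_left\<close>)
  moreover have "lift_of id (\<lambda>t. t)" by (simp add: lift_of_def)
  ultimately obtain k0 :: int where k0: "M (L t) = t + 2 * pi * k0" for t
    using lift_of_unique by metis
  have "vderiv M (L t) * vderiv L t = 1" for t
    using lift_of_vderiv_unique[OF \<open>lift_of id (\<lambda>t. t)\<close> \<open>lift_of id (\<lambda>t. M (L t))\<close>]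
    by (simp add: vderiv_compose[OF sM L] vderiv_ident fun_eq_iff)
  then have "vderiv L t \<noteq> 0" for t by (metis mult_zero_right zero_neq_one)
  then have sign: "(\<forall>t. vderiv L t > 0) \<or> (\<forall>t. vderiv L t < 0)"
    by (intro continuous_nonzero_sign_UNIV smooth_line_continuous smooth_line_vderiv L)
  have shift: "\<exists>k::int. \<forall>t. K (t + 2 * pi) = K t + 2 * pi * k" if "lift_of \<psi> K" for \<psi> K
  proof -
    have "lift_of \<psi> (\<lambda>t. K (t + 2 * pi))"
      unfolding lift_of_def
    proof (intro conjI allI)
      show "smooth_line (\<lambda>t. K (t + 2 * pi))"
        using that by (intro smooth_line_shift) (simp add: lift_of_def)
      have "cis (t + 2 * pi) = cis t" for t by (simp flip: cis_mult)
      then show "\<psi> (cis t) = cis (K (t + 2 * pi))" for t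
        using that unfolding lift_of_def by metis
    qed
    then show ?thesis using lift_of_unique[OF that] by blast
  qed
  obtain k :: int where k: "\<And>t. L (t + 2 * pi) = L t + 2 * pi * k" using shift[OF assms(2)] by blast
  obtain m :: int where m: "\<And>t. M (t + 2 * pi) = M t + 2 * pi * m" using shift[OF M] by blast
  have mk: "M (t + 2 * pi * j) = M t + 2 * pi * m * j" for t and j :: int
  proof (induction j arbitrary: t rule: int_induct[of _ 0])
    case (step1 i) then show ?case using m[of "t + 2 * pi * i"] by (simp add: algebra_simps)
  next
    case (step2 i) then show ?case using m[of "t + 2 * pi * (i - 1)"] by (simp add: algebra_simps)
  qed simp
  have "M (L (0 + 2 * pi)) = M (L 0) + 2 * pi * m * k"
    unfolding k by (rule mk)
  then have "2 * pi * real_of_int (m * k) = 2 * pi * 1" unfolding k0 by simp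
  then have "real_of_int (m * k) = 1" using pi_neq_zero by simp
  then have "k = 1 \<or> k = -1" using zmult_eq_1_iff by (metis of_int_eq_1_iff)
  moreover have "L (0 + 2 * pi) > L 0" if "\<forall>t. vderiv L t > 0"
    by (rule DERIV_pos_imp_increasing[of 0 _ L]) (use that smooth_line_has_real_derivative[OF L] pi_gt_zero in \<open>simp, blast\<close>)
  moreover have "L (0 + 2 * pi) < L 0" if "\<forall>t. vderiv L t < 0"
    by (rule DERIV_neg_imp_decreasing[of 0 _ L]) (use that smooth_line_has_real_derivative[OF L] pi_gt_zero in \<open>simp, blast\<close>)
  ultimately show ?thesis using sign k[of 0] k by auto
qed

section \<open>The time function of a one-form with simple poles\<close>

text \<open>This is \<open>ln u \<le> u\<close> at \<open>u = 1 / sqrt \<bar>x\<bar>\<close>.\<close>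

lemma abs_x_ln_le:
  fixes x :: real
  assumes "\<bar>x\<bar> < 1" shows "\<bar>x * ln \<bar>x\<bar>\<bar> \<le> 2 * sqrt \<bar>x\<bar>"
proof (cases "x = 0")
  case False
  define y where "y = sqrt \<bar>x\<bar>"
  have y: "0 < y" "y * y = \<bar>x\<bar>" using False by (auto simp: y_def)
  have "ln (1 / y) \<le> 1 / y" using ln_add_one_self_le_self2[of "1 / y - 1"] y(1)
    by (smt (verit) divide_pos_pos ln_le_minus_one)
  then have "- ln y \<le> 1 / y" using y(1) by (simp add: ln_div)
  then have "y * - ln y \<le> 1" using y(1) by (simp add: field_simps)
  have "ln \<bar>x\<bar> < 0" using assms False by simp
  then have "\<bar>x * ln \<bar>x\<bar>\<bar> = \<bar>x\<bar> * - ln \<bar>x\<bar>" by (simp add: abs_mult)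
  also have "\<dots> = (2 * y) * (y * - ln y)"
  proof -
    have "ln \<bar>x\<bar> = 2 * ln y" using y ln_mult[of y y] by simp
    then show ?thesis using y(2) by (simp add: algebra_simps)
  qed
  also have "\<dots> \<le> (2 * y) * 1" using y(1) \<open>y * - ln y \<le> 1\<close> by (intro mult_left_mono) auto
  finally show ?thesis unfolding y_def mult_1_right .
qed simp

lemma tendsto_x_ln_abs_0: "((\<lambda>x::real. x * ln \<bar>x\<bar>) \<longlongrightarrow> 0) (at 0)"
proof (rule tendsto_rabs_zero_cancel, rule tendsto_sandwich[of "\<lambda>_. 0"])
  show "\<forall>\<^sub>F x in at 0. \<bar>x * ln \<bar>x\<bar>\<bar> \<le> 2 * sqrt \<bar>x::real\<bar>"
    unfolding eventually_at by (intro exI[of _ 1]) (auto intro: abs_x_ln_le)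
  show "((\<lambda>x::real. 2 * sqrt \<bar>x\<bar>) \<longlongrightarrow> 0) (at 0)"
    by (auto intro!: tendsto_eq_intros)
qed auto

lemma isCont_x_ln_abs: "isCont (\<lambda>x::real. x * ln \<bar>x\<bar>) x"
proof (cases "x = 0")
  case True
  then show ?thesis using tendsto_x_ln_abs_0 by (simp add: isCont_def)
qed (auto intro!: continuous_intros)

lemma DERIV_ln_abs:
  assumes "(f has_real_derivative f') (at t)" "f t \<noteq> 0"
  shows "((\<lambda>t. ln \<bar>f t\<bar>) has_real_derivative f' / f t) (at t)"
proof -
  have "(\<lambda>t. ln \<bar>f t\<bar>) = (\<lambda>t. ln ((f t)\<^sup>2) / 2)"
  proof
    show "ln \<bar>f t\<bar> = ln ((f t)\<^sup>2) / 2" for t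
      by (cases "f t = 0") (use ln_realpow[of "\<bar>f t\<bar>" 2] in auto)
  qed
  moreover have "((\<lambda>t. ln ((f t)\<^sup>2) / 2) has_real_derivative f' / f t) (at t)"
    using assms by (auto intro!: derivative_eq_intros simp: field_simps power2_eq_square zero_less_mult_iff)
  ultimately show ?thesis by simp
qed

text \<open>The difference quotient of \<open>h\<close> tends to \<open>d\<close>. Hence a change of coordinate alters a logarithmic
  singularity only by a term that has a limit.\<close>

lemma
  fixes h :: "real \<Rightarrow> real"
  assumes "(h has_real_derivative d) (at p)" "d \<noteq> 0"
  shows eventually_neq_if_deriv_nonzero: "\<forall>\<^sub>F t in at p. h t \<noteq> h p"
    and tendsto_ln_abs_quotient: "((\<lambda>t. ln \<bar>h t - h p\<bar> - ln \<bar>t - p\<bar>) \<longlongrightarrow> ln \<bar>d\<bar>) (at p)"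
proof -
  have q: "((\<lambda>t. (h t - h p) / (t - p)) \<longlongrightarrow> d) (at p)"
    using assms(1) by (simp add: has_field_derivative_iff)
  have "\<forall>\<^sub>F t in at p. (h t - h p) / (t - p) \<noteq> 0"
    by (rule tendsto_imp_eventually_ne[OF q assms(2)])
  then show ne: "\<forall>\<^sub>F t in at p. h t \<noteq> h p" by eventually_elim auto
  have "((\<lambda>t. ln \<bar>(h t - h p) / (t - p)\<bar>) \<longlongrightarrow> ln \<bar>d\<bar>) (at p)"
    using assms(2) by (intro tendsto_intros q) auto
  moreover have "\<forall>\<^sub>F t in at p. ln \<bar>(h t - h p) / (t - p)\<bar> = ln \<bar>h t - h p\<bar> - ln \<bar>t - p\<bar>"
    using ne eventually_neq_at_within[of p] by eventually_elim (simp add: ln_div)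
  ultimately show "((\<lambda>t. ln \<bar>h t - h p\<bar> - ln \<bar>t - p\<bar>) \<longlongrightarrow> ln \<bar>d\<bar>) (at p)"
    by (rule Lim_transform_eventually)
qed

definition periodic_smooth :: "(real \<Rightarrow> real) \<Rightarrow> bool" where
  "periodic_smooth D \<longleftrightarrow> smooth_line D \<and> (\<forall>t. D (t + 2 * pi) = D t)"

lemma periodic_smooth_vderiv: "periodic_smooth D \<Longrightarrow> periodic_smooth (vderiv D)"
  using vderiv_shift[of D "2 * pi"] smooth_line_vderiv[of D]
  by (simp add: periodic_smooth_def fun_eq_iff)

lemma periodic_int:
  fixes D :: "real \<Rightarrow> 'a"
  assumes "\<And>t. D (t + 2 * pi) = D t" shows "D (t + 2 * pi * of_int k) = D t"
proof (induction k arbitrary: t rule: int_induct[of _ 0])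
  case (step1 i) then show ?case using assms[of "t + 2 * pi * i"] by (simp add: algebra_simps)
next
  case (step2 i) then show ?case using assms[of "t + 2 * pi * (i - 1)"] by (simp add: algebra_simps)
qed simp

lemma reduce_angle: "\<exists>k::int. 0 \<le> t + 2 * pi * k \<and> t + 2 * pi * k < 2 * pi"
proof -
  define n where "n = \<lfloor>t / (2 * pi)\<rfloor>"
  have "of_int n \<le> t / (2 * pi)" "t / (2 * pi) < of_int n + 1" unfolding n_def by linarith+
  then have "of_int n * (2 * pi) \<le> t" "t < (of_int n + 1) * (2 * pi)"
    by (simp_all only: pos_le_divide_eq[of "2 * pi"] pos_divide_less_eq[of "2 * pi"] pi_gt_zero
        zero_less_mult_iff zero_less_numeral simp_thms)
  then show ?thesis
    by (intro exI[of _ "- n"]) (simp add: algebra_simps)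
qed

lemma periodic_continuous_bounded:
  fixes D :: "real \<Rightarrow> real"
  assumes "continuous_on UNIV D" "\<And>t. D (t + 2 * pi) = D t"
  shows "\<exists>B>0. \<forall>t. \<bar>D t\<bar> \<le> B"
proof -
  have "bounded (D ` {0..2 * pi})"
    by (intro compact_imp_bounded compact_continuous_image continuous_on_subset[OF assms(1)]) auto
  then obtain B where B: "B > 0" "\<And>t. t \<in> {0..2 * pi} \<Longrightarrow> \<bar>D t\<bar> \<le> B"
    unfolding bounded_pos by auto
  have "\<bar>D t\<bar> \<le> B" for t
  proof -
    obtain k :: int where "0 \<le> t + 2 * pi * k" "t + 2 * pi * k < 2 * pi" using reduce_angle by blast
    then have "\<bar>D (t + 2 * pi * k)\<bar> \<le> B" by (intro B) auto
    then show ?thesis using periodic_int[of D, OF assms(2)] by simp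
  qed
  then show ?thesis using B(1) by blast
qed

lemma periodic_smooth_bounded: "periodic_smooth D \<Longrightarrow> \<exists>B>0. \<forall>t. \<bar>D t\<bar> \<le> B"
  by (rule periodic_continuous_bounded) (auto simp: periodic_smooth_def smooth_line_continuous)

lemma antideriv_shift:
  assumes "continuous_on UNIV k" "\<And>t. k (t + 2 * pi) = k t"
  shows "antideriv k (t + 2 * pi) = antideriv k t + antideriv k (2 * pi)"
proof -
  have "((\<lambda>t. antideriv k (t + 2 * pi) - antideriv k t) has_real_derivative 0) (at t)" for t
  proof -
    have "((\<lambda>t. antideriv k (t + 2 * pi)) has_real_derivative k (t + 2 * pi)) (at t)"
      using DERIV_shift[THEN iffD1, OF antideriv_has_derivative[OF assms(1)]] .
    then show ?thesis
      using DERIV_diff[OF _ antideriv_has_derivative[OF assms(1)]] assms(2) by fastforce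
  qed
  from real_const_if_derivative_0[OF this, of t 0] show ?thesis by simp
qed

text \<open>In the application \<open>a\<close> is the derivative of a Morse function with respect to the angle, and
  the form \<open>(D / a) dt\<close> is dual to its gradient if \<open>D\<close> is the coefficient of the metric. The
  formulas of this locale give a primitive of the form outside its poles, and the principal value of
  its integral over the circle. They are linear in \<open>D\<close> and only integrate continuous functions. With
  \<open>R = a\<^sup>2 + a'\<^sup>2\<close> and \<open>c = a' / R\<close>, the identity \<open>1 = a\<^sup>2 / R + c a'\<close> gives
  \<open>D / a = D a / R + (D c) a' / a\<close>, and \<open>(D c) a' / a = (D c ln \<bar>a\<bar>)' - (D c)' ln \<bar>a\<bar>\<close>. The
  same identity, together with the continuous primitive \<open>E = a ln \<bar>a\<bar> - a\<close> of \<open>a' ln \<bar>a\<bar>\<close>, gives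
  \<open>(D c)' ln \<bar>a\<bar> = (D c)' a\<^sup>2 ln \<bar>a\<bar> / R + ((D c)' c E)' - ((D c)' c)' E\<close>. The continuous function
  that remains to be integrated is the density; the functions \<open>q0\<close>, \<open>q1\<close>, \<open>q2\<close> are its
  coefficients with respect to \<open>D\<close>, \<open>D'\<close>, \<open>D''\<close>.\<close>

locale simple_zeros =
  fixes a :: "real \<Rightarrow> real"
  assumes periodic_smooth: "periodic_smooth a"
    and simple: "\<And>t. a t = 0 \<Longrightarrow> vderiv a t \<noteq> 0"
begin

lemma smooth: "smooth_line a" and periodic: "a (t + 2 * pi) = a t"
  using periodic_smooth by (auto simp: periodic_smooth_def)

abbreviation a' :: "real \<Rightarrow> real" where "a' \<equiv> vderiv a"

definition R :: "real \<Rightarrow> real" where "R t = (a t)\<^sup>2 + (a' t)\<^sup>2"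

lemma R_nonzero: "R t \<noteq> 0"
  using simple[of t] by (auto simp: R_def sum_power2_eq_zero_iff)

definition c :: "real \<Rightarrow> real" where "c t = a' t / R t"

definition E :: "real \<Rightarrow> real" where "E t = a t * ln \<bar>a t\<bar> - a t"

definition q0 :: "real \<Rightarrow> real" where
  "q0 t = a t / R t + (vderiv (vderiv c) t * c t + (vderiv c t)\<^sup>2) * E t
     - vderiv c t * a t * (a t * ln \<bar>a t\<bar>) / R t"

definition q1 :: "real \<Rightarrow> real" where
  "q1 t = 3 * c t * vderiv c t * E t - c t * a t * (a t * ln \<bar>a t\<bar>) / R t"

definition q2 :: "real \<Rightarrow> real" where "q2 t = (c t)\<^sup>2 * E t"

definition density :: "(real \<Rightarrow> real) \<Rightarrow> real \<Rightarrow> real" where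
  "density D t = D t * q0 t + vderiv D t * q1 t + vderiv (vderiv D) t * q2 t"

definition time :: "(real \<Rightarrow> real) \<Rightarrow> real \<Rightarrow> real" where
  "time D t = D t * c t * ln \<bar>a t\<bar> - (vderiv D t * (c t)\<^sup>2 + D t * vderiv c t * c t) * E t
     + antideriv (density D) t"

definition period :: "(real \<Rightarrow> real) \<Rightarrow> real" where
  "period D = antideriv (density D) (2 * pi)"

lemma periodic_smooth_R: "periodic_smooth R"
  using periodic_smooth periodic_smooth_vderiv[OF periodic_smooth]
  unfolding periodic_smooth_def R_def by (auto intro!: smooth_line_add smooth_line_power)

lemma periodic_smooth_c: "periodic_smooth c"
  using periodic_smooth_R periodic_smooth_vderiv[OF periodic_smooth] R_nonzero
  unfolding periodic_smooth_def c_def by (auto intro!: smooth_line_divide)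

lemmas smooth_c = periodic_smooth_c[unfolded periodic_smooth_def, THEN conjunct1]
lemmas smooth_c' = smooth_line_vderiv[OF smooth_c]
lemmas smooth_c'' = smooth_line_vderiv[OF smooth_c']

lemma continuous_a_ln_a: "continuous_on S (\<lambda>t. a t * ln \<bar>a t\<bar>)"
  using continuous_on_compose2[of UNIV "\<lambda>x. x * ln \<bar>x\<bar>" S a] isCont_x_ln_abs 
    smooth_line_continuous[OF smooth] by (auto simp: continuous_on_eq_continuous_at)

lemma continuous_E: "continuous_on S E"
  unfolding E_def by (intro continuous_intros continuous_a_ln_a smooth_line_continuous smooth)

lemma
  shows continuous_q0: "continuous_on UNIV q0"
    and continuous_q1: "continuous_on UNIV q1"
    and continuous_q2: "continuous_on UNIV q2"
  unfolding q0_def q1_def q2_def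
  using R_nonzero periodic_smooth_R[unfolded periodic_smooth_def]
  by (auto intro!: continuous_intros continuous_a_ln_a continuous_E smooth
      smooth_c smooth_c' smooth_c'' intro: smooth_line_continuous)

lemma
  shows periodic_q0: "q0 (t + 2 * pi) = q0 t"
    and periodic_q1: "q1 (t + 2 * pi) = q1 t"
    and periodic_q2: "q2 (t + 2 * pi) = q2 t"
  using periodic_smooth_c periodic_smooth_vderiv[OF periodic_smooth_c] periodic_smooth_R
    periodic_smooth_vderiv[OF periodic_smooth_vderiv[OF periodic_smooth_c]] periodic
  unfolding q0_def q1_def q2_def E_def by (auto simp: periodic_smooth_def)

lemma continuous_density: "smooth_line D \<Longrightarrow> continuous_on UNIV (density D)"
  unfolding density_def
  by (intro continuous_intros continuous_q0 continuous_q1 continuous_q2 smooth_line_continuous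
      smooth_line_vderiv)

lemma periodic_density: "periodic_smooth D \<Longrightarrow> density D (t + 2 * pi) = density D t"
  using periodic_smooth_vderiv[of D] periodic_smooth_vderiv[of "vderiv D"]
  unfolding density_def by (simp add: periodic_q0 periodic_q1 periodic_q2 periodic_smooth_def)

lemma time_shift:
  assumes "periodic_smooth D"
  shows "time D (t + 2 * pi) = time D t + period D"
proof -
  have "antideriv (density D) (t + 2 * pi) = antideriv (density D) t + period D"
    unfolding period_def
    using assms by (intro antideriv_shift continuous_density periodic_density) (auto simp: periodic_smooth_def)
  then show ?thesis
    using assms periodic_smooth_vderiv[OF assms] periodic_smooth_c periodic
      periodic_smooth_vderiv[OF periodic_smooth_c]
    unfolding time_def E_def by (simp add: periodic_smooth_def)
qed

lemma time_has_derivative: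
  assumes D: "smooth_line D" and nz: "a t \<noteq> 0"
  shows "(time D has_real_derivative D t / a t) (at t)"
proof -
  note [derivative_intros] = smooth_line_has_real_derivative[OF D, THEN DERIV_cong]
    smooth_line_has_real_derivative[OF smooth_line_vderiv[OF D], THEN DERIV_cong]
    smooth_line_has_real_derivative[OF smooth, THEN DERIV_cong]
    smooth_line_has_real_derivative[OF smooth_c, THEN DERIV_cong]
    smooth_line_has_real_derivative[OF smooth_c', THEN DERIV_cong]
    DERIV_ln_abs[OF smooth_line_has_real_derivative[OF smooth] nz, THEN DERIV_cong]
    antideriv_has_derivative[OF continuous_density[OF D], THEN DERIV_cong]
  define l where "l = ln \<bar>a t\<bar>"
  define q where "q = 1 / R t"
  have cR: "c t * a' t = 1 - a t * a t * q"
    using R_nonzero[of t] unfolding c_def q_def by (simp add: R_def field_simps power2_eq_square)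
  have "(E has_real_derivative a' t * l) (at t)"
    unfolding E_def l_def by (auto intro!: derivative_eq_intros simp: nz)
  note [derivative_intros] = this[THEN DERIV_cong]
  have Et: "E t = a t * l - a t" by (simp add: E_def l_def)
  have "(time D has_real_derivative
      (vderiv D t * c t + D t * vderiv c t) * l + D t * c t * (a' t / a t)
      - ((vderiv (vderiv D) t * (c t)\<^sup>2 + vderiv D t * (2 * c t * vderiv c t)
          + (vderiv D t * vderiv c t + D t * vderiv (vderiv c) t) * c t
          + D t * vderiv c t * vderiv c t) * E t
        + (vderiv D t * (c t)\<^sup>2 + D t * vderiv c t * c t) * (a' t * l))
      + density D t) (at t)"
    unfolding time_def
    by (auto intro!: derivative_eq_intros simp: l_def[symmetric]) (simp add: algebra_simps)
  also have "(vderiv D t * c t + D t * vderiv c t) * l + D t * c t * (a' t / a t)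
      - ((vderiv (vderiv D) t * (c t)\<^sup>2 + vderiv D t * (2 * c t * vderiv c t)
          + (vderiv D t * vderiv c t + D t * vderiv (vderiv c) t) * c t
          + D t * vderiv c t * vderiv c t) * E t
        + (vderiv D t * (c t)\<^sup>2 + D t * vderiv c t * c t) * (a' t * l))
      + density D t = 
      (vderiv D t * c t + D t * vderiv c t) * l * (1 - c t * a' t - a t * a t * q)
      + D t * (c t * a' t) / a t + D t * a t * q"
    unfolding density_def q0_def q1_def q2_def l_def[symmetric]
    by (simp add: q_def power2_eq_square algebra_simps)
  also have "\<dots> = D t / a t"
    unfolding cR using nz by (simp add: field_simps)
  finally show ?thesis .
qed

text \<open>The term \<open>D c ln \<bar>a\<bar>\<close> contributes the logarithm, with the residue \<open>D p c p = D p / a' p\<close> of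
  the form as its coefficient. The other terms are continuous at \<open>p\<close>.\<close>

lemma time_singularity:
  assumes D: "smooth_line D" and p: "a p = 0"
  shows "\<exists>l. ((\<lambda>t. time D t - D p / a' p * ln \<bar>t - p\<bar>) \<longlongrightarrow> l) (at p)"
proof -
  define m where "m = (\<lambda>t. D t * c t)"
  have m: "smooth_line m" unfolding m_def by (intro smooth_line_mult D smooth_c)
  have mp: "m p = D p / a' p"
    using simple[OF p] p by (simp add: m_def c_def R_def power2_eq_square)
  have 1: "((\<lambda>t. m t * (ln \<bar>a t - a p\<bar> - ln \<bar>t - p\<bar>)) \<longlongrightarrow> m p * ln \<bar>a' p\<bar>) (at p)"
    by (intro tendsto_mult isContD[OF smooth_line_isCont[OF m]]
        tendsto_ln_abs_quotient[OF smooth_line_has_real_derivative[OF smooth] simple[OF p]])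
  have "((\<lambda>t. (m t - m p) / (t - p) * ((t - p) * ln \<bar>t - p\<bar>)) \<longlongrightarrow> vderiv m p * 0) (at p)"
  proof (rule tendsto_mult)
    show "((\<lambda>t. (m t - m p) / (t - p)) \<longlongrightarrow> vderiv m p) (at p)"
      using smooth_line_has_real_derivative[OF m, of p] by (simp add: has_field_derivative_iff)
    have "((\<lambda>t. t - p) \<longlongrightarrow> 0) (at p)" by (auto intro!: tendsto_eq_intros)
    moreover have "\<forall>\<^sub>F t in at p. t - p \<noteq> 0" using eventually_neq_at_within[of p] by eventually_elim auto
    ultimately have "filterlim (\<lambda>t. t - p) (at 0) (at p)" by (rule filterlim_atI)
    then show "((\<lambda>t. (t - p) * ln \<bar>t - p\<bar>) \<longlongrightarrow> 0) (at p)"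
      by (rule filterlim_compose[OF tendsto_x_ln_abs_0])
  qed
  moreover have "\<forall>\<^sub>F t in at p. (m t - m p) / (t - p) * ((t - p) * ln \<bar>t - p\<bar>) = (m t - m p) * ln \<bar>t - p\<bar>"
    using eventually_neq_at_within[of p] by eventually_elim (simp add: field_simps)
  ultimately have 2: "((\<lambda>t. (m t - m p) * ln \<bar>t - p\<bar>) \<longlongrightarrow> vderiv m p * 0) (at p)"
    by (rule Lim_transform_eventually)
  define r where "r = (\<lambda>t. antideriv (density D) t - (vderiv D t * (c t)\<^sup>2 + D t * vderiv c t * c t) * E t)"
  have "continuous_on UNIV (antideriv (density D))"
    using antideriv_has_derivative[OF continuous_density[OF D]]
    by (meson DERIV_isCont continuous_at_imp_continuous_on)
  then have "continuous_on UNIV r"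
    unfolding r_def
    by (intro continuous_intros continuous_E smooth_line_continuous[of "vderiv _"] 
        smooth_line_continuous[of D] smooth_line_continuous[of c] smooth_line_vderiv D smooth_c)
  then have 3: "(r \<longlongrightarrow> r p) (at p)"
    by (simp add: continuous_on_eq_continuous_at isCont_def)
  have "time D t - D p / a' p * ln \<bar>t - p\<bar> =
      m t * (ln \<bar>a t - a p\<bar> - ln \<bar>t - p\<bar>) + (m t - m p) * ln \<bar>t - p\<bar> + r t" for t
    by (simp add: time_def m_def[symmetric] r_def mp[symmetric] p) (simp add: m_def algebra_simps)
  then show ?thesis
    using tendsto_add[OF tendsto_add[OF 1 2] 3] by (metis (no_types, lifting) ext)
qed

lemma zeros_isolated: "a p = 0 \<Longrightarrow> \<forall>\<^sub>F t in at p. a t \<noteq> 0"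
  using eventually_neq_if_deriv_nonzero[OF smooth_line_has_real_derivative[OF smooth] simple, of p]
  by simp

lemma eventually_nonzero: "\<forall>\<^sub>F t in at p. a t \<noteq> 0"
proof (cases "a p = 0")
  case False
  then show ?thesis
    using tendsto_imp_eventually_ne[OF isContD[OF smooth_line_isCont[OF smooth]]] by blast
qed (rule zeros_isolated)

text \<open>The zeros are isolated, and the limit at a zero makes the constants on its two sides equal.\<close>

lemma const_off_zeros:
  assumes deriv: "\<And>t. a t \<noteq> 0 \<Longrightarrow> (h has_real_derivative 0) (at t)"
    and lim: "\<And>p. a p = 0 \<Longrightarrow> \<exists>l. (h \<longlongrightarrow> l) (at p)"
  shows "\<exists>k. \<forall>t. a t \<noteq> 0 \<longrightarrow> h t = k"
proof -
  have const: "h s = h t" if "\<And>u. min s t \<le> u \<Longrightarrow> u \<le> max s t \<Longrightarrow> a u \<noteq> 0" for s t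
  proof -
    have "\<exists>k. \<forall>u\<in>{min s t..max s t}. h u = k"
      using that deriv
      by (intro has_field_derivative_zero_constant) (auto intro: DERIV_subset)
    then show ?thesis by (metis atLeastAtMost_iff max.cobounded1 max.cobounded2 min.cobounded1 min.cobounded2)
  qed
  define H where "H t = (if a t = 0 then Lim (at t) h else h t)" for t
  have "\<forall>\<^sub>F s in nhds t. H s = H t" for t
  proof -
    obtain e where e: "e > 0" "\<And>s. s \<noteq> t \<Longrightarrow> \<bar>s - t\<bar> < e \<Longrightarrow> a s \<noteq> 0"
      using eventually_nonzero[of t] unfolding eventually_at dist_real_def by auto
    have "H s = H t" if s: "\<bar>s - t\<bar> < e" "s \<noteq> t" for s
    proof (cases "a t = 0")
      case False
      have "h s = h t" by (rule const) (use e(2) s False in \<open>smt (verit)\<close>)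
      then show ?thesis using False e(2)[OF s(2,1)] by (simp add: H_def)
    next
      case True
      obtain l where l: "(h \<longlongrightarrow> l) (at t)" using lim[OF True] by blast
      then have Ht: "H t = l" using True tendsto_Lim[of "at t" h l] by (simp add: H_def)
      have "\<forall>\<^sub>F u in at t within (if s < t then {..<t} else {t<..}). h u = h s"
      proof -
        have "\<forall>\<^sub>F u in at t within (if s < t then {..<t} else {t<..}). 
            \<bar>u - t\<bar> < e \<and> u \<in> (if s < t then {..<t} else {t<..})"
          unfolding eventually_at using e(1) by (intro exI[of _ e]) (auto simp: dist_real_def)
        then show ?thesis
        proof eventually_elim
          case (elim u)
          show ?case by (rule const) (use elim s e(2) in \<open>auto split: if_splits\<close>)
        qed
      qed
      then have "((\<lambda>_. h s) \<longlongrightarrow> l) (at t within (if s < t then {..<t} else {t<..}))"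
        by (rule Lim_transform_eventually[OF tendsto_within_subset[OF l subset_UNIV]])
      then have "h s = l"
        by (auto split: if_splits simp: tendsto_const_iff trivial_limit_at_left_real trivial_limit_at_right_real)
      then show ?thesis using Ht e(2)[OF s(2,1)] by (simp add: H_def)
    qed
    then show ?thesis
      unfolding eventually_nhds_metric dist_real_def using e(1) by (metis)
  qed
  then have "(H has_real_derivative 0) (at t)" for t
    using DERIV_cong_ev[OF refl, of H "\<lambda>_. H t" t 0 0] by simp
  then have "H t = H 0" for t using real_const_if_derivative_0 by blast
  then show ?thesis unfolding H_def by metis
qed

end

section \<open>Symmetries preserve the time function\<close>

context simple_zeros
begin

lemma nonzero_ex: "\<exists>t. a t \<noteq> 0"
proof (rule ccontr)
  assume "\<nexists>t. a t \<noteq> 0"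
  then have "a = (\<lambda>_. 0)" by auto
  then have "a' = (\<lambda>_. 0)" by (intro vderiv_realI) auto
  with simple \<open>a = (\<lambda>_. 0)\<close> show False by metis
qed

text \<open>The form \<open>w dt\<close> has no poles, so its principal value is the ordinary integral.\<close>

lemma period_exact:
  assumes w: "periodic_smooth w" "\<And>t. w t > 0"
  shows "period (\<lambda>t. a t * w t) > 0"
proof -
  let ?D = "\<lambda>t. a t * w t"
  have sw: "smooth_line w" using w(1) by (simp add: periodic_smooth_def)
  have D: "periodic_smooth ?D"
    using w(1) periodic_smooth by (auto simp: periodic_smooth_def intro: smooth_line_mult)
  have sD: "smooth_line ?D" using D by (simp add: periodic_smooth_def)
  have W: "(antideriv w has_real_derivative w t) (at t)" for t
    by (intro antideriv_has_derivative smooth_line_continuous sw)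
  have "\<exists>k. \<forall>t. a t \<noteq> 0 \<longrightarrow> time ?D t - antideriv w t = k"
  proof (rule const_off_zeros)
    show "((\<lambda>t. time ?D t - antideriv w t) has_real_derivative 0) (at t)" if "a t \<noteq> 0" for t
      using DERIV_diff[OF time_has_derivative[OF sD that] W[of t]] that by simp
    show "\<exists>l. ((\<lambda>t. time ?D t - antideriv w t) \<longlongrightarrow> l) (at p)" if p: "a p = 0" for p
    proof -
      obtain l where "((\<lambda>t. time ?D t) \<longlongrightarrow> l) (at p)"
        using time_singularity[OF sD p] p by auto
      then show ?thesis using tendsto_diff[OF _ isContD[OF DERIV_isCont[OF W[of p]]]] by blast
    qed
  qed
  then obtain k where k: "\<And>t. a t \<noteq> 0 \<Longrightarrow> time ?D t = antideriv w t + k"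
    by (metis diff_add_cancel add.commute)
  obtain t where t: "a t \<noteq> 0" using nonzero_ex by blast
  have "period ?D = antideriv w (t + 2 * pi) - antideriv w t"
    using time_shift[OF D, of t] k[OF t] k[of "t + 2 * pi"] t periodic by simp
  moreover have "antideriv w t < antideriv w (t + 2 * pi)"
    by (rule DERIV_pos_imp_increasing[of t]) (use W w(2) pi_gt_zero in \<open>simp, blast\<close>)
  ultimately show ?thesis by simp
qed

end

text \<open>The function \<open>X\<close> below is the coefficient of the gradient, with respect to a metric with
  coefficient \<open>G\<close>, of a function with derivative \<open>a\<close>.\<close>

locale positive_coefficient = simple_zeros +
  fixes G :: "real \<Rightarrow> real"
  assumes periodic_smooth_G: "periodic_smooth G" and G_pos: "\<And>t. G t > 0"
begin

lemma smooth_G: "smooth_line G"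
  using periodic_smooth_G by (simp add: periodic_smooth_def)

definition X :: "real \<Rightarrow> real" where "X t = a t / G t"

lemma X_eq_0_iff: "X t = 0 \<longleftrightarrow> a t = 0"
  using G_pos[of t] by (simp add: X_def)

lemma smooth_X: "smooth_line X"
  unfolding X_def using G_pos by (intro smooth_line_divide smooth smooth_G) (simp add: less_imp_neq[symmetric])

lemma periodic_smooth_X: "periodic_smooth X"
  using smooth_X periodic_smooth_G periodic by (simp add: periodic_smooth_def X_def)

lemma X_deriv_zero:
  assumes "a p = 0" shows "vderiv X p = a' p / G p"
proof -
  have "(X has_real_derivative (a' p * G p - a p * vderiv G p) / (G p * G p)) (at p)"
    unfolding X_def using G_pos[of p]
    by (intro DERIV_divide smooth_line_has_real_derivative smooth smooth_G) auto
  then show ?thesis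
    using DERIV_unique[OF smooth_line_has_real_derivative[OF smooth_X]] assms G_pos[of p]
    by (fastforce simp: field_simps)
qed

lemma time_G_has_derivative: "a t \<noteq> 0 \<Longrightarrow> (time G has_real_derivative 1 / X t) (at t)"
  using time_has_derivative[OF smooth_G, of t] by (simp add: X_def)

lemma time_neq:
  assumes "u < v" "\<And>s. u \<le> s \<Longrightarrow> s \<le> v \<Longrightarrow> a s \<noteq> 0"
  shows "time G u \<noteq> time G v"
proof
  assume eq: "time G u = time G v"
  have "\<exists>z>u. z < v \<and> time G v - time G u = (v - u) * (1 / X z)"
    by (rule MVT2[OF assms(1)]) (use assms(2) time_G_has_derivative in auto)
  then obtain z where "u < z" "z < v" "(v - u) * (1 / X z) = 0" using eq by auto
  then show False using assms X_eq_0_iff[of z] by auto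
qed

text \<open>The last condition says that \<open>L\<close> maps the vector field \<open>X d/dt\<close> to itself.\<close>

definition symmetry :: "(real \<Rightarrow> real) \<Rightarrow> bool" where
  "symmetry L \<longleftrightarrow> smooth_line L \<and> (\<forall>t. vderiv L t \<noteq> 0) \<and> (\<forall>t. vderiv L t * X t = X (L t))"

lemma symmetry_zero_iff: "symmetry L \<Longrightarrow> a (L t) = 0 \<longleftrightarrow> a t = 0"
  unfolding symmetry_def by (metis X_eq_0_iff mult_eq_0_iff)

text \<open>Differentiate \<open>L' X = X \<circ> L\<close> at the zero.\<close>

lemma symmetry_multiplier:
  assumes "symmetry L" "a p = 0"
  shows "a' (L p) / G (L p) = a' p / G p"
proof -
  have L: "smooth_line L" "vderiv L p \<noteq> 0" and eq: "\<And>t. vderiv L t * X t = X (L t)"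
    using assms(1) by (auto simp: symmetry_def)
  have 1: "((\<lambda>t. X (L t)) has_real_derivative vderiv X (L p) * vderiv L p) (at p)"
    by (intro DERIV_chain2 smooth_line_has_real_derivative smooth_X L)
  have 2: "((\<lambda>t. vderiv L t * X t) has_real_derivative
      vderiv (vderiv L) p * X p + vderiv X p * vderiv L p) (at p)"
    by (intro DERIV_mult smooth_line_has_real_derivative smooth_X L smooth_line_vderiv)
  have "vderiv X (L p) = vderiv X p"
    using DERIV_unique[OF 1 2[unfolded eq]] assms(2) X_eq_0_iff[of p] L(2) by simp
  then show ?thesis
    using X_deriv_zero assms symmetry_zero_iff[OF assms(1), of p] by simp
qed

text \<open>A symmetry pulls back the time function to a function with the same derivative. The
  logarithmic singularities also agree, as the residues are inverse multipliers.\<close>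

lemma symmetry_time:
  assumes sym: "symmetry L"
  shows "\<exists>k. \<forall>t. a t \<noteq> 0 \<longrightarrow> time G (L t) = time G t + k"
proof -
  have L: "smooth_line L" "\<And>t. vderiv L t \<noteq> 0" and eq: "\<And>t. vderiv L t * X t = X (L t)"
    using sym by (auto simp: symmetry_def)
  note dL = smooth_line_has_real_derivative[OF L(1)]
  have "\<exists>k. \<forall>t. a t \<noteq> 0 \<longrightarrow> time G (L t) - time G t = k"
  proof (rule const_off_zeros)
    fix t assume t: "a t \<noteq> 0"
    have aL: "a (L t) \<noteq> 0" using t symmetry_zero_iff[OF sym] by simp
    have "((\<lambda>t. time G (L t) - time G t) has_real_derivative 1 / X (L t) * vderiv L t - 1 / X t) (at t)"
      by (intro DERIV_diff DERIV_chain2[OF _ dL] time_G_has_derivative t aL)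
    moreover have "1 / X (L t) * vderiv L t - 1 / X t = 0"
      using L(2)[of t] X_eq_0_iff[of t] t by (simp flip: eq)
    ultimately show "((\<lambda>t. time G (L t) - time G t) has_real_derivative 0) (at t)" by simp
  next
    fix p assume p: "a p = 0"
    have aL: "a (L p) = 0" using p symmetry_zero_iff[OF sym] by simp
    define \<mu> where "\<mu> = G p / a' p"
    have \<mu>': "G (L p) / a' (L p) = \<mu>"
      using symmetry_multiplier[OF sym p] by (metis \<mu>_def inverse_divide)
    obtain l1 where l1: "((\<lambda>t. time G t - \<mu> * ln \<bar>t - p\<bar>) \<longlongrightarrow> l1) (at p)"
      using time_singularity[OF smooth_G p] by (auto simp: \<mu>_def)
    obtain l2 where l2: "((\<lambda>t. time G t - \<mu> * ln \<bar>t - L p\<bar>) \<longlongrightarrow> l2) (at (L p))"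
      using time_singularity[OF smooth_G aL] by (auto simp: \<mu>')
    have "filterlim L (at (L p)) (at p)"
      using isContD[OF DERIV_isCont[OF dL]] eventually_neq_if_deriv_nonzero[OF dL L(2)]
      by (rule filterlim_atI)
    from filterlim_compose[OF l2 this]
    have l3: "((\<lambda>t. time G (L t) - \<mu> * ln \<bar>L t - L p\<bar>) \<longlongrightarrow> l2) (at p)" .
    have l4: "((\<lambda>t. ln \<bar>L t - L p\<bar> - ln \<bar>t - p\<bar>) \<longlongrightarrow> ln \<bar>vderiv L p\<bar>) (at p)"
      by (rule tendsto_ln_abs_quotient[OF dL L(2)])
    have "(\<lambda>t. time G (L t) - time G t) =
        (\<lambda>t. (time G (L t) - \<mu> * ln \<bar>L t - L p\<bar>) - (time G t - \<mu> * ln \<bar>t - p\<bar>)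
          + \<mu> * (ln \<bar>L t - L p\<bar> - ln \<bar>t - p\<bar>))"
      by (simp add: algebra_simps)
    then show "\<exists>l. ((\<lambda>t. time G (L t) - time G t) \<longlongrightarrow> l) (at p)"
      using tendsto_add[OF tendsto_diff[OF l3 l1] tendsto_mult_left[OF l4]] by auto
  qed
  then obtain k where "\<And>t. a t \<noteq> 0 \<Longrightarrow> time G (L t) - time G t = k" by blast
  then show ?thesis by (intro exI[of _ k]) (simp add: diff_eq_eq add.commute)
qed

text \<open>One turn around the circle increases the time function by the period. Since the symmetry
  changes it by a constant and reverses the turn, the period equals its negative.\<close>

lemma reversing_symmetry_period:
  assumes sym: "symmetry L" and rev: "\<And>t. L (t + 2 * pi) = L t - 2 * pi"
  shows "period G = 0"
proof -
  obtain k where k: "\<And>t. a t \<noteq> 0 \<Longrightarrow> time G (L t) = time G t + k"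
    using symmetry_time[OF sym] by blast
  obtain t where t: "a t \<noteq> 0" using nonzero_ex by blast
  have "time G (L t) = time G (L t - 2 * pi) + period G"
    using time_shift[OF periodic_smooth_G, of "L t - 2 * pi"] by simp
  also have "time G (L t - 2 * pi) = time G t + period G + k"
    using k[of "t + 2 * pi"] t rev[of t] periodic time_shift[OF periodic_smooth_G, of t] by simp
  finally show ?thesis using k[OF t] by simp
qed

text \<open>The time function is injective on each side of a zero, and increasing maps that agree at a point
  stay on the same side of the common value. Hence the set on which the maps agree is open.\<close>

lemma symmetries_eq:
  assumes sym: "symmetry L1" "symmetry L2" 
    and incr: "\<And>t. vderiv L1 t > 0" "\<And>t. vderiv L2 t > 0"
    and time: "\<And>t. a t \<noteq> 0 \<Longrightarrow> time G (L1 t) = time G (L2 t)" and "L1 t0 = L2 t0"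
  shows "L1 t = L2 t"
proof -
  have smooth: "smooth_line L1" "smooth_line L2" using sym by (auto simp: symmetry_def)
  have mono: "s < t \<Longrightarrow> L1 s < L1 t" "s < t \<Longrightarrow> L2 s < L2 t" for s t
    by (rule DERIV_pos_imp_increasing, assumption,
        use incr smooth_line_has_real_derivative smooth in blast)+
  have cont: "isCont L1 t" "isCont L2 t" for t using smooth by (auto intro: smooth_line_isCont)
  let ?T = "{t. L1 t = L2 t}"
  have "closed ?T" using smooth by (intro closed_Collect_eq smooth_line_continuous)
  moreover have "open ?T"
    unfolding open_dist
  proof
    fix t assume t: "t \<in> ?T"
    obtain e where e: "e > 0" "\<And>s. s \<noteq> L1 t \<Longrightarrow> \<bar>s - L1 t\<bar> < e \<Longrightarrow> a s \<noteq> 0"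
      using eventually_nonzero[of "L1 t"] unfolding eventually_at dist_real_def by auto
    have "\<forall>\<^sub>F s in nhds t. \<bar>L1 s - L1 t\<bar> < e \<and> \<bar>L2 s - L1 t\<bar> < e"
      using cont[of t] t e(1) unfolding isCont_def tendsto_iff dist_real_def 
      by (auto simp: eventually_conj_iff eventually_nhds_conv_at)
    then obtain d where d: "d > 0" "\<And>s. \<bar>s - t\<bar> < d \<Longrightarrow> \<bar>L1 s - L1 t\<bar> < e \<and> \<bar>L2 s - L1 t\<bar> < e"
      unfolding eventually_nhds_metric dist_real_def by blast
    have "L1 s = L2 s" if s: "\<bar>s - t\<bar> < d" for s
    proof (cases "s = t")
      case False
      \<comment> \<open>both values lie on the same side of the possible zero \<open>L1 t\<close>\<close>
      have side: "L1 s \<noteq> L1 t \<and> (L1 s < L1 t \<longleftrightarrow> L2 s < L1 t) \<and> L2 s \<noteq> L1 t"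
        using False mono[of s t] mono[of t s] t by (cases "s < t") auto
      have "a (L1 s) \<noteq> 0" using side d(2)[OF s] e(2) by blast
      then have "time G (L1 s) = time G (L2 s)" using time symmetry_zero_iff[OF sym(1)] by blast
      moreover have "time G u \<noteq> time G v" if "u < v" "{u, v} = {L1 s, L2 s}" for u v
      proof (rule time_neq[OF that(1)])
        fix r assume "u \<le> r" "r \<le> v"
        then have "r \<noteq> L1 t \<and> \<bar>r - L1 t\<bar> < e"
          using that side d(2)[OF s] by (auto simp: doubleton_eq_iff)
        then show "a r \<noteq> 0" using e(2) by blast
      qed
      ultimately show ?thesis by (metis insert_commute linorder_neqE)
    qed (use t in simp)
    then show "\<exists>d>0. \<forall>s. dist s t < d \<longrightarrow> s \<in> ?T" using d(1) by (auto simp: dist_real_def)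
  qed
  ultimately have "?T = UNIV" using clopen[of ?T] assms(6) by blast
  then show ?thesis by blast
qed

subsection \<open>Trajectories\<close>

lemma time_unbounded:
  assumes p: "a p = 0"
  shows "\<forall>\<^sub>F t in at p. B < \<bar>time G t\<bar>"
proof -
  define \<mu> where "\<mu> = G p / a' p"
  have "\<mu> \<noteq> 0" using G_pos[of p] simple[OF p] by (simp add: \<mu>_def)
  obtain l where l: "((\<lambda>t. time G t - \<mu> * ln \<bar>t - p\<bar>) \<longlongrightarrow> l) (at p)"
    using time_singularity[OF smooth_G p] by (auto simp: \<mu>_def)
  have ev1: "\<forall>\<^sub>F t in at p. dist (time G t - \<mu> * ln \<bar>t - p\<bar>) l < 1"
    using l by (rule tendstoD) simp
  define C where "C = - (\<bar>B\<bar> + \<bar>l\<bar> + 1) / \<bar>\<mu>\<bar>"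
  have ev2: "\<forall>\<^sub>F t in at p. \<bar>t - p\<bar> < exp C \<and> t \<noteq> p"
    unfolding eventually_at by (intro exI[of _ "exp C"]) (auto simp: dist_real_def)
  show ?thesis
    using ev1 ev2
  proof eventually_elim
    case (elim t)
    have "ln \<bar>t - p\<bar> < C" using elim ln_less_cancel_iff[of "\<bar>t - p\<bar>" "exp C"] by simp
    then have "\<bar>\<mu>\<bar> * ln \<bar>t - p\<bar> < \<bar>\<mu>\<bar> * C" using \<open>\<mu> \<noteq> 0\<close> by (intro mult_strict_left_mono) auto
    also have "\<bar>\<mu>\<bar> * C = - (\<bar>B\<bar> + \<bar>l\<bar> + 1)" using \<open>\<mu> \<noteq> 0\<close> by (simp add: C_def)
    finally have "\<bar>B\<bar> + \<bar>l\<bar> + 1 < - (\<bar>\<mu>\<bar> * ln \<bar>t - p\<bar>)" by simp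
    also have "\<dots> \<le> \<bar>\<mu> * ln \<bar>t - p\<bar>\<bar>" 
      using mult_left_mono[of "- ln \<bar>t - p\<bar>" "\<bar>ln \<bar>t - p\<bar>\<bar>" "\<bar>\<mu>\<bar>"] by (simp add: abs_mult)
    finally have "\<bar>B\<bar> + \<bar>l\<bar> + 1 < \<bar>\<mu> * ln \<bar>t - p\<bar>\<bar>" .
    then show ?case using elim(1) by (auto simp: dist_real_def)
  qed
qed

lemma unbounded_increasing_surj:
  fixes h :: "real \<Rightarrow> real"
  assumes "l < r" and cont: "continuous_on {l<..<r} h" 
    and mono: "\<And>x y. l < x \<Longrightarrow> x < y \<Longrightarrow> y < r \<Longrightarrow> h x < h y"
    and left: "\<And>B. \<forall>\<^sub>F t in at_right l. B < \<bar>h t\<bar>" and right: "\<And>B. \<forall>\<^sub>F t in at_left r. B < \<bar>h t\<bar>"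
  shows "\<exists>y. l < y \<and> y < r \<and> h y = v"
proof -
  define x0 where "x0 = (l + r) / 2"
  have x0: "l < x0" "x0 < r" using \<open>l < r\<close> by (auto simp: x0_def)
  let ?B = "\<bar>h x0\<bar> + \<bar>v\<bar>"
  have "\<forall>\<^sub>F t in at_right l. ?B < \<bar>h t\<bar> \<and> l < t \<and> t < x0"
    using left[of ?B] eventually_at_right_real[OF x0(1)] by eventually_elim auto
  then obtain x where x: "?B < \<bar>h x\<bar>" "l < x" "x < x0"
    using eventually_happens'[OF trivial_limit_at_right_real] by blast
  have "\<forall>\<^sub>F t in at_left r. ?B < \<bar>h t\<bar> \<and> x0 < t \<and> t < r"
    using right[of ?B] eventually_at_left_real[OF x0(2)] by eventually_elim auto
  then obtain y where y: "?B < \<bar>h y\<bar>" "x0 < y" "y < r"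
    using eventually_happens'[OF trivial_limit_at_left_real] by blast
  have "h x < v" using mono[OF x(2,3) x0(2)] x(1) by (smt (verit))
  moreover have "v < h y" using mono[OF x0(1) y(2,3)] y(1) by (smt (verit))
  moreover have "continuous_on {x..y} h"
    using x(2) y(3) by (intro continuous_on_subset[OF cont]) auto
  ultimately obtain z where "x \<le> z" "z \<le> y" "h z = v"
    using IVT'[of h x v y] x(3) y(2) by auto
  then show ?thesis using x(2) y(3) by (intro exI[of _ z]) auto
qed

lemma gap_between_zeros:
  assumes t: "a t \<noteq> 0" and z: "a z = 0"
  obtains l r where "l < t" "t < r" "a l = 0" "a r = 0" "\<And>s. l < s \<Longrightarrow> s < r \<Longrightarrow> a s \<noteq> 0"
proof -
  let ?Z = "{s. a s = 0}"
  have "closed ?Z" by (intro closed_Collect_eq smooth_line_continuous smooth) auto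
  obtain k :: int where k: "0 \<le> (z - t) + 2 * pi * k" "(z - t) + 2 * pi * k < 2 * pi"
    using reduce_angle by blast
  define u where "u = z + 2 * pi * k"
  have u: "a u = 0" using periodic_int[of a, OF periodic] z by (simp add: u_def)
  then have u2: "a (u - 2 * pi) = 0" using periodic[of "u - 2 * pi"] by simp
  have tu: "t \<le> u" "u - 2 * pi \<le> t" using k by (auto simp: u_def)
  let ?A = "?Z \<inter> {..t}" and ?B = "?Z \<inter> {t..}"
  have A: "Sup ?A \<in> ?A"
    by (rule closed_contains_Sup) (use \<open>closed ?Z\<close> u2 tu in auto)
  have B: "Inf ?B \<in> ?B"
    by (rule closed_contains_Inf) (use \<open>closed ?Z\<close> u tu in auto)
  have "a s \<noteq> 0" if "Sup ?A < s" "s < Inf ?B" for s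
  proof
    assume "a s = 0"
    then consider "s \<in> ?A" | "s \<in> ?B" by force
    then show False
    proof cases
      case 1 then have "s \<le> Sup ?A" by (intro cSup_upper) auto
      then show False using that by simp
    next
      case 2 then have "Inf ?B \<le> s" by (intro cInf_lower) auto
      then show False using that by simp
    qed
  qed
  moreover have "Sup ?A \<noteq> t" "Inf ?B \<noteq> t" using A B t by auto
  ultimately show ?thesis using that[of "Sup ?A" "Inf ?B"] A B by auto
qed

text \<open>Between two zeros the trajectories are the inverse of the time function, whose values
  exhaust the line because of its logarithmic singularities.\<close>

lemma trajectory_ex:
  assumes z: "a z = 0"
  shows "\<exists>y. y 0 = t \<and> (\<forall>s. (y has_real_derivative X (y s)) (at s))"
proof (cases "a t = 0")
  case True
  then show ?thesis using X_eq_0_iff[of t] by (intro exI[of _ "\<lambda>_. t"]) auto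
next
  case False
  obtain l r where lr: "l < t" "t < r" "a l = 0" "a r = 0" and nz: "\<And>s. l < s \<Longrightarrow> s < r \<Longrightarrow> a s \<noteq> 0"
    using gap_between_zeros[OF False z] by blast
  let ?S = "time G"
  have dS: "(?S has_real_derivative 1 / X s) (at s)" if "l < s" "s < r" for s
    using nz that time_G_has_derivative by blast
  have contS: "continuous_on {l<..<r} ?S"
    by (intro continuous_at_imp_continuous_on) (auto intro: DERIV_isCont[OF dS])
  have sign: "0 < a u \<longleftrightarrow> 0 < a v" if "l < u" "u < r" "l < v" "v < r" for u v
    by (rule continuous_nonzero_sign[of "min u v" "max u v"])
      (use that nz smooth_line_continuous[OF smooth] in auto)
  have Xpos: "0 < X s \<longleftrightarrow> 0 < a s" "X s < 0 \<longleftrightarrow> a s < 0" for s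
    using G_pos[of s] by (auto simp: X_def zero_less_divide_iff divide_less_0_iff)
  have surj: "\<exists>y. l < y \<and> y < r \<and> ?S y = v" for v
  proof (cases "0 < a t")
    case True
    have "?S x < ?S y" if "l < x" "x < y" "y < r" for x y
    proof (rule DERIV_pos_imp_increasing[OF that(2)])
      fix s assume "x \<le> s" "s \<le> y"
      then have "l < s" "s < r" using that by auto
      then show "\<exists>d. (?S has_real_derivative d) (at s) \<and> 0 < d"
        using dS sign[of s t] lr True Xpos by (intro exI[of _ "1 / X s"]) auto
    qed
    then show ?thesis
      using lr by (intro unbounded_increasing_surj contS)
        (auto intro: filter_leD[OF at_le[OF subset_UNIV]] time_unbounded)
  next
    case neg: False
    have "- ?S x < - ?S y" if "l < x" "x < y" "y < r" for x y
    proof (rule DERIV_pos_imp_increasing[OF that(2)])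
      fix s assume "x \<le> s" "s \<le> y"
      then have s: "l < s" "s < r" using that by auto
      then have "a s < 0" using sign[of s t] lr neg nz[of s] by (meson linorder_neqE)
      then show "\<exists>d. ((\<lambda>x. - ?S x) has_real_derivative d) (at s) \<and> 0 < d"
        using DERIV_minus[OF dS[OF s]] Xpos(2) by (intro exI[of _ "- (1 / X s)"]) auto
    qed
    then have "\<exists>y. l < y \<and> y < r \<and> - ?S y = - v"
      using lr by (intro unbounded_increasing_surj continuous_on_minus contS)
        (auto intro: filter_leD[OF at_le[OF subset_UNIV]] time_unbounded)
    then show ?thesis by simp
  qed
  have inj: "x = y" if "l < x" "x < r" "l < y" "y < r" "?S x = ?S y" for x y
    using time_neq[of x y] time_neq[of y x] nz that by (metis linorder_neqE order.strict_trans1 order.strict_trans2)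
  obtain g where g: "\<And>v. l < g v \<and> g v < r \<and> ?S (g v) = v" using surj by metis
  have gS: "g (?S x) = x" if "l < x" "x < r" for x using inj g that by blast
  have contg: "isCont g v" for v
  proof -
    obtain x y where xy: "l < x" "x < g v" "g v < y" "y < r" using g[of v] dense by meson
    have "isCont g (?S (g v))"
      by (rule isCont_inverse_function2[of x "g v" y])
        (use xy gS in \<open>auto intro: DERIV_isCont[OF dS]\<close>)
    then show ?thesis using g by simp
  qed
  have dg: "(g has_real_derivative X (g v)) (at v)" for v
  proof -
    have "(g has_real_derivative inverse (1 / X (g v))) (at v)"
      by (rule DERIV_inverse_function[of ?S _ g v "v - 1" "v + 1"])
        (use g dS contg nz[of "g v"] X_eq_0_iff[of "g v"] in auto)
    then show ?thesis by simp
  qed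
  show ?thesis
  proof (intro exI[of _ "\<lambda>s. g (s + ?S t)"] conjI allI)
    show "g (0 + ?S t) = t" using gS lr by simp
    show "((\<lambda>s. g (s + ?S t)) has_real_derivative X (g (s + ?S t))) (at s)" for s
      using DERIV_shift[THEN iffD1, OF dg] .
  qed
qed

end

section \<open>Smooth dependence of trajectories on the initial value\<close>

locale complete_ode =
  fixes X :: "real \<Rightarrow> real"
  assumes periodic_smooth: "periodic_smooth X"
    and trajectory_ex: "\<And>t. \<exists>y. y 0 = t \<and> (\<forall>s. (y has_real_derivative X (y s)) (at s))"
begin

lemma smooth: "smooth_line X" using periodic_smooth by (simp add: periodic_smooth_def)

lemmas continuous_X' = smooth_line_continuous[OF smooth_line_vderiv[OF smooth]]

text \<open>The usual quotient in a form that is continuous on the diagonal.\<close>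

definition divided_difference :: "real \<Rightarrow> real \<Rightarrow> real" where
  "divided_difference x y = integral {0..1} (\<lambda>u. vderiv X (x + u * (y - x)))"

lemma divided_difference_eq: "X y - X x = divided_difference x y * (y - x)"
proof -
  have "((\<lambda>u. vderiv X (x + u * (y - x)) * (y - x)) has_integral (X (x + 1 * (y - x)) - X (x + 0 * (y - x)))) {0..1}"
  proof (rule fundamental_theorem_of_calculus)
    fix u :: real
    have "((\<lambda>u. X (x + u * (y - x))) has_real_derivative vderiv X (x + u * (y - x)) * (y - x)) (at u within {0..1})"
      by (rule DERIV_chain2[OF smooth_line_has_real_derivative[OF smooth]]) (auto intro!: derivative_eq_intros)
    then show "((\<lambda>u. X (x + u * (y - x))) has_vector_derivative vderiv X (x + u * (y - x)) * (y - x)) (at u within {0..1})"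
      by (simp add: has_real_derivative_iff_has_vector_derivative)
  qed simp
  from integral_unique[OF this] show ?thesis by (simp add: divided_difference_def)
qed

lemma divided_difference_same: "divided_difference x x = vderiv X x"
  by (simp add: divided_difference_def)

lemma continuous_divided_difference:
  assumes "continuous_on S f" "continuous_on S g"
  shows "continuous_on S (\<lambda>p. divided_difference (f p) (g p))"
proof -
  have "continuous_on (UNIV \<times> cbox 0 1) (\<lambda>(p, u). vderiv X (fst p + u * (snd p - fst p)))"
    unfolding split_beta by (intro continuous_on_compose2[OF continuous_X'[of UNIV]] continuous_intros) auto
  then have "continuous_on UNIV (\<lambda>p. integral (cbox 0 1) (\<lambda>u. vderiv X (fst p + u * (snd p - fst p))))"
    by (rule integral_continuous_on_param)
  then have "continuous_on UNIV (\<lambda>p. divided_difference (fst p) (snd p))"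
    by (simp add: divided_difference_def)
  from continuous_on_compose2[OF this continuous_on_Pair[OF assms]] show ?thesis by simp
qed

lemma divided_difference_bounded: "\<exists>K>0. \<forall>x y. \<bar>divided_difference x y\<bar> \<le> K"
proof -
  obtain K where K: "K > 0" "\<And>t. \<bar>vderiv X t\<bar> \<le> K"
    using periodic_smooth_bounded[OF periodic_smooth_vderiv[OF periodic_smooth]] by blast
  have "norm (integral {0..1} (\<lambda>u. vderiv X (x + u * (y - x)))) \<le> K * (1 - 0)" for x y
    by (intro integral_bound continuous_on_compose2[OF continuous_X'[of UNIV]] continuous_intros) (use K in auto)
  then show ?thesis using K(1) by (auto simp: divided_difference_def)
qed

definition trajectory :: "(real \<Rightarrow> real) \<Rightarrow> bool" where
  "trajectory y \<longleftrightarrow> (\<forall>s. (y has_real_derivative X (y s)) (at s))"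

lemma trajectory_continuous: "trajectory y \<Longrightarrow> continuous_on S y"
  unfolding trajectory_def by (meson DERIV_isCont continuous_at_imp_continuous_on)

text \<open>The difference of two trajectories solves a linear equation, with the divided difference
  as its coefficient.\<close>

lemma trajectory_diff:
  assumes "trajectory y" "trajectory z"
  shows "z s - y s = (z 0 - y 0) * exp (antideriv (\<lambda>r. divided_difference (y r) (z r)) s)"
proof -
  define I where "I = antideriv (\<lambda>r. divided_difference (y r) (z r))"
  have I: "(I has_real_derivative divided_difference (y r) (z r)) (at r)" for r
    unfolding I_def
    by (intro antideriv_has_derivative continuous_divided_difference trajectory_continuous assms)
  have yz: "(y has_real_derivative X (y r)) (at r)" "(z has_real_derivative X (z r)) (at r)" for r
    using assms by (auto simp: trajectory_def)
  have "((\<lambda>r. (z r - y r) * exp (- I r)) has_real_derivative 0) (at r)" for r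
  proof -
    have "((\<lambda>r. (z r - y r) * exp (- I r)) has_real_derivative
        (X (z r) - X (y r)) * exp (- I r) + exp (- I r) * (- divided_difference (y r) (z r)) * (z r - y r)) (at r)"
      by (intro DERIV_mult DERIV_diff yz DERIV_chain2[OF DERIV_exp] DERIV_minus I)
    then show ?thesis by (simp add: divided_difference_eq)
  qed
  from real_const_if_derivative_0[OF this, of s 0]
  have "(z s - y s) * exp (- I s) = z 0 - y 0" by (simp add: I_def)
  then show ?thesis by (simp add: I_def exp_minus field_simps)
qed

definition Y :: "real \<Rightarrow> real \<Rightarrow> real" where
  "Y s t = (SOME y. y 0 = t \<and> trajectory y) s"

lemma Y_0 [simp]: "Y 0 t = t" and trajectory_Y: "trajectory (\<lambda>s. Y s t)"
proof -
  have "\<exists>y. y 0 = t \<and> trajectory y" using trajectory_ex by (simp add: trajectory_def)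
  from someI_ex[OF this] show "Y 0 t = t" "trajectory (\<lambda>s. Y s t)" by (simp_all add: Y_def)
qed

lemma Y_has_derivative: "((\<lambda>s. Y s t) has_real_derivative X (Y s t)) (at s)"
  using trajectory_Y by (simp add: trajectory_def)

lemma trajectory_eq_Y: "trajectory y \<Longrightarrow> y s = Y s (y 0)"
  using trajectory_diff[OF trajectory_Y, of y s "y 0"] by simp

lemma Y_add: "Y (s + r) t = Y s (Y r t)"
proof -
  have "trajectory (\<lambda>s. Y (s + r) t)"
    unfolding trajectory_def using DERIV_shift[THEN iffD1, OF Y_has_derivative] by (intro allI)
  from trajectory_eq_Y[OF this, of s] show ?thesis by simp
qed

lemma Y_diff: "Y s u - Y s t = (u - t) * exp (antideriv (\<lambda>r. divided_difference (Y r t) (Y r u)) s)"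
  using trajectory_diff[OF trajectory_Y trajectory_Y, of s u t] by simp

lemma Y_lipschitz: "\<exists>K>0. \<forall>s t u. \<bar>Y s u - Y s t\<bar> \<le> \<bar>u - t\<bar> * exp (K * \<bar>s\<bar>)"
proof -
  obtain K where K: "K > 0" "\<And>x y. \<bar>divided_difference x y\<bar> \<le> K" using divided_difference_bounded by blast
  have "\<bar>Y s u - Y s t\<bar> \<le> \<bar>u - t\<bar> * exp (K * \<bar>s\<bar>)" for s t u
  proof -
    have "norm (integral {0..1} (\<lambda>v. s * divided_difference (Y (s * v) t) (Y (s * v) u))) \<le> K * \<bar>s\<bar> * (1 - 0)"
    proof (rule integral_bound)
      show "continuous_on {0..1} (\<lambda>v. s * divided_difference (Y (s * v) t) (Y (s * v) u))"
        by (intro continuous_intros continuous_divided_difference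
            continuous_on_compose2[OF trajectory_continuous[OF trajectory_Y, of UNIV]]) auto
      show "norm (s * divided_difference (Y (s * v) t) (Y (s * v) u)) \<le> K * \<bar>s\<bar>" for v
        using mult_right_mono[OF K(2), of "\<bar>s\<bar>"] by (simp add: abs_mult mult.commute)
    qed simp
    then have "antideriv (\<lambda>r. divided_difference (Y r t) (Y r u)) s \<le> K * \<bar>s\<bar>" 
      by (simp only: antideriv_def real_norm_def diff_zero mult_1_right abs_le_iff)
    then show ?thesis
      unfolding Y_diff by (simp add: abs_mult mult_left_mono)
  qed
  then show ?thesis using K(1) by blast
qed

lemma continuous_Y:
  assumes "continuous_on S f" "continuous_on S g"
  shows "continuous_on S (\<lambda>p. Y (f p) (g p))"
proof -
  obtain K where K: "K > 0" "\<And>s t u. \<bar>Y s u - Y s t\<bar> \<le> \<bar>u - t\<bar> * exp (K * \<bar>s\<bar>)"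
    using Y_lipschitz by blast
  have "isCont (\<lambda>p. Y (fst p) (snd p)) (s0, t0)" for s0 t0
  proof -
    let ?F = "at (s0, t0)"
    have fs: "(fst \<longlongrightarrow> s0) ?F" "(snd \<longlongrightarrow> t0) ?F"
      using tendsto_fst[OF tendsto_ident_at, of "(s0, t0)" UNIV] tendsto_snd[OF tendsto_ident_at, of "(s0, t0)" UNIV] by simp_all
    have "((\<lambda>p. \<bar>snd p - t0\<bar> * exp (K * \<bar>fst p\<bar>) + \<bar>Y (fst p) t0 - Y s0 t0\<bar>) \<longlongrightarrow>
        \<bar>t0 - t0\<bar> * exp (K * \<bar>s0\<bar>) + \<bar>Y s0 t0 - Y s0 t0\<bar>) ?F"
      by (intro tendsto_intros fs isCont_tendsto_compose[OF DERIV_isCont[OF Y_has_derivative]])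
    then have lim: "((\<lambda>p. \<bar>snd p - t0\<bar> * exp (K * \<bar>fst p\<bar>) + \<bar>Y (fst p) t0 - Y s0 t0\<bar>) \<longlongrightarrow> 0) ?F" by simp
    have "norm (Y (fst p) (snd p) - Y s0 t0) \<le> \<bar>snd p - t0\<bar> * exp (K * \<bar>fst p\<bar>) + \<bar>Y (fst p) t0 - Y s0 t0\<bar>" for p
      using K(2)[of "fst p" "snd p" t0] unfolding real_norm_def by linarith
    then have "((\<lambda>p. Y (fst p) (snd p) - Y s0 t0) \<longlongrightarrow> 0) ?F"
      by (intro Lim_null_comparison[OF _ lim] always_eventually allI)
    then show ?thesis by (simp add: isCont_def LIM_zero_iff)
  qed
  then have "continuous_on UNIV (\<lambda>p. Y (fst p) (snd p))"
    by (intro continuous_at_imp_continuous_on) auto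
  from continuous_on_compose2[OF this continuous_on_Pair[OF assms]] show ?thesis by simp
qed

text \<open>The solution of the linearized equation along a trajectory with initial value one.\<close>

definition J :: "real \<Rightarrow> real \<Rightarrow> real" where
  "J s t = exp (s * integral {0..1} (\<lambda>u. vderiv X (Y (s * u) t)))"

lemma Y_has_derivative_J: "((\<lambda>t. Y s t) has_real_derivative J s t) (at t)"
proof -
  define Q where "Q u = exp (antideriv (\<lambda>r. divided_difference (Y r t) (Y r u)) s)" for u
  have "continuous_on (UNIV \<times> cbox 0 1) (\<lambda>(u, v). s * divided_difference (Y (s * v) t) (Y (s * v) u))"
    unfolding split_beta by (intro continuous_intros continuous_divided_difference continuous_Y)
  from integral_continuous_on_param[OF this] have "continuous_on UNIV Q"
    unfolding Q_def antideriv_def by (intro continuous_intros) simp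
  then have "isCont Q t" by (simp add: continuous_on_eq_continuous_at)
  moreover have "Q t = J s t" by (simp add: Q_def J_def antideriv_def divided_difference_same)
  moreover have "\<forall>u. Y s u - Y s t = Q u * (u - t)" using Y_diff by (simp add: Q_def mult.commute)
  ultimately show ?thesis unfolding CARAT_DERIV by blast
qed

text \<open>A class of functions of time and initial value that contains the flow and is closed under
  differentiation with respect to the initial value.\<close>

inductive flow_expr :: "(real \<Rightarrow> real \<Rightarrow> real) \<Rightarrow> bool" where
  flow_expr_comp: "smooth_line h \<Longrightarrow> flow_expr (\<lambda>s t. h (Y s t))"
| flow_expr_J: "flow_expr J"
| flow_expr_time: "flow_expr (\<lambda>s t. s)"
| flow_expr_add: "flow_expr A \<Longrightarrow> flow_expr B \<Longrightarrow> flow_expr (\<lambda>s t. A s t + B s t)"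
| flow_expr_mult: "flow_expr A \<Longrightarrow> flow_expr B \<Longrightarrow> flow_expr (\<lambda>s t. A s t * B s t)"
| flow_expr_integral: "flow_expr A \<Longrightarrow> flow_expr (\<lambda>s t. integral {0..1} (\<lambda>u. A (s * u) t))"

lemma continuous_on_two_args:
  assumes "continuous_on UNIV (\<lambda>p. A (fst p) (snd p))" "continuous_on S f" "continuous_on S g"
  shows "continuous_on S (\<lambda>x. A (f x) (g x))"
  using continuous_on_compose2[OF assms(1) continuous_on_Pair[OF assms(2,3)]] by simp

lemma continuous_time_integral:
  fixes A :: "real \<Rightarrow> real \<Rightarrow> real"
  assumes "continuous_on UNIV (\<lambda>p. A (fst p) (snd p))"
  shows "continuous_on UNIV (\<lambda>p. integral {0..1} (\<lambda>u. A (fst p * u) (snd p)))"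
proof -
  have "continuous_on (UNIV \<times> cbox 0 1) (\<lambda>(p, u). A (fst p * u) (snd p))"
    unfolding split_beta
    by (intro continuous_on_two_args[OF assms] continuous_intros)
  from integral_continuous_on_param[OF this] show ?thesis by simp
qed

lemma flow_expr_continuous: "flow_expr A \<Longrightarrow> continuous_on UNIV (\<lambda>p. A (fst p) (snd p))"
proof (induction rule: flow_expr.induct)
  case (flow_expr_comp h)
  then show ?case
    by (intro continuous_on_compose2[OF smooth_line_continuous[of h UNIV]] continuous_Y continuous_intros) auto
next
  case flow_expr_J
  have "continuous_on UNIV (\<lambda>p. vderiv X (Y (fst p) (snd p)))"
    by (intro continuous_on_compose2[OF continuous_X'[of UNIV]] continuous_Y continuous_intros) auto
  then show ?case
    unfolding J_def by (intro continuous_intros continuous_time_integral)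
qed (auto intro!: continuous_intros continuous_time_integral)

lemma integral_has_derivative:
  fixes A A' :: "real \<Rightarrow> real \<Rightarrow> real"
  assumes deriv: "\<And>s t. ((\<lambda>t. A s t) has_real_derivative A' s t) (at t)"
    and cont: "continuous_on UNIV (\<lambda>p. A (fst p) (snd p))" "continuous_on UNIV (\<lambda>p. A' (fst p) (snd p))"
  shows "((\<lambda>t. integral {0..1} (\<lambda>u. A (s * u) t)) has_real_derivative
      integral {0..1} (\<lambda>u. A' (s * u) t)) (at t)"
proof -
  have c: "continuous_on S (\<lambda>(t, u). A' (s * u) t)" for S
    unfolding split_beta
    by (intro continuous_on_two_args[OF cont(2)] continuous_intros)
  have "((\<lambda>t. integral (cbox 0 1) (\<lambda>u. A (s * u) t)) has_real_derivative
      integral (cbox 0 1) (\<lambda>u. A' (s * u) t)) (at t)"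
  proof (rule leibniz_rule_field_derivative[where U = UNIV])
    show "(\<lambda>u. A (s * u) t) integrable_on cbox 0 1" for t
      by (intro integrable_continuous continuous_on_two_args[OF cont(1)] continuous_intros)
  qed (use deriv c in auto)
  then show ?thesis by simp
qed

lemma flow_expr_has_derivative:
  "flow_expr A \<Longrightarrow> \<exists>A'. flow_expr A' \<and> (\<forall>s t. ((\<lambda>t. A s t) has_real_derivative A' s t) (at t))"
proof (induction rule: flow_expr.induct)
  case (flow_expr_comp h)
  have "flow_expr (\<lambda>s t. vderiv h (Y s t) * J s t)"
    using flow_expr_comp by (intro flow_expr_mult flow_expr_J flow_expr.flow_expr_comp[OF smooth_line_vderiv])
  moreover have "((\<lambda>t. h (Y s t)) has_real_derivative vderiv h (Y s t) * J s t) (at t)" for s t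
    by (intro DERIV_chain2[OF smooth_line_has_real_derivative[OF flow_expr_comp]] Y_has_derivative_J)
  ultimately show ?case by blast
next
  case flow_expr_J
  let ?B = "\<lambda>s t. vderiv X (Y s t)" and ?B' = "\<lambda>s t. vderiv (vderiv X) (Y s t) * J s t"
  have B: "flow_expr ?B" "flow_expr ?B'"
    using flow_expr_mult[OF flow_expr_comp[OF smooth_line_vderiv[OF smooth_line_vderiv[OF smooth]]] flow_expr.flow_expr_J]
      flow_expr_comp[OF smooth_line_vderiv[OF smooth]] by auto
  have dB: "((\<lambda>t. ?B s t) has_real_derivative ?B' s t) (at t)" for s t
    by (intro DERIV_chain2[OF smooth_line_has_real_derivative[OF smooth_line_vderiv[OF smooth]]] Y_has_derivative_J)
  have "flow_expr (\<lambda>s t. J s t * (s * integral {0..1} (\<lambda>u. ?B' (s * u) t)))"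
    by (intro flow_expr_mult[of J] flow_expr.flow_expr_J flow_expr_mult[OF flow_expr_time] flow_expr_integral[OF B(2)])
  moreover have "((\<lambda>t. J s t) has_real_derivative J s t * (s * integral {0..1} (\<lambda>u. ?B' (s * u) t))) (at t)" for s t
    unfolding J_def[of s]
    by (intro DERIV_chain2[OF DERIV_exp] DERIV_cmult 
        integral_has_derivative[of ?B ?B', OF dB flow_expr_continuous[OF B(1)] flow_expr_continuous[OF B(2)]])
  ultimately show ?case by blast
next
  case flow_expr_time
  have "flow_expr (\<lambda>s t. 0)" using flow_expr_comp[OF smooth_line_const] .
  then show ?case by (intro exI[of _ "\<lambda>s t. 0"]) auto
next
  case (flow_expr_add A B)
  then obtain A' B' where *: "flow_expr A'" "\<And>s t. ((\<lambda>t. A s t) has_real_derivative A' s t) (at t)"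
    "flow_expr B'" "\<And>s t. ((\<lambda>t. B s t) has_real_derivative B' s t) (at t)" by blast
  then show ?case
    using flow_expr.flow_expr_add[OF *(1,3)] DERIV_add[OF *(2,4)]
    by (intro exI[of _ "\<lambda>s t. A' s t + B' s t"]) simp
next
  case (flow_expr_mult A B)
  then obtain A' B' where *: "flow_expr A'" "\<And>s t. ((\<lambda>t. A s t) has_real_derivative A' s t) (at t)"
    "flow_expr B'" "\<And>s t. ((\<lambda>t. B s t) has_real_derivative B' s t) (at t)" by blast
  have "flow_expr (\<lambda>s t. A' s t * B s t + B' s t * A s t)"
    by (intro flow_expr.flow_expr_add flow_expr.flow_expr_mult * flow_expr_mult.hyps)
  then show ?case using DERIV_mult[OF *(2,4)]
    by (intro exI[of _ "\<lambda>s t. A' s t * B s t + B' s t * A s t"]) simp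
next
  case (flow_expr_integral A)
  then obtain A' where *: "flow_expr A'" "\<And>s t. ((\<lambda>t. A s t) has_real_derivative A' s t) (at t)" by blast
  show ?case
    using flow_expr.flow_expr_integral[OF *(1)]
      integral_has_derivative[of A A', OF *(2) flow_expr_continuous[OF flow_expr_integral.hyps] flow_expr_continuous[OF *(1)]]
    by (intro exI[of _ "\<lambda>s t. integral {0..1} (\<lambda>u. A' (s * u) t)"]) simp
qed

lemma smooth_Y: "smooth_line (\<lambda>t. Y s t)"
proof (rule smooth_line_coinduct[where R = "\<lambda>F. \<exists>A. flow_expr A \<and> F = (\<lambda>t. A s t)"])
  show "\<exists>A. flow_expr A \<and> (\<lambda>t. Y s t) = (\<lambda>t. A s t)"
    using flow_expr_comp[OF smooth_line_ident] by blast
  fix F assume "\<exists>A. flow_expr A \<and> F = (\<lambda>t. A s t)"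
  then obtain A where A: "flow_expr A" "F = (\<lambda>t. A s t)" by blast
  then obtain A' where A': "flow_expr A'" "\<And>s t. ((\<lambda>t. A s t) has_real_derivative A' s t) (at t)"
    using flow_expr_has_derivative by blast
  then show "\<exists>F'. (\<exists>A. flow_expr A \<and> F' = (\<lambda>t. A s t)) \<and> (\<forall>t. (F has_vector_derivative F' t) (at t))"
    unfolding A(2) by (intro exI[of _ "\<lambda>t. A' s t"]) (auto simp: has_real_derivative_iff_has_vector_derivative[symmetric])
qed

lemma vderiv_Y: "vderiv (\<lambda>t. Y s t) = (\<lambda>t. J s t)"
  by (intro vderiv_realI Y_has_derivative_J)

lemma J_pos: "J s t > 0"
  by (simp add: J_def)

text \<open>Differentiate \<open>Y s (Y r t) = Y r (Y s t)\<close> with respect to \<open>r\<close> at \<open>r = 0\<close>.\<close>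

lemma J_X: "J s t * X t = X (Y s t)"
proof -
  have "((\<lambda>r. Y s (Y r t)) has_real_derivative J s (Y 0 t) * X (Y 0 t)) (at 0)"
    by (rule DERIV_chain2[OF Y_has_derivative_J Y_has_derivative])
  moreover have "((\<lambda>r. Y r (Y s t)) has_real_derivative X (Y 0 (Y s t))) (at 0)"
    by (rule Y_has_derivative)
  moreover have "Y s (Y r t) = Y r (Y s t)" for r by (metis Y_add add.commute)
  ultimately show ?thesis using DERIV_unique by simp
qed

end

section \<open>Tangent vectors, gradients and metrics in the angular coordinate\<close>

lemma tangent_circle_cis_iff: "v \<in> tangent_circle (cis t) \<longleftrightarrow> (\<exists>r::real. v = of_real r * (\<i> * cis t))"
proof
  assume "v \<in> tangent_circle (cis t)"
  then have v: "Re v * cos t + Im v * sin t = 0"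
    by (simp add: tangent_circle_def inner_complex_def)
  have ring: "x * (c * c + s * s) = (x * c + y * s) * c - (y * c - x * s) * s"
    "y * (c * c + s * s) = (x * c + y * s) * s + (y * c - x * s) * c" for x y c s :: real
    by (simp_all add: algebra_simps)
  have cs: "cos t * cos t + sin t * sin t = 1" using sin_cos_squared_add3 by simp
  have "Re v = - ((Im v * cos t - Re v * sin t) * sin t)"
  proof -
    have "Re v = Re v * (cos t * cos t + sin t * sin t)" by (simp only: cs mult_1_right)
    also have "\<dots> = (Re v * cos t + Im v * sin t) * cos t - (Im v * cos t - Re v * sin t) * sin t"
      by (rule ring(1))
    finally show ?thesis by (simp only: v mult_zero_left diff_0 add_0)
  qed
  moreover have "Im v = (Im v * cos t - Re v * sin t) * cos t"
  proof -
    have "Im v = Im v * (cos t * cos t + sin t * sin t)" by (simp only: cs mult_1_right)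
    also have "\<dots> = (Re v * cos t + Im v * sin t) * sin t + (Im v * cos t - Re v * sin t) * cos t"
      by (rule ring(2))
    finally show ?thesis by (simp only: v mult_zero_left diff_0 add_0)
  qed
  ultimately show "\<exists>r::real. v = of_real r * (\<i> * cis t)"
    by (intro exI[of _ "Im v * cos t - Re v * sin t"] complex_eqI) simp_all
qed (auto simp: tangent_circle_def inner_complex_def)

lemma tangent_circleI [simp]: "of_real r * (\<i> * cis t) \<in> tangent_circle (cis t)"
  using tangent_circle_cis_iff by blast

lemma cis_tangent_curve:
  "cis t * exp (of_real s * (of_real r * (\<i> * cis t)) / cis t) = cis (t + s * r)"
proof -
  have "of_real s * (of_real r * (\<i> * cis t)) / cis t = \<i> * of_real (s * r)"
    by (simp add: field_simps)
  then show ?thesis by (simp only: cis_conv_exp[symmetric] cis_mult)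
qed

lemma differential_cis:
  assumes "((\<lambda>t. \<phi> (cis t)) has_vector_derivative d) (at t)"
  shows "differential \<phi> (cis t) (of_real r * (\<i> * cis t)) = r *\<^sub>R d"
proof -
  have 1: "((\<lambda>s. t + s * r) has_vector_derivative r) (at 0)"
    by (auto intro!: derivative_eq_intros simp: has_real_derivative_iff_has_vector_derivative[symmetric])
  have "((\<lambda>t. \<phi> (cis t)) \<circ> (\<lambda>s. t + s * r) has_vector_derivative r *\<^sub>R d) (at 0)"
    by (rule vector_diff_chain_at[OF 1]) (use assms in simp)
  then show ?thesis
    unfolding differential_def cis_tangent_curve by (auto simp: o_def intro: vector_derivative_at)
qed

lemma differential_function:
  fixes f :: "complex \<Rightarrow> real"
  assumes "smooth_circle f"
  shows "differential f (cis t) (of_real r * (\<i> * cis t)) = r * vderiv (\<lambda>s. f (cis s)) t"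
  using differential_cis[of f, OF smooth_line_has_vderiv] assms by (simp add: smooth_circle_def)

lemma differential_lift:
  assumes "lift_of \<phi> L"
  shows "differential \<phi> (cis t) (of_real r * (\<i> * cis t)) = of_real (r * vderiv L t) * (\<i> * cis (L t))"
proof -
  have L: "smooth_line L" "\<And>t. \<phi> (cis t) = cis (L t)" using assms by (auto simp: lift_of_def)
  have "((\<lambda>t. \<phi> (cis t)) has_vector_derivative of_real (vderiv L t) * (\<i> * cis (L t))) (at t)"
    unfolding L(2) by (intro has_vector_derivative_cis smooth_line_has_real_derivative L(1))
  from differential_cis[OF this] show ?thesis by (simp add: scaleR_conv_of_real)
qed

lemma periodic_smooth_circle:
  fixes f :: "complex \<Rightarrow> real"
  shows "smooth_circle f \<Longrightarrow> periodic_smooth (\<lambda>t. f (cis t))"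
  by (simp add: periodic_smooth_def smooth_circle_def cis_mult[symmetric])

lemma smooth_circle_cong: "(\<And>t. \<phi> (cis t) = \<psi> (cis t)) \<Longrightarrow> smooth_circle \<phi> = smooth_circle \<psi>"
  by (simp add: smooth_circle_def)

lemma
  assumes "g \<in> Met_circle"
  shows metric_tangent: "g (cis t) (of_real x * (\<i> * cis t)) (of_real y * (\<i> * cis t)) = x * y * metric_coeff g t"
    and metric_coeff_pos: "metric_coeff g t > 0"
    and periodic_smooth_metric_coeff: "periodic_smooth (metric_coeff g)"
proof -
  let ?e = "\<i> * cis t"
  have sym: "g (cis t) v w = g (cis t) w v"
    if "v \<in> tangent_circle (cis t)" "w \<in> tangent_circle (cis t)" for v w
    using assms that cis_mem_circle unfolding Met_circle_def by blast
  have lin: "g (cis t) (a *\<^sub>R u + b *\<^sub>R v) w = a * g (cis t) u w + b * g (cis t) v w"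
    if "u \<in> tangent_circle (cis t)" "v \<in> tangent_circle (cis t)" "w \<in> tangent_circle (cis t)" for u v w a b
    using assms that cis_mem_circle unfolding Met_circle_def by blast
  have e: "?e \<in> tangent_circle (cis t)" using tangent_circleI[of 1 t] by simp
  have lin1: "g (cis t) (of_real x * ?e) w = x * g (cis t) ?e w" if "w \<in> tangent_circle (cis t)" for x w
    using lin[OF e e that, of x 0] by (simp add: scaleR_conv_of_real)
  show "g (cis t) (of_real x * ?e) (of_real y * ?e) = x * y * metric_coeff g t"
    using lin1[of "of_real y * ?e" x] lin1[of ?e y] e sym[of ?e "of_real y * ?e"]
    by (simp add: metric_coeff_def)
  show "metric_coeff g t > 0"
    using assms e cis_mem_circle[of t] unfolding Met_circle_def metric_coeff_def by auto
  show "periodic_smooth (metric_coeff g)"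
    using assms unfolding periodic_smooth_def
    by (auto simp: Met_circle_def metric_coeff_def cis_mult[symmetric])
qed

lemma gradient_cis:
  assumes "g \<in> Met_circle" "smooth_circle f"
  shows "gradient g f (cis t) = of_real (vderiv (\<lambda>s. f (cis s)) t / metric_coeff g t) * (\<i> * cis t)"
  unfolding gradient_def
proof (rule the_equality)
  have pos: "metric_coeff g t > 0" by (rule metric_coeff_pos[OF assms(1)])
  let ?r = "vderiv (\<lambda>s. f (cis s)) t / metric_coeff g t"
  show "of_real ?r * (\<i> * cis t) \<in> tangent_circle (cis t) \<and>
     (\<forall>v \<in> tangent_circle (cis t). g (cis t) (of_real ?r * (\<i> * cis t)) v = differential f (cis t) v)"
  proof (intro conjI ballI tangent_circleI)
    fix v assume "v \<in> tangent_circle (cis t)"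
    then obtain y where v: "v = of_real y * (\<i> * cis t)" using tangent_circle_cis_iff by blast
    show "g (cis t) (of_real ?r * (\<i> * cis t)) v = differential f (cis t) v"
      unfolding v metric_tangent[OF assms(1)] differential_function[OF assms(2)] using pos by simp
  qed
  fix x assume x: "x \<in> tangent_circle (cis t) \<and> (\<forall>v \<in> tangent_circle (cis t). g (cis t) x v = differential f (cis t) v)"
  then obtain r where r: "x = of_real r * (\<i> * cis t)" using tangent_circle_cis_iff by blast
  have "g (cis t) x (of_real 1 * (\<i> * cis t)) = differential f (cis t) (of_real 1 * (\<i> * cis t))"
    using x tangent_circleI by blast
  then have "r * metric_coeff g t = vderiv (\<lambda>s. f (cis s)) t"
    unfolding r metric_tangent[OF assms(1)] differential_function[OF assms(2)] by simp
  then have "r = ?r" using pos by (simp add: field_simps)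
  then show "x = of_real ?r * (\<i> * cis t)" using r by simp
qed

section \<open>Diffeomorphisms and automorphisms of a vector field on the circle\<close>

lemma Diff_circleI:
  assumes "\<phi> \<in> extensional circle" "lift_of \<phi> L" "lift_of \<psi> M"
    and inv: "\<And>z. z \<in> circle \<Longrightarrow> \<psi> (\<phi> z) = z" "\<And>z. z \<in> circle \<Longrightarrow> \<phi> (\<psi> z) = z"
  shows "\<phi> \<in> Diff_circle"
proof -
  have into: "\<phi> z \<in> circle" "\<psi> z \<in> circle" if "z \<in> circle" for z
    using that assms(2,3) circle_cisE[of z] by (metis cis_mem_circle lift_of_def)+
  then have bij: "bij_betw \<phi> circle circle"
    by (intro bij_betw_byWitness[where f' = \<psi>]) (use inv in auto)
  have "inv_into circle \<phi> z = \<psi> z" if "z \<in> circle" for z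
    using bij that into inv by (metis bij_betw_inv_into_left)
  then have "smooth_circle (inv_into circle \<phi>)"
    using smooth_circle_cong[of "inv_into circle \<phi>" \<psi>] lift_of_imp_smooth_circle[OF assms(3)] cis_mem_circle by blast
  then show ?thesis
    using bij assms(1) lift_of_imp_smooth_circle[OF assms(2)] by (simp add: Diff_circle_def Bij_def)
qed

lemma Diff_circle_Bij: "\<phi> \<in> Diff_circle \<Longrightarrow> \<phi> \<in> Bij circle"
  by (simp add: Diff_circle_def)

lemma Bij_image_circle: "\<phi> \<in> Bij circle \<Longrightarrow> \<phi> ` circle = circle"
  by (simp add: Bij_def bij_betw_def)

lemma Bij_lift_ex:
  assumes "\<phi> \<in> Bij circle" "smooth_circle \<phi>" shows "\<exists>L. lift_of \<phi> L"
  using lift_ex[OF assms(2)] Bij_image_circle[OF assms(1)] circle_cisE[OF Bij_circle_cis[OF assms(1)]]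
  by (metis subset_refl)

lemma Diff_circle_inverse:
  assumes "\<phi> \<in> Diff_circle"
  shows "restrict (inv_into circle \<phi>) circle \<in> Diff_circle"
proof -
  let ?\<psi> = "restrict (inv_into circle \<phi>) circle"
  have bij: "bij_betw \<phi> circle circle" using assms by (simp add: Diff_circle_def Bij_def)
  have psi: "?\<psi> \<in> Bij circle" using restrict_inv_into_Bij[OF Diff_circle_Bij[OF assms]] .
  have "smooth_circle ?\<psi>"
    using assms smooth_circle_cong[of ?\<psi> "inv_into circle \<phi>"] by (simp add: Diff_circle_def)
  then obtain M where M: "lift_of ?\<psi> M" using Bij_lift_ex[OF psi] by blast
  obtain L where L: "lift_of \<phi> L" using assms Bij_lift_ex by (auto simp: Diff_circle_def)
  show ?thesis
  proof (rule Diff_circleI[OF _ M L])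
    fix z assume z: "z \<in> circle"
    show "\<phi> (?\<psi> z) = z" using z bij by (simp only: restrict_apply' bij_betw_inv_into_right)
    have "\<phi> z \<in> circle" using z bij bij_betw_apply by metis
    then show "?\<psi> (\<phi> z) = z" using z bij by (simp only: restrict_apply' bij_betw_inv_into_left)
  qed simp
qed

lemma Diff_circle_compose:
  assumes "\<phi> \<in> Diff_circle" "\<psi> \<in> Diff_circle"
  shows "compose circle \<phi> \<psi> \<in> Diff_circle"
proof -
  let ?\<phi>' = "restrict (inv_into circle \<phi>) circle" and ?\<psi>' = "restrict (inv_into circle \<psi>) circle"
  have inv: "?\<phi>' \<in> Diff_circle" "?\<psi>' \<in> Diff_circle" using assms Diff_circle_inverse by auto
  have ex: "\<exists>L. lift_of \<theta> L" if "\<theta> \<in> Diff_circle" for \<theta>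
    using that Bij_lift_ex by (auto simp: Diff_circle_def)
  obtain L M L' M' where lifts: "lift_of \<phi> L" "lift_of \<psi> M" "lift_of ?\<phi>' L'" "lift_of ?\<psi>' M'"
    using ex assms inv by meson
  have bij: "bij_betw \<phi> circle circle" "bij_betw \<psi> circle circle"
    using assms by (auto simp: Diff_circle_def Bij_def)
  have mem: "\<phi> z \<in> circle" "\<psi> z \<in> circle" "inv_into circle \<phi> z \<in> circle" "inv_into circle \<psi> z \<in> circle" 
    if "z \<in> circle" for z
    using that bij_betw_apply[OF bij(1)] bij_betw_apply[OF bij(2)]
      bij_betw_apply[OF bij_betw_inv_into[OF bij(1)]] bij_betw_apply[OF bij_betw_inv_into[OF bij(2)]] by auto
  show ?thesis
  proof (rule Diff_circleI[of _ "\<lambda>t. L (M t)" "compose circle ?\<psi>' ?\<phi>'" "\<lambda>t. M' (L' t)"])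
    show "lift_of (compose circle \<phi> \<psi>) (\<lambda>t. L (M t))"
      by (rule lift_of_compose[OF lifts(1,2)]) (simp add: compose_def)
    show "lift_of (compose circle ?\<psi>' ?\<phi>') (\<lambda>t. M' (L' t))"
      by (rule lift_of_compose[OF lifts(4,3)]) (simp add: compose_def)
    fix z assume "z \<in> circle"
    then show "compose circle ?\<psi>' ?\<phi>' (compose circle \<phi> \<psi> z) = z"
      "compose circle \<phi> \<psi> (compose circle ?\<psi>' ?\<phi>' z) = z"
      using mem bij_betw_inv_into_left[OF bij(1)] bij_betw_inv_into_left[OF bij(2)]
       bij_betw_inv_into_right[OF bij(1)] bij_betw_inv_into_right[OF bij(2)] by (simp_all add: compose_def)
  qed (simp add: compose_def)
qed

locale circle_field = complete_ode X for X +
  fixes V :: "complex \<Rightarrow> complex"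
  assumes V_cis: "\<And>t. V (cis t) = of_real (X t) * (\<i> * cis t)"
begin

text \<open>In the angle, the pushforward multiplies the coefficient of the field by the derivative of a
  lift.\<close>

lemma V_preserved_iff:
  assumes \<phi>: "\<phi> \<in> Bij circle" and L: "lift_of \<phi> L"
  shows "(\<forall>w \<in> circle. pushforward \<phi> V w = V w) \<longleftrightarrow> (\<forall>t. vderiv L t * X t = X (L t))"
proof -
  have bij: "bij_betw \<phi> circle circle" using \<phi> by (simp add: Bij_def)
  have eq: "pushforward \<phi> V (\<phi> (cis t)) = V (\<phi> (cis t)) \<longleftrightarrow> vderiv L t * X t = X (L t)" for t
  proof -
    have "inv_into circle \<phi> (\<phi> (cis t)) = cis t"
      using bij by (simp add: bij_betw_inv_into_left)
    then have "pushforward \<phi> V (\<phi> (cis t)) = of_real (X t * vderiv L t) * (\<i> * cis (L t))"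
      by (simp only: pushforward_def V_cis differential_lift[OF L])
    moreover have "V (\<phi> (cis t)) = of_real (X (L t)) * (\<i> * cis (L t))"
      using L V_cis by (simp add: lift_of_def)
    ultimately show ?thesis by (simp add: mult.commute flip: of_real_mult)
  qed
  have "(\<forall>w \<in> circle. pushforward \<phi> V w = V w) \<longleftrightarrow> (\<forall>t. pushforward \<phi> V (\<phi> (cis t)) = V (\<phi> (cis t)))"
  proof (intro iffI allI ballI)
    fix w assume *: "\<forall>t. pushforward \<phi> V (\<phi> (cis t)) = V (\<phi> (cis t))" and "w \<in> circle"
    then obtain z where "z \<in> circle" "w = \<phi> z" using bij by (metis bij_betw_imp_surj_on imageE)
    then show "pushforward \<phi> V w = V w" using * circle_cisE by metis
  qed (use Bij_circle_cis[OF \<phi>] in blast)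
  then show ?thesis unfolding eq .
qed

lemma Aut_Diff: "\<phi> \<in> carrier (Aut_field V) \<Longrightarrow> \<phi> \<in> Diff_circle"
  by (simp add: Aut_field_def)

lemma Aut_lift:
  assumes "\<phi> \<in> carrier (Aut_field V)" "lift_of \<phi> L" shows "vderiv L t * X t = X (L t)"
  using V_preserved_iff[OF Diff_circle_Bij assms(2)] assms(1) by (simp add: Aut_field_def)

lemma AutI:
  assumes "\<phi> \<in> Diff_circle" "lift_of \<phi> L" "\<And>t. vderiv L t * X t = X (L t)"
  shows "\<phi> \<in> carrier (Aut_field V)"
  using V_preserved_iff[OF Diff_circle_Bij assms(2)] assms(1,3) by (simp add: Aut_field_def)

lemma Aut_lift_ex:
  assumes "\<phi> \<in> carrier (Aut_field V)" shows "\<exists>L. lift_of \<phi> L"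
  using Aut_Diff[OF assms] Bij_lift_ex by (auto simp: Diff_circle_def)

lemma Aut_mult:
  "\<phi> \<in> carrier (Aut_field V) \<Longrightarrow> \<psi> \<in> carrier (Aut_field V) \<Longrightarrow>
    \<phi> \<otimes>\<^bsub>Aut_field V\<^esub> \<psi> = compose circle \<phi> \<psi>"
  using Aut_Diff[THEN Diff_circle_Bij, of \<phi>] Aut_Diff[THEN Diff_circle_Bij, of \<psi>]
  by (simp add: Aut_field_def BijGroup_def)

lemma subgroup_Aut: "subgroup (carrier (Aut_field V)) (BijGroup circle)"
proof (rule group.subgroupI[OF group_BijGroup])
  show "carrier (Aut_field V) \<subseteq> carrier (BijGroup circle)"
    using Aut_Diff Diff_circle_Bij by (auto simp: BijGroup_def)
  have id: "lift_of (restrict (\<lambda>z. z) circle) (\<lambda>t. t)" "lift_of (\<lambda>z. z) (\<lambda>t. t)"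
    by (simp_all add: lift_of_def)
  have "restrict (\<lambda>z. z) circle \<in> Diff_circle"
    by (rule Diff_circleI[OF _ id]) auto
  then have "restrict (\<lambda>z. z) circle \<in> carrier (Aut_field V)"
    by (rule AutI[OF _ id(1)]) (simp add: vderiv_ident)
  then show "carrier (Aut_field V) \<noteq> {}" by blast
next
  fix \<phi> assume \<phi>: "\<phi> \<in> carrier (Aut_field V)"
  have B: "\<phi> \<in> Bij circle" using \<phi> Aut_Diff Diff_circle_Bij by blast
  let ?\<psi> = "restrict (inv_into circle \<phi>) circle"
  have D: "?\<psi> \<in> Diff_circle" using Diff_circle_inverse[OF Aut_Diff[OF \<phi>]] .
  obtain L where L: "lift_of \<phi> L" using Aut_lift_ex[OF \<phi>] by blast
  obtain M where M: "lift_of ?\<psi> M" using D Bij_lift_ex by (auto simp: Diff_circle_def)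
  have sm: "smooth_line L" "smooth_line M" using L M by (auto simp: lift_of_def)
  have bij: "bij_betw \<phi> circle circle" using B by (simp add: Bij_def)
  have "lift_of id (\<lambda>t. L (M t))"
    by (rule lift_of_compose[OF L M]) (use bij in \<open>simp add: bij_betw_inv_into_right\<close>)
  moreover have "lift_of id (\<lambda>t. t)" by (simp add: lift_of_def)
  ultimately have k: "\<exists>k::int. \<forall>t. L (M t) = t + 2 * pi * k"
    and one: "vderiv L (M t) * vderiv M t = 1" for t
    using lift_of_unique lift_of_vderiv_unique vderiv_compose[OF sm] vderiv_ident by (blast, metis)
  have "vderiv M t * X t = X (M t)" for t
  proof -
    have "vderiv L (M t) * X (M t) = X (L (M t))" by (rule Aut_lift[OF \<phi> L])
    also have "\<dots> = X t" using k periodic_int[of X] periodic_smooth by (auto simp: periodic_smooth_def)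
    finally have "vderiv M t * X t = (vderiv L (M t) * vderiv M t) * X (M t)" by (simp add: mult_ac)
    then show ?thesis by (simp add: one)
  qed
  then have "?\<psi> \<in> carrier (Aut_field V)" by (rule AutI[OF D M])
  then show "inv\<^bsub>BijGroup circle\<^esub> \<phi> \<in> carrier (Aut_field V)" by (simp add: inv_BijGroup[OF B])
next
  fix \<phi> \<psi> assume \<phi>: "\<phi> \<in> carrier (Aut_field V)" and \<psi>: "\<psi> \<in> carrier (Aut_field V)"
  obtain L M where L: "lift_of \<phi> L" and M: "lift_of \<psi> M" using Aut_lift_ex \<phi> \<psi> by meson
  have sm: "smooth_line L" "smooth_line M" using L M by (auto simp: lift_of_def)
  have "compose circle \<phi> \<psi> \<in> carrier (Aut_field V)"
  proof (rule AutI)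
    show "compose circle \<phi> \<psi> \<in> Diff_circle" using \<phi> \<psi> Aut_Diff Diff_circle_compose by blast
    show "lift_of (compose circle \<phi> \<psi>) (\<lambda>t. L (M t))"
      by (rule lift_of_compose[OF L M]) (simp add: compose_def)
    show "vderiv (\<lambda>t. L (M t)) t * X t = X (L (M t))" for t
      unfolding vderiv_compose[OF sm] using Aut_lift[OF \<phi> L] Aut_lift[OF \<psi> M] by (simp add: mult.assoc)
  qed
  then show "\<phi> \<otimes>\<^bsub>BijGroup circle\<^esub> \<psi> \<in> carrier (Aut_field V)"
    using \<phi> \<psi> Aut_mult by (simp add: Aut_field_def)
qed

lemma group_Aut: "group (Aut_field V)"
proof -
  have "Aut_field V = BijGroup circle\<lparr>carrier := carrier (Aut_field V)\<rparr>"
    by (simp add: Aut_field_def)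
  then show ?thesis
    using subgroup.subgroup_is_group[OF subgroup_Aut group_BijGroup] by metis
qed

text \<open>Near \<open>z\<^sub>0 = cis \<theta>\<close> the angle \<open>\<theta> + Arg (z / z\<^sub>0)\<close> is continuous, since the branch cut lies opposite to
  \<open>z\<^sub>0\<close>.\<close>

lemma continuous_on_V: "continuous_on circle V"
  unfolding continuous_on_eq_continuous_within
proof
  fix z0 :: complex assume "z0 \<in> circle"
  then obtain \<theta> where z0: "z0 = cis \<theta>" using circle_cisE by blast
  have V: "V z = of_real (X (\<theta> + Arg (z / z0))) * (\<i> * z)" if z: "z \<in> circle" for z
  proof -
    have "cmod (z / z0) = 1" using z z0 by (simp add: norm_divide)
    then have "cis (Arg (z / z0)) = z / z0"
      using rcis_cmod_Arg[of "z / z0"] by (simp add: rcis_def)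
    then have "z = cis (\<theta> + Arg (z / z0))" using z0 by (simp add: cis_mult[symmetric])
    then show ?thesis using V_cis by metis
  qed
  have "isCont (\<lambda>z. Arg (z / z0)) z0"
  proof (rule isCont_o2[of _ "\<lambda>z. z / z0"])
    show "isCont (\<lambda>z. z / z0) z0" using z0 by (intro continuous_intros) auto
    show "isCont Arg (z0 / z0)" using z0 by (intro continuous_at_Arg) auto
  qed
  then have "isCont (\<lambda>z. \<theta> + Arg (z / z0)) z0" by (intro continuous_intros)
  from isCont_o2[OF this smooth_line_isCont[OF smooth]]
  have "isCont (\<lambda>z. of_real (X (\<theta> + Arg (z / z0))) * (\<i> * z)) z0"
    by (intro continuous_intros) auto
  then have "continuous (at z0 within circle) (\<lambda>z. of_real (X (\<theta> + Arg (z / z0))) * (\<i> * z))"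
    by (rule continuous_at_imp_continuous_at_within)
  then show "continuous (at z0 within circle) V"
    by (rule continuous_transform_within[of _ _ _ 1]) (use V \<open>z0 \<in> circle\<close> in auto)
qed

text \<open>An angle for an integral curve is a trajectory on the line, where uniqueness is known.\<close>

lemma integral_curve_iff: "integral_curve V (cis t) c \<longleftrightarrow> c = (\<lambda>s. cis (Y s t))"
proof
  assume c: "integral_curve V (cis t) c"
  then have c0: "c 0 = cis t" and circ: "\<And>s. c s \<in> circle"
    and dc: "\<And>s. (c has_vector_derivative V (c s)) (at s)"
    by (auto simp: integral_curve_def)
  have contc: "continuous_on UNIV c"
    using dc by (intro continuous_at_imp_continuous_on ballI has_vector_derivative_continuous)
  define u where "u = (\<lambda>s. Im (V (c s) * cnj (c s)))"
  define y where "y = (\<lambda>s. t + antideriv u s)"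
  have "continuous_on UNIV (\<lambda>s. V (c s))"
    by (rule continuous_on_compose2[OF continuous_on_V contc]) (use circ in blast)
  moreover have norm: "cmod (c s) = 1" for s using circ by simp
  ultimately have dy: "(y has_real_derivative u s) (at s)" and cy: "c s = cis (y s)" for s
    using circle_curve_angle[of c "\<lambda>s. V (c s)" t, OF dc norm _ c0] unfolding u_def y_def by blast+
  have "u s = X (y s)" for s
  proof -
    have "V (c s) * cnj (c s) = of_real (X (y s)) * \<i> * (cis (y s) * cnj (cis (y s)))"
      unfolding cy V_cis by simp
    also have "cis (y s) * cnj (cis (y s)) = 1" by (simp add: cis_cnj cis_mult)
    finally have "Im (V (c s) * cnj (c s)) = Im (of_real (X (y s)) * \<i> * 1)" by (rule arg_cong)
    then show ?thesis unfolding u_def by (simp only: mult_1_right Im_i_times Im_complex_of_real Re_complex_of_real mult.commute[of _ \<i>])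
  qed
  then have "trajectory y" using dy by (simp add: trajectory_def)
  moreover have "y 0 = t" by (simp add: y_def)
  ultimately have "y s = Y s t" for s using trajectory_eq_Y by metis
  then show "c = (\<lambda>s. cis (Y s t))" using cy by auto
next
  assume "c = (\<lambda>s. cis (Y s t))"
  then show "integral_curve V (cis t) c"
    using has_vector_derivative_cis[OF Y_has_derivative] by (simp add: integral_curve_def V_cis)
qed

lemma flow_cis: "flow V s (cis t) = cis (Y s t)"
proof -
  have "(THE c. integral_curve V (cis t) c) = (\<lambda>s. cis (Y s t))"
    by (rule the_equality) (simp_all add: integral_curve_iff)
  then show ?thesis by (simp add: flow_def)
qed

lemma flow_lift: "lift_of (flow V s) (\<lambda>t. Y s t)"
  by (simp add: lift_of_def smooth_Y flow_cis)

lemma flow_extensional: "flow V s \<in> extensional circle"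
  by (simp add: flow_def)

lemma flow_add: "z \<in> circle \<Longrightarrow> flow V (s + r) z = flow V s (flow V r z)"
  by (elim circle_cisE) (simp add: flow_cis Y_add)

lemma flow_0: "z \<in> circle \<Longrightarrow> flow V 0 z = z"
  by (elim circle_cisE) (simp add: flow_cis)

lemma flow_Aut: "flow V s \<in> carrier (Aut_field V)"
proof (rule AutI[OF Diff_circleI[OF flow_extensional flow_lift flow_lift] flow_lift])
  show "flow V (- s) (flow V s z) = z" "flow V s (flow V (- s) z) = z" if "z \<in> circle" for z
    using that flow_add[of z "- s" s] flow_add[of z s "- s"] flow_0 by simp_all
  show "vderiv (Y s) t * X t = X (Y s t)" for t
    using vderiv_Y J_X by simp
qed

lemma Aut_eqI:
  assumes "\<phi> \<in> extensional circle" "\<psi> \<in> extensional circle" "\<And>t. \<phi> (cis t) = \<psi> (cis t)"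
  shows "\<phi> = \<psi>"
  by (rule extensionalityI[OF assms(1,2)]) (metis assms(3) circle_cisE)

lemma flow_compose: "compose circle (flow V s) (flow V r) = flow V (s + r)"
  by (rule Aut_eqI) (auto simp: flow_extensional flow_add compose_def)

text \<open>A lift of an automorphism maps trajectories to trajectories.\<close>

lemma flow_commutes:
  assumes \<phi>: "\<phi> \<in> carrier (Aut_field V)"
  shows "compose circle \<phi> (flow V s) = compose circle (flow V s) \<phi>"
proof (rule Aut_eqI)
  fix t
  obtain L where L: "lift_of \<phi> L" using Aut_lift_ex[OF \<phi>] by blast
  have "trajectory (\<lambda>s. L (Y s t))"
    unfolding trajectory_def
  proof
    fix s
    have "((\<lambda>s. L (Y s t)) has_real_derivative vderiv L (Y s t) * X (Y s t)) (at s)"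
      using L by (intro DERIV_chain2[OF smooth_line_has_real_derivative Y_has_derivative]) (simp add: lift_of_def)
    then show "((\<lambda>s. L (Y s t)) has_real_derivative X (L (Y s t))) (at s)"
      unfolding Aut_lift[OF \<phi> L] .
  qed
  from trajectory_eq_Y[OF this, of s] have "L (Y s t) = Y s (L t)" by simp
  then show "compose circle \<phi> (flow V s) (cis t) = compose circle (flow V s) \<phi> (cis t)"
    using L by (simp add: compose_def flow_cis lift_of_def)
qed (auto simp: compose_def)

lemma normal_flow: "range (flow V) \<lhd> Aut_field V"
proof -
  interpret A: group "Aut_field V" by (rule group_Aut)
  have sub: "range (flow V) \<subseteq> carrier (Aut_field V)" using flow_Aut by blast
  have mult: "flow V s \<otimes>\<^bsub>Aut_field V\<^esub> flow V r = flow V (s + r)" for s r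
    by (simp add: Aut_mult flow_Aut flow_compose)
  have one: "\<one>\<^bsub>Aut_field V\<^esub> = flow V 0"
    using A.l_cancel_one'[OF flow_Aut flow_Aut, of 0 0] mult[of 0 0] by simp
  have "subgroup (range (flow V)) (Aut_field V)"
  proof (rule A.subgroupI[OF sub])
    fix a assume "a \<in> range (flow V)"
    then obtain s where "a = flow V s" by blast
    then have "inv\<^bsub>Aut_field V\<^esub> a = flow V (- s)"
      using mult[of "- s" s] one flow_Aut A.inv_equality by simp
    then show "inv\<^bsub>Aut_field V\<^esub> a \<in> range (flow V)" by simp
  qed (use mult in auto)
  moreover have "range (flow V) #>\<^bsub>Aut_field V\<^esub> x = x <#\<^bsub>Aut_field V\<^esub> range (flow V)"
    if "x \<in> carrier (Aut_field V)" for x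
    using that flow_commutes flow_Aut by (auto simp: r_coset_def l_coset_def Aut_mult)
  ultimately show ?thesis by (intro A.normalI) auto
qed

end

text \<open>The image of \<open>h\<close> is a complement of the normal subgroup, and a complement represents each coset
  once.\<close>

lemma (in normal) Mod_iso_complement:
  assumes \<Gamma>: "group \<Gamma>" and h: "h \<in> hom \<Gamma> G"
    and inj: "\<And>\<gamma>. \<gamma> \<in> carrier \<Gamma> \<Longrightarrow> h \<gamma> \<in> H \<Longrightarrow> \<gamma> = \<one>\<^bsub>\<Gamma>\<^esub>"
    and cover: "\<And>x. x \<in> carrier G \<Longrightarrow> \<exists>\<gamma> \<in> carrier \<Gamma>. \<exists>n \<in> H. x = n \<otimes> h \<gamma>"
  shows "G Mod H \<cong> \<Gamma>"
proof -
  interpret Q: group "G Mod H" by (rule factorgroup_is_group)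
  let ?k = "(\<lambda>x. H #> x) \<circ> h"
  have k: "?k \<in> hom \<Gamma> (G Mod H)"
    using h r_coset_hom_Mod by (rule Group.hom_compose)
  interpret kh: group_hom \<Gamma> "G Mod H" ?k
    by (rule group_hom.intro) (use \<Gamma> k Q.group_axioms in \<open>auto simp: group_hom_axioms_def\<close>)
  have hc: "h \<gamma> \<in> carrier G" if "\<gamma> \<in> carrier \<Gamma>" for \<gamma> using h that by (auto simp: hom_def)
  have "inj_on ?k (carrier \<Gamma>)"
  proof (rule kh.inj_on_one_iff[THEN iffD2, rule_format])
    fix \<gamma> assume \<gamma>: "\<gamma> \<in> carrier \<Gamma>" and "?k \<gamma> = \<one>\<^bsub>G Mod H\<^esub>"
    then have "H #> h \<gamma> = H" by (simp add: FactGroup_def)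
    then have "h \<gamma> \<in> H" using rcos_self[OF hc[OF \<gamma>] subgroup_axioms] by simp
    then show "\<gamma> = \<one>\<^bsub>\<Gamma>\<^esub>" using inj \<gamma> by blast
  qed
  moreover have "?k ` carrier \<Gamma> = carrier (G Mod H)"
  proof
    show "?k ` carrier \<Gamma> \<subseteq> carrier (G Mod H)" using k by (auto simp: hom_def)
    show "carrier (G Mod H) \<subseteq> ?k ` carrier \<Gamma>"
    proof
      fix C assume "C \<in> carrier (G Mod H)"
      then obtain x where x: "x \<in> carrier G" "C = H #> x"
        by (auto simp: FactGroup_def RCOSETS_def)
      then obtain \<gamma> n where \<gamma>: "\<gamma> \<in> carrier \<Gamma>" "n \<in> H" "x = n \<otimes> h \<gamma>" using cover by blast
      have "H #> x = (H #> n) #> h \<gamma>"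
        using \<gamma> hc by (simp add: coset_mult_assoc subset)
      also have "H #> n = H" using \<gamma>(2) subgroup_axioms by (intro coset_join2) auto
      finally show "C \<in> ?k ` carrier \<Gamma>" using x(2) \<gamma>(1) by auto
    qed
  qed
  ultimately have "?k \<in> iso \<Gamma> (G Mod H)" using k by (simp add: iso_def bij_betw_def)
  then show ?thesis using group.iso_sym[OF \<Gamma>] is_isoI by blast
qed

section \<open>Orientation\<close>

definition preserving :: "(complex \<Rightarrow> complex) \<Rightarrow> bool" where
  "preserving \<phi> \<longleftrightarrow> (\<exists>L. lift_of \<phi> L \<and> (\<forall>t. vderiv L t > 0))"

lemma preserving_lift: "preserving \<phi> \<Longrightarrow> lift_of \<phi> L \<Longrightarrow> vderiv L t > 0"
  unfolding preserving_def using lift_of_vderiv_unique by metis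

lemma not_preserving_lift:
  assumes "\<phi> \<in> Diff_circle" "\<not> preserving \<phi>" "lift_of \<phi> L"
  shows "vderiv L t < 0" "L (t + 2 * pi) = L t - 2 * pi"
  using Diff_circle_lift[OF assms(1,3)] assms(2,3) unfolding preserving_def by blast+

lemma Diff_circle_lift_ex: "\<phi> \<in> Diff_circle \<Longrightarrow> \<exists>L. lift_of \<phi> L"
  using Bij_lift_ex by (auto simp: Diff_circle_def)

lemma preserving_compose_iff:
  assumes "\<phi> \<in> Diff_circle" "\<psi> \<in> Diff_circle"
  shows "preserving (compose circle \<phi> \<psi>) \<longleftrightarrow> (preserving \<phi> \<longleftrightarrow> preserving \<psi>)"
proof -
  obtain L M where L: "lift_of \<phi> L" and M: "lift_of \<psi> M" using Diff_circle_lift_ex assms by meson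
  have sm: "smooth_line L" "smooth_line M" using L M by (auto simp: lift_of_def)
  have LM: "lift_of (compose circle \<phi> \<psi>) (\<lambda>t. L (M t))"
    by (rule lift_of_compose[OF L M]) (simp add: compose_def)
  have pres: "preserving \<theta> \<longleftrightarrow> vderiv K 0 > 0" if "\<theta> \<in> Diff_circle" "lift_of \<theta> K" for \<theta> K
    using not_preserving_lift[OF that(1) _ that(2), of 0] preserving_lift[OF _ that(2), of 0] by fastforce
  have L0: "preserving \<phi> \<longleftrightarrow> vderiv L (M 0) > 0"
    using not_preserving_lift[OF assms(1) _ L, of "M 0"] preserving_lift[OF _ L, of "M 0"] by fastforce
  have "vderiv L (M 0) \<noteq> 0" "vderiv M 0 \<noteq> 0"
    using Diff_circle_lift[OF assms(1) L] Diff_circle_lift[OF assms(2) M] by (metis less_irrefl)+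
  then show ?thesis
    using L0 pres[OF assms(2) M] pres[OF Diff_circle_compose[OF assms] LM]
    by (auto simp: vderiv_compose[OF sm] zero_less_mult_iff)
qed

text \<open>A lift with \<open>0 \<le> L 0 < 2 * pi\<close> satisfies \<open>L (2 * pi) = L 0 - 2 * pi < 2 * pi\<close>, so that
  \<open>L t - t\<close> changes sign.\<close>

lemma orientation_reversing_fixed_point:
  assumes "\<phi> \<in> Diff_circle" "\<not> preserving \<phi>"
  shows "\<exists>L t. lift_of \<phi> L \<and> L t = t"
proof -
  have B: "\<phi> \<in> Bij circle" using assms(1) Diff_circle_Bij by blast
  obtain \<theta>' where \<theta>': "\<phi> (cis 0) = cis \<theta>'" using Bij_circle_cis[OF B] circle_cisE by blast
  obtain k :: int where k: "0 \<le> \<theta>' + 2 * pi * k" "\<theta>' + 2 * pi * k < 2 * pi" using reduce_angle by blast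
  have "\<phi> (cis 0) = cis (\<theta>' + 2 * pi * k)" using \<theta>' cis_eq_iff by metis
  then obtain L where L: "lift_of \<phi> L" "L 0 = \<theta>' + 2 * pi * k"
    using lift_ex B Bij_image_circle assms(1) unfolding Diff_circle_def by blast
  have "L (0 + 2 * pi) = L 0 - 2 * pi" by (rule not_preserving_lift[OF assms L(1)])
  then have "L (2 * pi) - 2 * pi \<le> 0" "0 \<le> L 0 - 0" using k L(2) by auto
  moreover have "continuous_on {0..2 * pi} (\<lambda>t. L t - t)"
    using L(1) by (intro continuous_intros smooth_line_continuous) (simp add: lift_of_def)
  ultimately obtain t where "L t - t = 0"
    using IVT2'[of "\<lambda>t. L t - t" "2 * pi" 0 0] by auto
  then show ?thesis using L(1) by auto
qed

section \<open>Open and dense conditions on metrics\<close>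

text \<open>The continuity is phrased with the inequalities that define \<^const>\<open>Cinf_ball\<close>.\<close>

definition C2_functional :: "((real \<Rightarrow> real) \<Rightarrow> real) \<Rightarrow> bool" where
  "C2_functional \<l> \<longleftrightarrow>
     (\<forall>D E s. periodic_smooth D \<longrightarrow> periodic_smooth E \<longrightarrow> \<l> (\<lambda>t. D t + s * E t) = \<l> D + s * \<l> E) \<and>
     (\<exists>C>0. \<forall>D e. periodic_smooth D \<longrightarrow> (\<forall>k \<le> 2. \<forall>t. \<bar>(vderiv ^^ k) D t\<bar> < e) \<longrightarrow> \<bar>\<l> D\<bar> \<le> C * e)"

lemma periodic_smooth_add_scaled:
  "periodic_smooth D \<Longrightarrow> periodic_smooth E \<Longrightarrow> periodic_smooth (\<lambda>t. D t + s * E t)"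
  by (auto simp: periodic_smooth_def intro!: smooth_line_add smooth_line_mult)

lemma periodic_smooth_mult:
  "periodic_smooth D \<Longrightarrow> periodic_smooth E \<Longrightarrow> periodic_smooth (\<lambda>t. D t * E t)"
  by (auto simp: periodic_smooth_def intro!: smooth_line_mult)

lemma openin_Met_circle: "openin Cinf_topology Met_circle"
  unfolding openin_Cinf_topology Cinf_ball_def by (auto intro: exI[of _ 1])

lemma openin_functional_nonzero:
  assumes "C2_functional \<l>"
  shows "openin Cinf_topology {g \<in> Met_circle. \<l> (metric_coeff g) \<noteq> 0}"
  unfolding openin_Cinf_topology
proof (intro conjI ballI)
  fix g assume "g \<in> {g \<in> Met_circle. \<l> (metric_coeff g) \<noteq> 0}"
  then have g: "g \<in> Met_circle" and nz: "\<l> (metric_coeff g) \<noteq> 0" by auto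
  obtain C where "C > 0" and C: "\<And>D e. periodic_smooth D \<Longrightarrow>
      (\<forall>k \<le> 2. \<forall>t. \<bar>(vderiv ^^ k) D t\<bar> < e) \<Longrightarrow> \<bar>\<l> D\<bar> \<le> C * e"
    and lin: "\<And>D E s. periodic_smooth D \<Longrightarrow> periodic_smooth E \<Longrightarrow> \<l> (\<lambda>t. D t + s * E t) = \<l> D + s * \<l> E"
    using assms unfolding C2_functional_def by blast
  define e where "e = \<bar>\<l> (metric_coeff g)\<bar> / (2 * C)"
  have "e > 0" using nz \<open>C > 0\<close> by (simp add: e_def)
  have "\<l> (metric_coeff h) \<noteq> 0" if h: "h \<in> Cinf_ball g 2 e" for h
  proof
    assume 0: "\<l> (metric_coeff h) = 0"
    have hM: "h \<in> Met_circle" using h by (simp add: Cinf_ball_def)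
    let ?D = "\<lambda>t. metric_coeff h t + (- 1) * metric_coeff g t"
    note per = periodic_smooth_metric_coeff[OF hM] periodic_smooth_metric_coeff[OF g]
    have "\<bar>\<l> ?D\<bar> \<le> C * e"
    proof (rule C)
      show "periodic_smooth ?D" using per by (rule periodic_smooth_add_scaled)
      show "\<forall>k \<le> 2. \<forall>t. \<bar>(vderiv ^^ k) ?D t\<bar> < e"
        using h unfolding vderiv_funpow_add_scaled[OF per[unfolded periodic_smooth_def, THEN conjunct1]]
        by (simp add: Cinf_ball_def)
    qed
    also have "C * e = \<bar>\<l> (metric_coeff g)\<bar> / 2" using \<open>C > 0\<close> by (simp add: e_def)
    finally show False unfolding lin[OF per] using 0 nz by simp
  qed
  then show "\<exists>N. \<exists>e > 0. Cinf_ball g N e \<subseteq> {g \<in> Met_circle. \<l> (metric_coeff g) \<noteq> 0}"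
    using \<open>e > 0\<close> by (intro exI[of _ 2] exI[of _ e]) (auto simp: Cinf_ball_def)
qed auto

lemma openin_functionals_nonzero:
  assumes "finite \<L>" "\<And>\<l>. \<l> \<in> \<L> \<Longrightarrow> C2_functional \<l>"
  shows "openin Cinf_topology {g \<in> Met_circle. \<forall>\<l> \<in> \<L>. \<l> (metric_coeff g) \<noteq> 0}"
  using assms
proof (induction \<L>)
  case empty
  then show ?case using openin_Met_circle by simp
next
  case (insert \<l> \<L>)
  have "{g \<in> Met_circle. \<forall>\<l> \<in> insert \<l> \<L>. \<l> (metric_coeff g) \<noteq> 0} =
      {g \<in> Met_circle. \<l> (metric_coeff g) \<noteq> 0} \<inter> {g \<in> Met_circle. \<forall>\<l> \<in> \<L>. \<l> (metric_coeff g) \<noteq> 0}" by auto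
  then show ?case using insert openin_functional_nonzero by (simp add: openin_Int)
qed

definition perturb :: "(complex \<Rightarrow> complex \<Rightarrow> complex \<Rightarrow> real) \<Rightarrow> (complex \<Rightarrow> real) \<Rightarrow> real
    \<Rightarrow> complex \<Rightarrow> complex \<Rightarrow> complex \<Rightarrow> real" where
  "perturb g w s = (\<lambda>z u v. (1 + s * w z) * g z u v)"

lemma metric_coeff_perturb:
  "metric_coeff (perturb g w s) = (\<lambda>t. metric_coeff g t + s * (w (cis t) * metric_coeff g t))"
  by (auto simp: metric_coeff_def perturb_def algebra_simps)

lemma perturb_Met_circle:
  assumes g: "g \<in> Met_circle" and w: "smooth_circle w" "\<And>t. 1 + s * w (cis t) > 0"
  shows "perturb g w s \<in> Met_circle"
proof -
  have pos: "1 + s * w z > 0" if "z \<in> circle" for z using w(2) circle_cisE[OF that] by metis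
  have sm: "smooth_line (metric_coeff (perturb g w s))"
    unfolding metric_coeff_perturb
    using w(1) periodic_smooth_metric_coeff[OF g]
    by (intro smooth_line_add smooth_line_mult smooth_line_const) (auto simp: periodic_smooth_def smooth_circle_def)
  have fib: "(\<forall>v \<in> tangent_circle z. \<forall>w' \<in> tangent_circle z. perturb g w s z v w' = perturb g w s z w' v) \<and>
        (\<forall>u \<in> tangent_circle z. \<forall>v \<in> tangent_circle z. \<forall>w' \<in> tangent_circle z. \<forall>a b.
           perturb g w s z (a *\<^sub>R u + b *\<^sub>R v) w' = a * perturb g w s z u w' + b * perturb g w s z v w') \<and>
        (\<forall>v \<in> tangent_circle z. v \<noteq> 0 \<longrightarrow> perturb g w s z v v > 0)" if z: "z \<in> circle" for z
  proof -
    have "g z v w' = g z w' v" if "v \<in> tangent_circle z" "w' \<in> tangent_circle z" for v w'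
      using g z that unfolding Met_circle_def by blast
    moreover have "g z (a *\<^sub>R u + b *\<^sub>R v) w' = a * g z u w' + b * g z v w'"
      if "u \<in> tangent_circle z" "v \<in> tangent_circle z" "w' \<in> tangent_circle z" for u v w' a b
      using g z that unfolding Met_circle_def by blast
    moreover have "g z v v > 0" if "v \<in> tangent_circle z" "v \<noteq> 0" for v
      using g z that unfolding Met_circle_def by blast
    ultimately show ?thesis
      unfolding perturb_def using pos[OF z] by (simp add: distrib_left mult.left_commute)
  qed
  have off: "perturb g w s z v w' = 0" if "\<not> (z \<in> circle \<and> v \<in> tangent_circle z \<and> w' \<in> tangent_circle z)" for z v w'
    using g that unfolding Met_circle_def perturb_def by simp
  show ?thesis unfolding Met_circle_def using fib sm off by blast
qed

text \<open>Each functional is affine in \<open>s\<close> along the metrics \<open>(1 + s w) g\<close>, and not the zero function of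
  \<open>s\<close>. Thus all small \<open>s > 0\<close> avoid its zeros.\<close>

lemma perturb_approximates:
  assumes g: "g \<in> Met_circle" and w: "smooth_circle w"
    and \<L>: "finite \<L>" "\<And>\<l>. \<l> \<in> \<L> \<Longrightarrow> C2_functional \<l>"
    and nz: "\<And>\<l>. \<l> \<in> \<L> \<Longrightarrow> \<l> (metric_coeff g) = 0 \<Longrightarrow> \<l> (\<lambda>t. w (cis t) * metric_coeff g t) \<noteq> 0"
    and U: "openin Cinf_topology U" "g \<in> U"
  shows "\<exists>s. perturb g w s \<in> U \<and> (\<forall>\<l> \<in> \<L>. \<l> (metric_coeff (perturb g w s)) \<noteq> 0) \<and> (\<forall>t. 1 + s * w (cis t) > 0)"
proof -
  let ?G = "metric_coeff g" and ?W = "\<lambda>t. w (cis t) * metric_coeff g t"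
  have G: "periodic_smooth ?G" by (rule periodic_smooth_metric_coeff[OF g])
  have pw: "periodic_smooth (\<lambda>t. w (cis t))" by (rule periodic_smooth_circle[OF w])
  have W: "periodic_smooth ?W" using pw G by (rule periodic_smooth_mult)
  obtain N e where e: "e > 0" "Cinf_ball g N e \<subseteq> U" using U unfolding openin_Cinf_topology by blast
  have small: "\<forall>\<^sub>F s in at_right 0. \<forall>t. \<bar>s * H t\<bar> < d" if H: "periodic_smooth H" and "d > 0" for H and d :: real
  proof -
    obtain B where B: "B > 0" "\<And>t. \<bar>H t\<bar> \<le> B" using periodic_smooth_bounded[OF H] by blast
    have "\<forall>\<^sub>F s in at_right 0. 0 < s \<and> s < d / B"
      using eventually_at_right_real[of 0 "d / B"] \<open>d > 0\<close> B(1) by simp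
    then show ?thesis
    proof eventually_elim
      case (elim s)
      have "\<bar>s * H t\<bar> < d" for t
      proof -
        have "\<bar>s * H t\<bar> \<le> s * B" using elim B(2)[of t] by (simp add: abs_mult mult_left_mono)
        also have "\<dots> < d" using elim B(1) by (simp add: field_simps)
        finally show ?thesis .
      qed
      then show ?case by blast
    qed
  qed
  have per_k: "periodic_smooth ((vderiv ^^ k) ?W)" for k
    by (induction k) (auto intro: W periodic_smooth_vderiv)
  have 1: "\<forall>\<^sub>F s in at_right 0. \<forall>t. \<bar>s * w (cis t)\<bar> < 1" by (rule small[OF pw]) simp
  have 2: "\<forall>\<^sub>F s in at_right 0. \<forall>k \<in> {..N}. \<forall>t. \<bar>s * (vderiv ^^ k) ?W t\<bar> < e"
    by (intro eventually_ball_finite ballI small per_k e) simp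
  have 3: "\<forall>\<^sub>F s in at_right 0. \<forall>\<l> \<in> \<L>. \<l> (\<lambda>t. ?G t + s * ?W t) \<noteq> 0"
  proof (intro eventually_ball_finite \<L>(1) ballI)
    fix \<l> assume l: "\<l> \<in> \<L>"
    have lin: "\<l> (\<lambda>t. ?G t + s * ?W t) = \<l> ?G + s * \<l> ?W" for s
      using \<L>(2)[OF l] G W unfolding C2_functional_def by blast
    show "\<forall>\<^sub>F s in at_right 0. \<l> (\<lambda>t. ?G t + s * ?W t) \<noteq> 0"
    proof (cases "\<l> ?G = 0")
      case True
      have "\<forall>\<^sub>F s in at_right (0::real). s > 0" by (simp add: eventually_at_right_less)
      then show ?thesis by eventually_elim (use True nz[OF l] lin in simp)
    next
      case False
      have "((\<lambda>s. \<l> ?G + s * \<l> ?W) \<longlongrightarrow> \<l> ?G + 0 * \<l> ?W) (at_right 0)" by (intro tendsto_intros)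
      then show ?thesis unfolding lin using False by (intro tendsto_imp_eventually_ne) auto
    qed
  qed
  obtain s where s: "\<forall>t. \<bar>s * w (cis t)\<bar> < 1" "\<forall>k \<in> {..N}. \<forall>t. \<bar>s * (vderiv ^^ k) ?W t\<bar> < e"
    "\<forall>\<l> \<in> \<L>. \<l> (\<lambda>t. ?G t + s * ?W t) \<noteq> 0"
    using eventually_happens'[OF trivial_limit_at_right_real eventually_conj[OF 1 eventually_conj[OF 2 3]]] by blast
  have pos: "\<forall>t. 1 + s * w (cis t) > 0" using s(1) by (smt (verit))
  have "perturb g w s \<in> Cinf_ball g N e"
    using perturb_Met_circle[OF g w] pos s(2) G W
    by (auto simp: Cinf_ball_def metric_coeff_perturb vderiv_funpow_add_scaled periodic_smooth_def)
  then show ?thesis using e(2) s(3) pos by (intro exI[of _ s]) (auto simp: metric_coeff_perturb)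
qed

context simple_zeros
begin

lemma C2_functional_period: "C2_functional period"
  unfolding C2_functional_def
proof (intro conjI allI impI)
  fix D E s assume D: "periodic_smooth D" and E: "periodic_smooth E"
  have sm: "smooth_line D" "smooth_line E" using D E by (auto simp: periodic_smooth_def)
  have "vderiv (\<lambda>t. D t + s * E t) = (\<lambda>t. vderiv D t + s * vderiv E t)"
    using vderiv_funpow_add_scaled[OF sm, of 1 s] by simp
  moreover have "vderiv (vderiv (\<lambda>t. D t + s * E t)) = (\<lambda>t. vderiv (vderiv D) t + s * vderiv (vderiv E) t)"
    using vderiv_funpow_add_scaled[OF sm, of 2 s] by (simp add: numeral_2_eq_2)
  ultimately have dens: "density (\<lambda>t. D t + s * E t) = (\<lambda>t. density D t + s * density E t)"
    by (auto simp: density_def algebra_simps)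
  have "antideriv (\<lambda>t. density D t + s * density E t) r = 
      (antideriv (density D) r + s * antideriv (density E) r) - (antideriv (density D) 0 + s * antideriv (density E) 0)" for r
    by (rule antideriv_eq) (intro derivative_intros DERIV_cmult antideriv_has_derivative continuous_density sm)
  then show "period (\<lambda>t. D t + s * E t) = period D + s * period E"
    unfolding period_def dens by simp
next
  obtain B0 B1 B2 where B: "B0 > 0" "\<And>t. \<bar>q0 t\<bar> \<le> B0" "B1 > 0" "\<And>t. \<bar>q1 t\<bar> \<le> B1" "B2 > 0" "\<And>t. \<bar>q2 t\<bar> \<le> B2"
    using periodic_continuous_bounded[OF continuous_q0 periodic_q0] periodic_continuous_bounded[OF continuous_q1 periodic_q1]
      periodic_continuous_bounded[OF continuous_q2 periodic_q2] by metis
  let ?C = "2 * pi * (B0 + B1 + B2)"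
  have "\<bar>period D\<bar> \<le> ?C * e" if D: "periodic_smooth D" and e: "\<forall>k \<le> 2. \<forall>t. \<bar>(vderiv ^^ k) D t\<bar> < e" for D e
  proof -
    have e': "\<bar>D t\<bar> < e" "\<bar>vderiv D t\<bar> < e" "\<bar>vderiv (vderiv D) t\<bar> < e" for t
      using e[rule_format, of 0] e[rule_format, of 1] e[rule_format, of 2] by (auto simp: numeral_2_eq_2)
    have dens: "\<bar>density D t\<bar> \<le> (B0 + B1 + B2) * e" for t
    proof -
      have "\<bar>density D t\<bar> \<le> \<bar>D t\<bar> * \<bar>q0 t\<bar> + \<bar>vderiv D t\<bar> * \<bar>q1 t\<bar> + \<bar>vderiv (vderiv D) t\<bar> * \<bar>q2 t\<bar>"
        unfolding density_def by (simp flip: abs_mult)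
      also have "\<dots> \<le> e * B0 + e * B1 + e * B2"
        by (intro add_mono mult_mono) (use e'[of t] B in \<open>auto intro: less_imp_le\<close>)
      finally show ?thesis by (simp add: algebra_simps)
    qed
    have "norm (integral {0..1} (\<lambda>u. 2 * pi * density D (2 * pi * u))) \<le> ?C * e * (1 - 0)"
    proof (rule integral_bound)
      show "continuous_on {0..1} (\<lambda>u. 2 * pi * density D (2 * pi * u))"
        using D by (intro continuous_intros continuous_on_compose2[OF continuous_density[of D]]) (auto simp: periodic_smooth_def)
      show "norm (2 * pi * density D (2 * pi * u)) \<le> ?C * e" for u
        using mult_left_mono[OF dens[of "2 * pi * u"], of "2 * pi"] by (simp add: abs_mult mult.assoc)
    qed simp
    then show ?thesis by (simp only: period_def antideriv_def real_norm_def diff_zero mult_1_right)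
  qed
  moreover have "?C > 0" using B by simp
  ultimately show "\<exists>C>0. \<forall>D e. periodic_smooth D \<longrightarrow> (\<forall>k \<le> 2. \<forall>t. \<bar>(vderiv ^^ k) D t\<bar> < e) \<longrightarrow> \<bar>period D\<bar> \<le> C * e"
    by blast
qed

lemma C2_functional_evaluation: "C2_functional (\<lambda>D. x * D p - y * D q)"
  unfolding C2_functional_def
proof (intro conjI allI impI)
  have "\<bar>x * D p - y * D q\<bar> \<le> (\<bar>x\<bar> + \<bar>y\<bar> + 1) * e" if e: "\<forall>k \<le> 2. \<forall>t. \<bar>(vderiv ^^ k) D t\<bar> < e" for D :: "real \<Rightarrow> real" and e
  proof -
    have e': "\<bar>D t\<bar> < e" for t using e[rule_format, of 0] by simp
    have "\<bar>x * D p - y * D q\<bar> \<le> \<bar>x\<bar> * \<bar>D p\<bar> + \<bar>y\<bar> * \<bar>D q\<bar>"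
      using abs_triangle_ineq4[of "x * D p" "y * D q"] by (simp add: abs_mult)
    also have "\<dots> \<le> \<bar>x\<bar> * e + \<bar>y\<bar> * e" by (intro add_mono mult_left_mono less_imp_le[OF e']) auto
    also have "\<dots> \<le> (\<bar>x\<bar> + \<bar>y\<bar> + 1) * e" using e'[of 0] by (simp add: algebra_simps)
    finally show ?thesis .
  qed
  then show "\<exists>C>0. \<forall>D e. periodic_smooth D \<longrightarrow> (\<forall>k \<le> 2. \<forall>t. \<bar>(vderiv ^^ k) D t\<bar> < e) \<longrightarrow> \<bar>x * D p - y * D q\<bar> \<le> C * e"
    by (intro exI[of _ "\<bar>x\<bar> + \<bar>y\<bar> + 1"]) auto
qed (simp add: algebra_simps)

lemma finite_zeros: "finite {t \<in> {0..2 * pi}. a t = 0}"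
proof (rule ccontr)
  let ?Z = "{t \<in> {0..2 * pi}. a t = 0}"
  assume "infinite ?Z"
  then obtain p where p: "p islimpt ?Z"
    using compact_eq_Bolzano_Weierstrass[of "{0..2 * pi}"] by (metis (no_types, lifting) compact_Icc mem_Collect_eq subsetI)
  have "\<exists>\<^sub>F t in at p. a t = 0"
    using p unfolding islimpt_conv_frequently_at by (rule frequently_elim1) simp
  then show False using eventually_nonzero[of p] by (simp add: frequently_def)
qed

end

section \<open>Gradient fields of Morse functions\<close>

locale morse_function =
  fixes f :: "complex \<Rightarrow> real"
  assumes morse: "Morse_circle f"
begin

abbreviation F :: "real \<Rightarrow> real" where "F \<equiv> \<lambda>s. f (cis s)"

lemma smooth_f: "smooth_circle f"
  using morse by (simp add: Morse_circle_def)

lemma smooth_F: "smooth_line F"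
  using smooth_f by (simp add: smooth_circle_def)

end

sublocale morse_function \<subseteq> simple_zeros "vderiv (\<lambda>s. f (cis s))"
proof
  show "periodic_smooth (vderiv F)"
    by (intro periodic_smooth_vderiv periodic_smooth_circle smooth_f)
  fix t assume 0: "vderiv F t = 0"
  have "differential f (cis t) v = 0" if "v \<in> tangent_circle (cis t)" for v
    using that 0 differential_function[OF smooth_f] by (auto simp: tangent_circle_cis_iff)
  then have "(vderiv ^^ 2) F t \<noteq> 0" using morse unfolding Morse_circle_def by blast
  then show "vderiv (vderiv F) t \<noteq> 0" by (simp add: numeral_2_eq_2)
qed

context morse_function
begin

abbreviation a :: "real \<Rightarrow> real" where "a \<equiv> vderiv F"

lemma critical_point_ex: "\<exists>t. a t = 0"
proof -
  have "\<exists>z>0. z < 2 * pi \<and> F (2 * pi) - F 0 = (2 * pi - 0) * a z"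
    by (rule MVT2) (use smooth_line_has_real_derivative[OF smooth_F] in auto)
  then show ?thesis by auto
qed

end

locale gradient_field = morse_function +
  fixes g :: "complex \<Rightarrow> complex \<Rightarrow> complex \<Rightarrow> real"
  assumes metric: "g \<in> Met_circle"

sublocale gradient_field \<subseteq> positive_coefficient "vderiv (\<lambda>s. f (cis s))" "metric_coeff g"
  by unfold_locales (use metric in \<open>auto intro: periodic_smooth_metric_coeff metric_coeff_pos\<close>)

sublocale gradient_field \<subseteq> field: circle_field X "gradient g f"
proof
  show "periodic_smooth X" by (rule periodic_smooth_X)
  show "\<exists>y. y 0 = t \<and> (\<forall>s. (y has_real_derivative X (y s)) (at s))" for t
    using critical_point_ex trajectory_ex by blast
  show "gradient g f (cis t) = of_real (X t) * (\<i> * cis t)" for t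
    using gradient_cis[OF metric smooth_f] by (simp add: X_def)
qed

context gradient_field
begin

abbreviation Aut :: "(complex \<Rightarrow> complex) monoid" where "Aut \<equiv> Aut_field (gradient g f)"
abbreviation G :: "real \<Rightarrow> real" where "G \<equiv> metric_coeff g"
abbreviation Fl :: "real \<Rightarrow> complex \<Rightarrow> complex" where "Fl \<equiv> flow (gradient g f)"

lemma Aut_symmetry:
  assumes "\<phi> \<in> carrier Aut" "lift_of \<phi> L" shows "symmetry L"
proof -
  have "vderiv L t \<noteq> 0" for t
    using Diff_circle_lift[OF field.Aut_Diff[OF assms(1)] assms(2)] by (metis less_irrefl)
  then show ?thesis
    using assms field.Aut_lift[OF assms] by (simp add: symmetry_def lift_of_def)
qed

lemma flow_symmetry: "symmetry (\<lambda>t. field.Y s t)"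
  by (rule Aut_symmetry[OF field.flow_Aut field.flow_lift])

lemma flow_time:
  assumes "a t \<noteq> 0" shows "time G (field.Y s t) = time G t + s"
proof -
  have nz: "a (field.Y s t) \<noteq> 0" for s using assms symmetry_zero_iff[OF flow_symmetry] by blast
  have "((\<lambda>s. time G (field.Y s t) - s) has_real_derivative 0) (at s)" for s
  proof -
    have "((\<lambda>s. time G (field.Y s t)) has_real_derivative 1 / X (field.Y s t) * X (field.Y s t)) (at s)"
      by (rule DERIV_chain2[OF time_G_has_derivative[OF nz] field.Y_has_derivative])
    moreover have "1 / X (field.Y s t) * X (field.Y s t) = 1" using nz[of s] X_eq_0_iff by simp
    ultimately show ?thesis using DERIV_diff[OF _ DERIV_ident] by fastforce
  qed
  from real_const_if_derivative_0[OF this, of s 0] show ?thesis by simp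
qed

lemma flow_fixes_critical: "a p = 0 \<Longrightarrow> field.Y s p = p"
  by (rule field.trajectory_eq_Y[of "\<lambda>_. p", symmetric])
    (simp add: field.trajectory_def X_eq_0_iff[THEN iffD2])

text \<open>Compare the automorphism with the flow at the time by which it changes the time function.\<close>

lemma preserving_fixing_imp_flow:
  assumes \<phi>: "\<phi> \<in> carrier Aut" and pres: "preserving \<phi>" and p: "a p = 0" and fix_p: "\<phi> (cis p) = cis p"
  shows "\<exists>s. \<phi> = Fl s"
proof -
  have B: "\<phi> \<in> Bij circle" using field.Aut_Diff[OF \<phi>] Diff_circle_Bij by blast
  obtain L where L: "lift_of \<phi> L" "L p = p"
    using lift_ex[of \<phi> p p] fix_p field.Aut_Diff[OF \<phi>] Bij_image_circle[OF B] by (auto simp: Diff_circle_def)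
  have sym: "symmetry L" by (rule Aut_symmetry[OF \<phi> L(1)])
  obtain k where k: "\<And>t. a t \<noteq> 0 \<Longrightarrow> time G (L t) = time G t + k" using symmetry_time[OF sym] by blast
  have "L t = field.Y k t" for t
  proof (rule symmetries_eq[OF sym flow_symmetry])
    show "vderiv L t > 0" for t by (rule preserving_lift[OF pres L(1)])
    show "vderiv (\<lambda>t. field.Y k t) t > 0" for t using field.vderiv_Y field.J_pos by simp
    show "time G (L t) = time G (field.Y k t)" if "a t \<noteq> 0" for t using k flow_time that by simp
    show "L p = field.Y k p" using L(2) flow_fixes_critical[OF p] by simp
  qed
  then have "\<phi> = Fl k"
    using L(1) B by (intro field.Aut_eqI) (auto simp: Bij_def field.flow_cis lift_of_def field.flow_extensional)
  then show ?thesis by blast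
qed

lemma reversing_imp_period_0:
  assumes "\<phi> \<in> carrier Aut" "\<not> preserving \<phi>" shows "period G = 0"
proof -
  obtain L where L: "lift_of \<phi> L" using field.Aut_lift_ex[OF assms(1)] by blast
  show ?thesis
    by (rule reversing_symmetry_period[OF Aut_symmetry[OF assms(1) L]])
      (rule not_preserving_lift(2)[OF field.Aut_Diff[OF assms(1)] assms(2) L])
qed

lemma flow_pow: "Fl s [^]\<^bsub>Aut\<^esub> (n::nat) = Fl (real n * s)"
proof -
  interpret A: group Aut by (rule field.group_Aut)
  have mult: "Fl s \<otimes>\<^bsub>Aut\<^esub> Fl r = Fl (s + r)" for s r
    by (simp add: field.Aut_mult field.flow_Aut field.flow_compose)
  have one: "\<one>\<^bsub>Aut\<^esub> = Fl 0"
    using A.l_cancel_one'[OF field.flow_Aut field.flow_Aut, of 0 0] mult[of 0 0] by simp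
  show ?thesis by (induction n) (auto simp: one mult algebra_simps)
qed

lemma flow_periodic_imp_0:
  assumes "Fl s = Fl 0" shows "s = 0"
proof -
  obtain p where p: "a p = 0" using critical_point_ex by blast
  obtain t where t: "a t \<noteq> 0" using nonzero_ex by blast
  have "lift_of (Fl s) (\<lambda>t. t)" unfolding assms by (simp add: lift_of_def field.flow_cis)
  then obtain k :: int where k: "\<And>t. field.Y s t = t + 2 * pi * k"
    using lift_of_unique[OF _ field.flow_lift] by metis
  have "field.Y s t = t" using k[of p] k[of t] flow_fixes_critical[OF p, of s] by simp
  then show ?thesis using flow_time[OF t, of s] by simp
qed

end

section \<open>The group action\<close>

locale morse_action = morse_function +
  fixes \<Gamma> :: "('a, 'b) monoid_scheme" and \<alpha> :: "'a \<Rightarrow> complex \<Rightarrow> complex"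
  assumes group_\<Gamma>: "group \<Gamma>" and finite_\<Gamma>: "finite (carrier \<Gamma>)"
    and action: "smooth_effective_action \<Gamma> \<alpha>"
    and invariant: "invariant_function \<Gamma> \<alpha> f"
begin

lemma faithful: "faithful_action \<Gamma> circle \<alpha>"
  using action by (simp add: smooth_effective_action_def)

lemma act_Bij: "\<gamma> \<in> carrier \<Gamma> \<Longrightarrow> \<alpha> \<gamma> \<in> Bij circle"
  using faithful group_action.bij_prop0 faithful_action.axioms(1) by metis

lemma act_mult:
  assumes "\<gamma> \<in> carrier \<Gamma>" "\<delta> \<in> carrier \<Gamma>"
  shows "\<alpha> (\<gamma> \<otimes>\<^bsub>\<Gamma>\<^esub> \<delta>) = compose circle (\<alpha> \<gamma>) (\<alpha> \<delta>)"
proof -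
  have "group_hom \<Gamma> (BijGroup circle) \<alpha>"
    using faithful faithful_action.axioms(1) group_action.group_hom by blast
  then have "\<alpha> (\<gamma> \<otimes>\<^bsub>\<Gamma>\<^esub> \<delta>) = \<alpha> \<gamma> \<otimes>\<^bsub>BijGroup circle\<^esub> \<alpha> \<delta>"
    using assms group_hom.hom_mult by metis
  then show ?thesis using assms act_Bij by (simp add: BijGroup_def)
qed

lemma act_one: "\<alpha> \<one>\<^bsub>\<Gamma>\<^esub> = restrict (\<lambda>z. z) circle"
  using faithful faithful_action.axioms(1) group_action.id_eq_one by metis

lemma act_inv:
  assumes "\<gamma> \<in> carrier \<Gamma>" "z \<in> circle"
  shows "\<alpha> (inv\<^bsub>\<Gamma>\<^esub> \<gamma>) (\<alpha> \<gamma> z) = z" "\<alpha> \<gamma> (\<alpha> (inv\<^bsub>\<Gamma>\<^esub> \<gamma>) z) = z"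
proof -
  interpret group \<Gamma> by (rule group_\<Gamma>)
  show "\<alpha> (inv\<^bsub>\<Gamma>\<^esub> \<gamma>) (\<alpha> \<gamma> z) = z" "\<alpha> \<gamma> (\<alpha> (inv\<^bsub>\<Gamma>\<^esub> \<gamma>) z) = z"
    using act_mult[of "inv\<^bsub>\<Gamma>\<^esub> \<gamma>" \<gamma>] act_mult[of \<gamma> "inv\<^bsub>\<Gamma>\<^esub> \<gamma>"] act_one assms
    by (simp_all add: compose_def fun_eq_iff) (metis mem_sphere_0)+
qed

lemma act_lift_ex: "\<gamma> \<in> carrier \<Gamma> \<Longrightarrow> \<exists>L. lift_of (\<alpha> \<gamma>) L"
  using Bij_lift_ex act_Bij action by (simp add: smooth_effective_action_def)

lemma act_Diff:
  assumes "\<gamma> \<in> carrier \<Gamma>" shows "\<alpha> \<gamma> \<in> Diff_circle"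
proof -
  have inv: "inv\<^bsub>\<Gamma>\<^esub> \<gamma> \<in> carrier \<Gamma>" using group.inv_closed[OF group_\<Gamma> assms] .
  obtain L M where "lift_of (\<alpha> \<gamma>) L" "lift_of (\<alpha> (inv\<^bsub>\<Gamma>\<^esub> \<gamma>)) M" using act_lift_ex assms inv by meson
  then show ?thesis
    by (rule Diff_circleI[rotated]) (use act_inv assms act_Bij in \<open>auto simp: Bij_def\<close>)
qed

lemma act_derivative:
  assumes "\<gamma> \<in> carrier \<Gamma>" "lift_of (\<alpha> \<gamma>) L"
  shows "a (L t) * vderiv L t = a t"
proof -
  have L: "smooth_line L" using assms(2) by (simp add: lift_of_def)
  have "F (L t) = F t" for t
    using assms invariant cis_mem_circle unfolding invariant_function_def lift_of_def by metis
  moreover have "((\<lambda>t. F (L t)) has_real_derivative a (L t) * vderiv L t) (at t)"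
    by (intro DERIV_chain2[of F] smooth_line_has_real_derivative smooth_F L)
  ultimately have "(F has_real_derivative a (L t) * vderiv L t) (at t)" by simp
  then show ?thesis
    by (rule DERIV_unique) (rule smooth_line_has_real_derivative[OF smooth_F])
qed

lemma metric_act:
  assumes "g \<in> Met_inv \<Gamma> \<alpha>" "\<gamma> \<in> carrier \<Gamma>" "lift_of (\<alpha> \<gamma>) L"
  shows "metric_coeff g (L t) * (vderiv L t)\<^sup>2 = metric_coeff g t"
proof -
  have g: "g \<in> Met_circle" using assms(1) by (simp add: Met_inv_def)
  let ?e = "of_real 1 * (\<i> * cis t)"
  have "g (\<alpha> \<gamma> (cis t)) (differential (\<alpha> \<gamma>) (cis t) ?e) (differential (\<alpha> \<gamma>) (cis t) ?e) = g (cis t) ?e ?e"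
    using assms(1,2) cis_mem_circle tangent_circleI unfolding Met_inv_def by blast
  moreover have "\<alpha> \<gamma> (cis t) = cis (L t)" using assms(3) by (simp add: lift_of_def)
  ultimately show ?thesis
    by (simp only: differential_lift[OF assms(3)] metric_tangent[OF g]) (simp add: power2_eq_square mult_ac)
qed

lemma act_Aut:
  assumes g: "g \<in> Met_inv \<Gamma> \<alpha>" and \<gamma>: "\<gamma> \<in> carrier \<Gamma>"
  shows "\<alpha> \<gamma> \<in> carrier (Aut_field (gradient g f))"
proof -
  interpret gradient_field f g by unfold_locales (use g in \<open>simp add: Met_inv_def\<close>)
  obtain L where L: "lift_of (\<alpha> \<gamma>) L" using act_lift_ex[OF \<gamma>] by blast
  show ?thesis
  proof (rule field.AutI[OF act_Diff[OF \<gamma>] L])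
    fix t
    have eqs: "a t = a (L t) * vderiv L t" "G t = G (L t) * (vderiv L t)\<^sup>2"
      using act_derivative[OF \<gamma> L] metric_act[OF g \<gamma> L] by simp_all
    have "vderiv L t \<noteq> 0" using G_pos[of t] eqs(2) by auto
    then show "vderiv L t * X t = X (L t)"
      unfolding X_def eqs using G_pos[of "L t"] by (simp add: field_simps power2_eq_square)
  qed
qed

definition reversing :: "'a set" where
  "reversing = {\<gamma> \<in> carrier \<Gamma>. \<not> preserving (\<alpha> \<gamma>)}"

text \<open>At a fixed point of an orientation reversing element, the invariance of \<open>f\<close> gives \<open>a L' = a\<close> with
  \<open>L' < 0\<close>, so this point is critical.\<close>

lemma base_point_ex:
  "\<exists>p. a p = 0 \<and> (reversing \<noteq> {} \<longrightarrow> (\<exists>\<rho> \<in> reversing. \<alpha> \<rho> (cis p) = cis p))"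
proof (cases "reversing = {}")
  case True
  then show ?thesis using critical_point_ex by blast
next
  case False
  then obtain \<rho> where \<rho>: "\<rho> \<in> carrier \<Gamma>" "\<not> preserving (\<alpha> \<rho>)" by (auto simp: reversing_def)
  then obtain L t where L: "lift_of (\<alpha> \<rho>) L" "L t = t"
    using orientation_reversing_fixed_point[OF act_Diff] by blast
  have "a t * vderiv L t = a t" using act_derivative[OF \<rho>(1) L(1), of t] L(2) by simp
  moreover have "vderiv L t < 0" by (rule not_preserving_lift[OF act_Diff[OF \<rho>(1)] \<rho>(2) L(1)])
  ultimately have "a t = 0" by (auto simp: mult_cancel_left1)
  moreover have "\<alpha> \<rho> (cis t) = cis t" using L by (simp add: lift_of_def)
  ultimately show ?thesis using \<rho> by (auto simp: reversing_def)
qed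

end

text \<open>The base point serves to normalize automorphisms: its stabilizer contains an orientation
  reversing element whenever the group does.\<close>

locale based_morse_action = morse_action +
  fixes p :: real
  assumes critical: "vderiv (\<lambda>s. f (cis s)) p = 0"
    and reversing_fixes: "reversing \<noteq> {} \<Longrightarrow> \<exists>\<rho> \<in> reversing. \<alpha> \<rho> (cis p) = cis p"
begin

definition orb :: "complex set" where
  "orb = (\<lambda>\<gamma>. \<alpha> \<gamma> (cis p)) ` carrier \<Gamma>"

text \<open>These functionals do not vanish on the coefficient \<open>G\<close> of a metric if and only if no critical
  point outside the orbit of \<open>p\<close> has the same multiplier \<open>a' / G\<close> as \<open>p\<close> and, if the group preserves
  the orientation, the period is nonzero.\<close>

definition functionals :: "((real \<Rightarrow> real) \<Rightarrow> real) set" where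
  "functionals =
     (\<lambda>t D. a' t * D p - a' p * D t) ` {t \<in> {0..2 * pi}. a t = 0 \<and> cis t \<notin> orb} \<union>
     (if reversing = {} then {period} else {})"

lemma finite_functionals: "finite functionals"
proof -
  have "finite {t \<in> {0..2 * pi}. a t = 0 \<and> cis t \<notin> orb}"
    by (rule finite_subset[OF _ finite_zeros]) auto
  then show ?thesis unfolding functionals_def by simp
qed

lemma C2_functionals: "\<l> \<in> functionals \<Longrightarrow> C2_functional \<l>"
  unfolding functionals_def
  by (auto split: if_splits intro: C2_functional_period C2_functional_evaluation)

definition generic :: "(complex \<Rightarrow> complex \<Rightarrow> complex \<Rightarrow> real) set" where
  "generic = {g \<in> Met_inv \<Gamma> \<alpha>. \<forall>\<l> \<in> functionals. \<l> (metric_coeff g) \<noteq> 0}"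

text \<open>The product over the group makes this invariant and confines its zeros to a single orbit.\<close>

definition weight :: "complex \<Rightarrow> real" where
  "weight z = (\<Prod>\<gamma>\<in>carrier \<Gamma>. (cmod (\<alpha> \<gamma> z - cis p))\<^sup>2)"

lemma weight_act:
  assumes \<delta>: "\<delta> \<in> carrier \<Gamma>" and z: "z \<in> circle"
  shows "weight (\<alpha> \<delta> z) = weight z"
proof -
  interpret group \<Gamma> by (rule group_\<Gamma>)
  have bij: "bij_betw (\<lambda>\<gamma>. \<gamma> \<otimes>\<^bsub>\<Gamma>\<^esub> \<delta>) (carrier \<Gamma>) (carrier \<Gamma>)"
    by (rule bij_betw_byWitness[where f' = "\<lambda>\<gamma>. \<gamma> \<otimes>\<^bsub>\<Gamma>\<^esub> inv\<^bsub>\<Gamma>\<^esub> \<delta>"]) (use \<delta> in \<open>auto simp: m_assoc\<close>)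
  have "weight z = (\<Prod>\<gamma>\<in>carrier \<Gamma>. (cmod (\<alpha> (\<gamma> \<otimes>\<^bsub>\<Gamma>\<^esub> \<delta>) z - cis p))\<^sup>2)"
    unfolding weight_def by (rule prod.reindex_bij_betw[OF bij, symmetric])
  also have "\<dots> = (\<Prod>\<gamma>\<in>carrier \<Gamma>. (cmod (\<alpha> \<gamma> (\<alpha> \<delta> z) - cis p))\<^sup>2)"
    using \<delta> z by (intro prod.cong) (simp_all add: act_mult compose_def)
  finally show ?thesis by (simp add: weight_def)
qed

lemma weight_base: "weight (cis p) = 0"
proof -
  interpret group \<Gamma> by (rule group_\<Gamma>)
  have "(cmod (\<alpha> \<one>\<^bsub>\<Gamma>\<^esub> (cis p) - cis p))\<^sup>2 = 0" by (simp add: act_one)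
  then show ?thesis unfolding weight_def using finite_\<Gamma> by (intro prod_zero) auto
qed

lemma weight_off_orbit:
  assumes "z \<in> circle" "z \<notin> orb" shows "weight z \<noteq> 0"
proof
  assume "weight z = 0"
  then obtain \<gamma> where \<gamma>: "\<gamma> \<in> carrier \<Gamma>" "\<alpha> \<gamma> z = cis p" using finite_\<Gamma> by (auto simp: weight_def)
  then have "z = \<alpha> (inv\<^bsub>\<Gamma>\<^esub> \<gamma>) (cis p)" using act_inv(1)[OF \<gamma>(1) assms(1)] by simp
  then show False using assms(2) group.inv_closed[OF group_\<Gamma> \<gamma>(1)] by (auto simp: orb_def)
qed

lemma smooth_weight: "smooth_circle weight"
proof -
  have "smooth_line (\<lambda>t. (cmod (\<alpha> \<gamma> (cis t) - cis p))\<^sup>2)" if \<gamma>: "\<gamma> \<in> carrier \<Gamma>" for \<gamma>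
  proof -
    obtain L where L: "smooth_line L" "\<And>t. \<alpha> \<gamma> (cis t) = cis (L t)"
      using act_lift_ex[OF \<gamma>] by (auto simp: lift_of_def)
    have "(cmod (\<alpha> \<gamma> (cis t) - cis p))\<^sup>2 = (cos (L t) - cos p)\<^sup>2 + (sin (L t) - sin p)\<^sup>2" for t
      by (simp add: L(2) cmod_power2)
    then show ?thesis
      using L(1) by (auto intro!: smooth_line_add smooth_line_power smooth_line_diff
          smooth_line_compose[OF smooth_line_cos] smooth_line_compose[OF smooth_line_sin])
  qed
  then show ?thesis unfolding smooth_circle_def weight_def by (rule smooth_line_prod)
qed

text \<open>The weight moves the metric outside the orbit of \<open>p\<close> but not on it, hence changes the
  multipliers relative to that of \<open>p\<close>. If it does not change the period, then the derivative \<open>u\<close> of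
  \<open>f\<close> along the positive unit tangent vectors is added. This function vanishes at the critical points,
  and \<open>u G = a sqrt G\<close> has the length of the circle as its period. It changes sign under
  orientation reversing isometries, but the period is among the functionals only if the group has
  no such elements.\<close>

lemma direction_ex:
  assumes g: "g \<in> Met_inv \<Gamma> \<alpha>"
  shows "\<exists>w. smooth_circle w \<and> (\<forall>\<gamma> \<in> carrier \<Gamma>. \<forall>z \<in> circle. w (\<alpha> \<gamma> z) = w z) \<and>
    (\<forall>\<l> \<in> functionals. \<l> (\<lambda>t. w (cis t) * metric_coeff g t) \<noteq> 0)"
proof -
  interpret gradient_field f g by unfold_locales (use g in \<open>simp add: Met_inv_def\<close>)
  define u where "u z = differential f z (\<i> * z) / sqrt (g z (\<i> * z) (\<i> * z))" for z
  have u: "u (cis t) = a t / sqrt (G t)" for t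
    using differential_function[OF smooth_f, of t 1] by (simp add: u_def metric_coeff_def)
  have smooth_sqrt: "smooth_line (\<lambda>t. sqrt (G t))" using smooth_G G_pos by (rule smooth_line_sqrt)
  have smooth_u: "smooth_circle u"
    unfolding smooth_circle_def u
    by (intro smooth_line_divide smooth smooth_sqrt) (use G_pos in \<open>simp add: less_imp_neq[symmetric]\<close>)
  have uG: "u (cis t) * G t = a t * sqrt (G t)" for t
    using G_pos[of t] real_div_sqrt[of "G t"] by (simp add: u field_simps)
  have period_u: "period (\<lambda>t. u (cis t) * G t) > 0"
    unfolding uG
    by (rule period_exact) (use periodic_smooth_G smooth_sqrt G_pos in \<open>auto simp: periodic_smooth_def\<close>)
  have pw: "periodic_smooth (\<lambda>t. weight (cis t) * G t)" "periodic_smooth (\<lambda>t. u (cis t) * G t)"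
    by (intro periodic_smooth_mult periodic_smooth_circle smooth_weight smooth_u periodic_smooth_G)+
  define r :: real where 
    "r = (if reversing = {} \<and> period (\<lambda>t. weight (cis t) * G t) = 0 then 1 else 0)"
  define w where "w z = weight z + r * u z" for z
  have "smooth_circle w"
    using smooth_weight smooth_u unfolding w_def smooth_circle_def
    by (intro smooth_line_add smooth_line_mult smooth_line_const)
  moreover have "w (\<alpha> \<gamma> z) = w z" if \<gamma>: "\<gamma> \<in> carrier \<Gamma>" and z: "z \<in> circle" for \<gamma> z
  proof (cases "reversing = {}")
    case True
    obtain t where t: "z = cis t" using z circle_cisE by blast
    obtain L where L: "lift_of (\<alpha> \<gamma>) L" using act_lift_ex[OF \<gamma>] by blast
    have "vderiv L t > 0" using True \<gamma> preserving_lift[OF _ L] by (auto simp: reversing_def)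
    moreover have "a (L t) * vderiv L t = a t" "G (L t) * (vderiv L t)\<^sup>2 = G t"
      using act_derivative[OF \<gamma> L] metric_act[OF g \<gamma> L] by auto
    ultimately have "a t / sqrt (G t) = a (L t) / sqrt (G (L t))"
      by (metis abs_of_pos mult_divide_mult_cancel_right less_irrefl real_sqrt_abs real_sqrt_mult)
    then have "u (\<alpha> \<gamma> z) = u z" using L u by (simp add: t lift_of_def)
    then show ?thesis using weight_act[OF \<gamma> z] by (simp add: w_def)
  qed (use weight_act[OF \<gamma> z] in \<open>simp add: w_def r_def\<close>)
  moreover have "\<l> (\<lambda>t. w (cis t) * G t) \<noteq> 0" if l: "\<l> \<in> functionals" for \<l>
  proof -
    from l consider t where "a t = 0" "cis t \<notin> orb" "\<l> = (\<lambda>D. a' t * D p - a' p * D t)"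
      | "reversing = {}" "\<l> = period" by (auto simp: functionals_def split: if_splits)
    then show ?thesis
    proof cases
      case 1
      then show ?thesis
        using weight_base weight_off_orbit[of "cis t"] simple[OF critical] critical G_pos[of t] 
        by (simp add: w_def u)
    next
      case 2
      have "period (\<lambda>t. w (cis t) * G t) = 
          period (\<lambda>t. weight (cis t) * G t + r * (u (cis t) * G t))" 
        by (simp add: w_def algebra_simps)
      also have "\<dots> = period (\<lambda>t. weight (cis t) * G t) + r * period (\<lambda>t. u (cis t) * G t)"
        using C2_functional_period pw unfolding C2_functional_def by blast
      also have "\<dots> \<noteq> 0" using period_u 2 by (simp add: r_def)
      finally show ?thesis using 2 by simp
    qed
  qed
  ultimately show ?thesis by blast
qed

lemma generic_open: "openin (Met_inv_topology \<Gamma> \<alpha>) generic"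
proof -
  have "generic = {g \<in> Met_circle. \<forall>\<l> \<in> functionals. \<l> (metric_coeff g) \<noteq> 0} \<inter> Met_inv \<Gamma> \<alpha>"
    by (auto simp: generic_def Met_inv_def)
  then show ?thesis
    unfolding Met_inv_topology_def openin_subtopology
    using openin_functionals_nonzero[OF finite_functionals C2_functionals] by blast
qed

lemma generic_dense: "Met_inv_topology \<Gamma> \<alpha> closure_of generic = Met_inv \<Gamma> \<alpha>"
proof -
  have "topspace Cinf_topology = Met_circle"
    using openin_Met_circle openin_subset openin_topspace openin_Cinf_topology by (metis subset_antisym)
  then have top: "topspace (Met_inv_topology \<Gamma> \<alpha>) = Met_inv \<Gamma> \<alpha>"
    by (auto simp: Met_inv_topology_def Met_inv_def)
  have "\<exists>h. h \<in> generic \<and> h \<in> T" if g: "g \<in> Met_inv \<Gamma> \<alpha>" and T: "g \<in> T" "openin (Met_inv_topology \<Gamma> \<alpha>) T" for g T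
  proof -
    obtain U where U: "openin Cinf_topology U" "T = U \<inter> Met_inv \<Gamma> \<alpha>"
      using T(2) unfolding Met_inv_topology_def openin_subtopology by blast
    obtain w where w: "smooth_circle w" and inv: "\<And>\<gamma> z. \<gamma> \<in> carrier \<Gamma> \<Longrightarrow> z \<in> circle \<Longrightarrow> w (\<alpha> \<gamma> z) = w z"
      and nz: "\<And>\<l>. \<l> \<in> functionals \<Longrightarrow> \<l> (\<lambda>t. w (cis t) * metric_coeff g t) \<noteq> 0"
      using direction_ex[OF g] by blast
    have gM: "g \<in> Met_circle" using g by (simp add: Met_inv_def)
    have gU: "g \<in> U" using T U by blast
    obtain s where s: "perturb g w s \<in> U" "\<forall>\<l> \<in> functionals. \<l> (metric_coeff (perturb g w s)) \<noteq> 0"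
      "\<And>t. 1 + s * w (cis t) > 0"
      using perturb_approximates[OF gM w finite_functionals, of U] C2_functionals nz U(1) gU by blast
    have "perturb g w s \<in> Met_circle" by (rule perturb_Met_circle[OF gM w s(3)])
    then have "perturb g w s \<in> Met_inv \<Gamma> \<alpha>"
      using g inv by (simp add: Met_inv_def perturb_def)
    then show ?thesis using s U by (auto simp: generic_def)
  qed
  then show ?thesis using top by (auto simp: closure_of_def generic_def)
qed

lemma generic_multiplier:
  assumes g: "g \<in> generic" and t: "a t = 0" and eq: "a' t / metric_coeff g t = a' p / metric_coeff g p"
  shows "cis t \<in> orb"
proof (rule ccontr)
  assume "cis t \<notin> orb"
  have gM: "g \<in> Met_circle" using g by (simp add: generic_def Met_inv_def)
  obtain k :: int where k: "0 \<le> t + 2 * pi * k" "t + 2 * pi * k < 2 * pi" using reduce_angle by blast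
  let ?t = "t + 2 * pi * k"
  have per: "periodic_smooth a" "periodic_smooth a'" "periodic_smooth (metric_coeff g)"
    using periodic_smooth periodic_smooth_vderiv periodic_smooth_metric_coeff[OF gM] by auto
  have shift: "a ?t = a t" "a' ?t = a' t" "metric_coeff g ?t = metric_coeff g t"
    by (rule periodic_int, use per in \<open>simp add: periodic_smooth_def\<close>)+
  have "cis ?t = cis t" using cis_eq_iff by blast
  then have "?t \<in> {t \<in> {0..2 * pi}. a t = 0 \<and> cis t \<notin> orb}"
    using t k \<open>cis t \<notin> orb\<close> shift(1) by simp
  from imageI[OF this, of "\<lambda>t D. a' t * D p - a' p * D t"]
  have "(\<lambda>D. a' ?t * D p - a' p * D ?t) \<in> functionals"
    unfolding functionals_def by (rule UnI1)
  moreover have "\<forall>\<l> \<in> functionals. \<l> (metric_coeff g) \<noteq> 0" using g by (simp add: generic_def)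
  ultimately have "a' ?t * metric_coeff g p - a' p * metric_coeff g ?t \<noteq> 0"
    by (rule bspec[rotated])
  then show False
    using eq metric_coeff_pos[OF gM, of t] metric_coeff_pos[OF gM, of p]
    unfolding shift by (simp add: field_simps)
qed

text \<open>Composition with elements of the group makes an automorphism orientation preserving, and then lets it fix
  \<open>p\<close>. For the second step the group element must preserve the orientation, which is achieved
  with an orientation reversing element of the stabilizer of \<open>p\<close>.\<close>

lemma generic_cover:
  assumes g: "g \<in> generic" and \<phi>: "\<phi> \<in> carrier (Aut_field (gradient g f))"
  shows "\<exists>\<gamma> \<in> carrier \<Gamma>. \<exists>s. \<phi> = flow (gradient g f) s \<otimes>\<^bsub>Aut_field (gradient g f)\<^esub> \<alpha> \<gamma>"
proof -
  have gi: "g \<in> Met_inv \<Gamma> \<alpha>" using g by (simp add: generic_def)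
  interpret gradient_field f g by unfold_locales (use gi in \<open>simp add: Met_inv_def\<close>)
  interpret A: group Aut by (rule field.group_Aut)
  interpret \<Gamma>: group \<Gamma> by (rule group_\<Gamma>)
  have act: "\<alpha> \<gamma> \<in> carrier Aut" if "\<gamma> \<in> carrier \<Gamma>" for \<gamma> by (rule act_Aut[OF gi that])
  have act_m: "\<alpha> (\<gamma> \<otimes>\<^bsub>\<Gamma>\<^esub> \<delta>) = \<alpha> \<gamma> \<otimes>\<^bsub>Aut\<^esub> \<alpha> \<delta>" if "\<gamma> \<in> carrier \<Gamma>" "\<delta> \<in> carrier \<Gamma>" for \<gamma> \<delta>
    using that act by (simp add: act_mult field.Aut_mult)
  have pres: "preserving (\<phi> \<otimes>\<^bsub>Aut\<^esub> \<psi>) \<longleftrightarrow> (preserving \<phi> \<longleftrightarrow> preserving \<psi>)"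
    if "\<phi> \<in> carrier Aut" "\<psi> \<in> carrier Aut" for \<phi> \<psi>
    using that preserving_compose_iff field.Aut_Diff by (simp add: field.Aut_mult)
  have act_one': "\<alpha> \<one>\<^bsub>\<Gamma>\<^esub> = \<one>\<^bsub>Aut\<^esub>"
    using act_m[of "\<one>\<^bsub>\<Gamma>\<^esub>" "\<one>\<^bsub>\<Gamma>\<^esub>"] act[of "\<one>\<^bsub>\<Gamma>\<^esub>"] A.l_cancel_one' by simp
  have act_inv': "\<alpha> (inv\<^bsub>\<Gamma>\<^esub> \<gamma>) = inv\<^bsub>Aut\<^esub> (\<alpha> \<gamma>)" if "\<gamma> \<in> carrier \<Gamma>" for \<gamma>
    using act_m[of "inv\<^bsub>\<Gamma>\<^esub> \<gamma>" \<gamma>] that act act_one' A.inv_equality[of "\<alpha> (inv\<^bsub>\<Gamma>\<^esub> \<gamma>)" "\<alpha> \<gamma>"] by simp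
  have "\<exists>\<gamma>\<^sub>0 \<in> carrier \<Gamma>. preserving (\<alpha> \<gamma>\<^sub>0 \<otimes>\<^bsub>Aut\<^esub> \<phi>)"
  proof (cases "preserving \<phi>")
    case True
    then show ?thesis using \<phi> act_one' by (intro bexI[of _ "\<one>\<^bsub>\<Gamma>\<^esub>"]) auto
  next
    case False
    have "reversing \<noteq> {}"
    proof
      assume "reversing = {}"
      then have "period \<in> functionals" by (simp add: functionals_def)
      then show False using g reversing_imp_period_0[OF \<phi> False] unfolding generic_def by blast
    qed
    then obtain \<rho> where "\<rho> \<in> carrier \<Gamma>" "\<not> preserving (\<alpha> \<rho>)" by (auto simp: reversing_def)
    then show ?thesis using False pres[OF act \<phi>] by (intro bexI[of _ \<rho>]) auto
  qed
  then obtain \<gamma>\<^sub>0 where \<gamma>\<^sub>0: "\<gamma>\<^sub>0 \<in> carrier \<Gamma>" and pres1: "preserving (\<alpha> \<gamma>\<^sub>0 \<otimes>\<^bsub>Aut\<^esub> \<phi>)" by blast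
  define \<phi>\<^sub>1 where "\<phi>\<^sub>1 = \<alpha> \<gamma>\<^sub>0 \<otimes>\<^bsub>Aut\<^esub> \<phi>"
  have \<phi>\<^sub>1: "\<phi>\<^sub>1 \<in> carrier Aut" using act \<gamma>\<^sub>0 \<phi> by (simp add: \<phi>\<^sub>1_def)
  obtain L where L: "lift_of \<phi>\<^sub>1 L" using field.Aut_lift_ex[OF \<phi>\<^sub>1] by blast
  have sym: "symmetry L" by (rule Aut_symmetry[OF \<phi>\<^sub>1 L])
  have "cis (L p) \<in> orb"
    using symmetry_zero_iff[OF sym] critical symmetry_multiplier[OF sym critical]
    by (intro generic_multiplier[OF g]) auto
  then obtain \<gamma>\<^sub>1 where \<gamma>\<^sub>1: "\<gamma>\<^sub>1 \<in> carrier \<Gamma>" "\<alpha> \<gamma>\<^sub>1 (cis p) = \<phi>\<^sub>1 (cis p)"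
    using L by (auto simp: orb_def lift_of_def)
  have "\<exists>\<gamma>\<^sub>2 \<in> carrier \<Gamma>. preserving (\<alpha> \<gamma>\<^sub>2) \<and> \<alpha> \<gamma>\<^sub>2 (cis p) = \<phi>\<^sub>1 (cis p)"
  proof (cases "preserving (\<alpha> \<gamma>\<^sub>1)")
    case False
    then obtain \<rho> where \<rho>: "\<rho> \<in> carrier \<Gamma>" "\<not> preserving (\<alpha> \<rho>)" "\<alpha> \<rho> (cis p) = cis p"
      using \<gamma>\<^sub>1 reversing_fixes unfolding reversing_def by blast
    have "preserving (\<alpha> (\<gamma>\<^sub>1 \<otimes>\<^bsub>\<Gamma>\<^esub> \<rho>))"
      using False \<rho> \<gamma>\<^sub>1 act pres by (simp add: act_m)
    moreover have "\<alpha> (\<gamma>\<^sub>1 \<otimes>\<^bsub>\<Gamma>\<^esub> \<rho>) (cis p) = \<phi>\<^sub>1 (cis p)"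
      using \<rho> \<gamma>\<^sub>1 by (simp add: act_mult compose_def)
    ultimately show ?thesis using \<rho> \<gamma>\<^sub>1 by blast
  qed (use \<gamma>\<^sub>1 in blast)
  then obtain \<gamma>\<^sub>2 where \<gamma>\<^sub>2: "\<gamma>\<^sub>2 \<in> carrier \<Gamma>" "preserving (\<alpha> \<gamma>\<^sub>2)" "\<alpha> \<gamma>\<^sub>2 (cis p) = \<phi>\<^sub>1 (cis p)" by blast
  define \<phi>\<^sub>2 where "\<phi>\<^sub>2 = \<alpha> (inv\<^bsub>\<Gamma>\<^esub> \<gamma>\<^sub>2) \<otimes>\<^bsub>Aut\<^esub> \<phi>\<^sub>1"
  have \<phi>\<^sub>2: "\<phi>\<^sub>2 \<in> carrier Aut" using act \<gamma>\<^sub>2 \<phi>\<^sub>1 by (simp add: \<phi>\<^sub>2_def)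
  have eq12: "\<phi>\<^sub>1 = \<alpha> \<gamma>\<^sub>2 \<otimes>\<^bsub>Aut\<^esub> \<phi>\<^sub>2"
    using act \<gamma>\<^sub>2 \<phi>\<^sub>1 by (simp add: \<phi>\<^sub>2_def act_inv' flip: A.m_assoc)
  have "\<exists>s. \<phi>\<^sub>2 = Fl s"
  proof (rule preserving_fixing_imp_flow[OF \<phi>\<^sub>2 _ critical])
    show "preserving \<phi>\<^sub>2"
      using pres1 pres[OF act[OF \<gamma>\<^sub>2(1)] \<phi>\<^sub>2] \<gamma>\<^sub>2(2) by (simp add: \<phi>\<^sub>1_def[symmetric] eq12[symmetric])
    have "\<phi>\<^sub>2 (cis p) = \<alpha> (inv\<^bsub>\<Gamma>\<^esub> \<gamma>\<^sub>2) (\<alpha> \<gamma>\<^sub>2 (cis p))"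
      using act \<gamma>\<^sub>2 \<phi>\<^sub>1 by (simp add: \<phi>\<^sub>2_def field.Aut_mult compose_def)
    then show "\<phi>\<^sub>2 (cis p) = cis p" using act_inv(1)[OF \<gamma>\<^sub>2(1)] by simp
  qed
  then obtain s where s: "\<phi>\<^sub>2 = Fl s" by blast
  have flow: "Fl s \<in> carrier Aut" by (rule field.flow_Aut)
  have comm: "\<psi> \<otimes>\<^bsub>Aut\<^esub> Fl s = Fl s \<otimes>\<^bsub>Aut\<^esub> \<psi>" if "\<psi> \<in> carrier Aut" for \<psi>
    using field.flow_commutes[OF that] that flow by (simp add: field.Aut_mult)
  have "\<phi> = inv\<^bsub>Aut\<^esub> (\<alpha> \<gamma>\<^sub>0) \<otimes>\<^bsub>Aut\<^esub> \<phi>\<^sub>1"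
    using act \<gamma>\<^sub>0 \<phi> by (simp add: \<phi>\<^sub>1_def flip: A.m_assoc)
  also have "\<dots> = \<alpha> (inv\<^bsub>\<Gamma>\<^esub> \<gamma>\<^sub>0 \<otimes>\<^bsub>\<Gamma>\<^esub> \<gamma>\<^sub>2) \<otimes>\<^bsub>Aut\<^esub> Fl s"
    using act \<gamma>\<^sub>0 \<gamma>\<^sub>2 flow by (simp add: eq12 s act_m act_inv' A.m_assoc)
  also have "\<dots> = Fl s \<otimes>\<^bsub>Aut\<^esub> \<alpha> (inv\<^bsub>\<Gamma>\<^esub> \<gamma>\<^sub>0 \<otimes>\<^bsub>\<Gamma>\<^esub> \<gamma>\<^sub>2)"
    using \<gamma>\<^sub>0 \<gamma>\<^sub>2 act by (intro comm) simp
  finally show ?thesis using \<gamma>\<^sub>0 \<gamma>\<^sub>2 by blast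
qed

text \<open>A flow map of finite order changes the time function by zero, so only the neutral element of the
  group acts as a flow map.\<close>

lemma generic_iso:
  assumes g: "g \<in> generic"
  shows "Aut_field (gradient g f) Mod range (flow (gradient g f)) \<cong> \<Gamma>"
proof -
  have gi: "g \<in> Met_inv \<Gamma> \<alpha>" using g by (simp add: generic_def)
  interpret gradient_field f g by unfold_locales (use gi in \<open>simp add: Met_inv_def\<close>)
  interpret \<Gamma>: group \<Gamma> by (rule group_\<Gamma>)
  interpret N: normal "range Fl" Aut by (rule field.normal_flow)
  have hom: "\<alpha> \<in> hom \<Gamma> Aut"
    using act_Aut[OF gi] by (intro homI) (auto simp: act_mult field.Aut_mult)
  interpret h: group_hom \<Gamma> Aut \<alpha>
    by (rule group_hom.intro) (use hom group_\<Gamma> N.group_axioms in \<open>auto simp: group_hom_axioms_def\<close>)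
  show ?thesis
  proof (rule N.Mod_iso_complement[OF group_\<Gamma> hom])
    fix \<gamma> assume \<gamma>: "\<gamma> \<in> carrier \<Gamma>" and "\<alpha> \<gamma> \<in> range Fl"
    then obtain s where s: "\<alpha> \<gamma> = Fl s" by blast
    have "Fl (real (order \<Gamma>) * s) = \<alpha> \<gamma> [^]\<^bsub>Aut\<^esub> order \<Gamma>" unfolding s flow_pow ..
    also have "\<dots> = \<alpha> (\<gamma> [^]\<^bsub>\<Gamma>\<^esub> order \<Gamma>)" using h.hom_nat_pow[OF \<gamma>] by simp
    also have "\<dots> = \<one>\<^bsub>Aut\<^esub>" using \<Gamma>.pow_order_eq_1[OF \<gamma>] h.hom_one by simp
    also have "\<one>\<^bsub>Aut\<^esub> = Fl 0" using flow_pow[of 0 0] by simp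
    finally have "real (order \<Gamma>) * s = 0" by (rule flow_periodic_imp_0)
    then have "s = 0" using finite_\<Gamma> \<Gamma>.order_gt_0_iff_finite by simp
    then have "\<alpha> \<gamma> = \<alpha> \<one>\<^bsub>\<Gamma>\<^esub>" using s h.hom_one flow_pow[of 0 0] by simp
    then show "\<gamma> = \<one>\<^bsub>\<Gamma>\<^esub>"
      using faithful_action.faithful[OF faithful] \<gamma> by (meson \<Gamma>.one_closed inj_onD)
  next
    fix \<phi> assume "\<phi> \<in> carrier Aut"
    then show "\<exists>\<gamma> \<in> carrier \<Gamma>. \<exists>n \<in> range Fl. \<phi> = n \<otimes>\<^bsub>Aut\<^esub> \<alpha> \<gamma>"
      using generic_cover[OF g] by blast
  qed
qed

end

theorem theorem2p1:
  fixes \<Gamma> :: "('a, 'b) monoid_scheme"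
    and \<alpha> :: "'a \<Rightarrow> complex \<Rightarrow> complex"
    and f :: "complex \<Rightarrow> real"
  assumes "group \<Gamma>" and "finite (carrier \<Gamma>)"
    and "smooth_effective_action \<Gamma> \<alpha>"
    and "Morse_circle f" and "invariant_function \<Gamma> \<alpha> f"
  shows "\<exists>Met_f. Met_f \<subseteq> Met_inv \<Gamma> \<alpha> \<and>
           openin (Met_inv_topology \<Gamma> \<alpha>) Met_f \<and>
           Met_inv_topology \<Gamma> \<alpha> closure_of Met_f = Met_inv \<Gamma> \<alpha> \<and>
           (\<forall>g \<in> Met_f.
              Aut_field (gradient g f) Mod range (flow (gradient g f)) \<cong> \<Gamma>)"
proof -
  interpret morse_action f \<Gamma> \<alpha>
    by (intro morse_action.intro morse_function.intro morse_action_axioms.intro assms)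
  obtain p where "a p = 0" "reversing \<noteq> {} \<longrightarrow> (\<exists>\<rho> \<in> reversing. \<alpha> \<rho> (cis p) = cis p)"
    using base_point_ex by blast
  then interpret based_morse_action f \<Gamma> \<alpha> p
    by unfold_locales auto
  have "generic \<subseteq> Met_inv \<Gamma> \<alpha>" by (auto simp: generic_def)
  then show ?thesis using generic_open generic_dense generic_iso by blast
qed

end
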